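(* Let $\Gamma_0^{(n)}(N)\backslash\mathfrak{H}_n^*$ be the Satake compactification of $\Gamma_0^{(n)}(N)\backslash\mathfrak{H}_n$, with $N$ squarefree. (1) Let $(l_{n-r},\dots,l_1)$ be an $r$-cusp represented by $\gamma$, and let $0\le s\le r$. Consider two $s$-cusps on the Satake compactification $\Gamma_\gamma^{(r)}\backslash\mathfrak{H}_r^*$ of the boundary component corresponding to $(l_{n-r},\dots,l_1)$. If these two $s$-cusps are equal when viewed as $s$-cusps of $\Gamma_0^{(n)}(N)\backslash\mathfrak{H}_n^*$, then they are also equal as $s$-cusps of the boundary component $\Gamma_\gamma^{(r)}\backslash\mathfrak{H}_r^*$ (whose group is conjugate to $\Gamma_0^{(r)}(N)$). In other words, no $r$-cusp can self-intersect at an $s$-cusp. (2) Let $(l_{n-s},\dots,l_1)$ be an $s$-cusp, where $0\le s<n-1$. Then the $(s+1)$-cusps on which $(l_{n-s},\dots,l_1)$ lies are precisely those of the form \[\left(l_{n-s}c_{n-s-1},\ \frac{l_{n-s-1}}{c_{n-s-1}}c_{n-s-2},\ \frac{l_{n-s-2}}{c_{n-s-2}}c_{n-s-3},\ \dots,\ \frac{l_2}{c_2}c_1\right),\] where $c_i\mid l_i$ for $1\le i\le n-s-1$.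
   Context: Let $n$ be a positive integer and $N$ a squarefree positive integer; $\Gamma_0^{(n)}(N)=\{\left(\begin{smallmatrix} A & B\\ C & D\end{smallmatrix}\right)\in \mathrm{Sp}_{2n}(\mathbf{Z}) : C\equiv 0 \bmod N\}$. The Satake compactification is $\Gamma_0^{(n)}(N)\backslash\mathfrak{H}_n^*$ with $\mathfrak{H}_n^*=\bigsqcup_{r=0}^n \mathrm{Sp}_{2n}(\mathbf{Q})\, j_{r,n}(\mathfrak{H}_r)$ inside the Grassmannian of isotropic $n$-planes in $\mathbf{C}^{2n}$, where $j_{r,n}(Z)$ is the class of $\left(\begin{smallmatrix}1_n\\ \mathrm{diag}(Z^{-1},0_{n-r})\end{smallmatrix}\right)$ and $\mathfrak{H}_0=\{\infty\}$. The $r$-cusps correspond to $\Gamma_0^{(n)}(N)\backslash \mathrm{Sp}_{2n}(\mathbf{Q})/P_{n,r}(\mathbf{Q})$, where $P_{n,r}$ is the stabiliser of $j_{r,n}(\mathfrak{H}_r)$, i.e. matrices $\left(\begin{smallmatrix} A_{11} & 0 & B_{11} & B_{12} \\ A_{21} & A_{22} & B_{21} & B_{22} \\ C_{11} & 0 & D_{11} & D_{12} \\ 0 & 0 & 0 & D_{22}\end{smallmatrix}\right)$ ($*_{11}$ of size $r$), with surjection $\omega_{n,r}:P_{n,r}\to\mathrm{Sp}_{2r}$ onto $\left(\begin{smallmatrix} A_{11} & B_{11}\\ C_{11} & D_{11}\end{smallmatrix}\right)$ and splitting $\xi_{r,n}$ (embedding $\left(\begin{smallmatrix} A & B\\ C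 & D\end{smallmatrix}\right)$ with identity in the remaining diagonal blocks). The $r$-cusp attached to $\gamma$ is $\Gamma_\gamma^{(r)}\backslash\mathfrak{H}_r^*$, $\Gamma_\gamma^{(r)}=\omega_{n,r}(\gamma^{-1}\Gamma_0^{(n)}(N)\gamma\cap P_{n,r}(\mathbf{Q}))$, embedded by $\Gamma_\gamma^{(r)}\rho\, j_{s,r}(Z)\mapsto \Gamma_0^{(n)}(N)\gamma\,\xi_{r,n}(\rho)\, j_{s,n}(Z)$; thus an $s$-cusp of it is an $s$-cusp of $\Gamma_0^{(n)}(N)\backslash\mathfrak{H}_n^*$. An $r$-cusp is identified with a tuple $(l_{n-r},\dots,l_1)$ of pairwise coprime positive divisors of $N$, represented by $\gamma=\gamma^{(n)}(l_{n-r})\xi_{n-1,n}(\gamma^{(n-1)}(l_{n-r-1}))\cdots\xi_{r+1,n}(\gamma^{(r+1)}(l_1))$, where $\gamma^{(m)}(l)\in\mathrm{Sp}_{2m}(\mathbf{Z})$ is congruent to $\left(\begin{smallmatrix}0&-1_m\\1_m&0\end{smallmatrix}\right)$ mod $l^2$ and to $1_{2m}$ mod $(N/l)^2$; these represent all $r$-cusps, and then $\Gamma_\gamma^{(r)}=\{\left(\begin{smallmatrix}A&B\\C&D\end{smallmatrix}\right)\in\mathrm{Sp}_{2r}(\mathbf{Z}): C\equiv0 \bmod l_0,\ B\equiv 0\bmod l_{n-r}\cdots l_1\}$ with $l_0=N/(l_{n-r}\cdots l_1)$. Equivalently, for $p\mid N$, $p\mid l_i$ iff the lower-right $(n-r)\times(n-r)$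 block of the $C$-block of a representative has rank $i$ mod $p$. An $s$-cusp lies on an $(s+1)$-cusp if it is one of the $s$-cusps of that boundary component. *)

theory Defs
  imports
    Complex_Main
    "HOL-Computational_Algebra.Squarefree"
    "HOL-Number_Theory.Cong"
    "Jordan_Normal_Form.Gauss_Jordan_Elimination"
begin

text \<open>Junk value if the matrix is singular; only applied to invertible matrices below.\<close>

definition minv :: "'a::field mat \<Rightarrow> 'a mat" where
  "minv A = the (mat_inverse A)"

subsection \<open>Symplectic groups\<close>

definition Jmat :: "nat \<Rightarrow> 'a::comm_ring_1 mat" where
  "Jmat n = four_block_mat (0\<^sub>m n n) (- 1\<^sub>m n) (1\<^sub>m n) (0\<^sub>m n n)"

definition Sp :: "nat \<Rightarrow> 'a::comm_ring_1 mat set" where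
  "Sp n = {M \<in> carrier_mat (2*n) (2*n). transpose_mat M * Jmat n * M = Jmat n}"

abbreviation rat_mat :: "int mat \<Rightarrow> rat mat" where
  "rat_mat \<equiv> map_mat of_int"

text \<open>The group is realised inside the rational symplectic group.\<close>

definition Gamma0 :: "nat \<Rightarrow> nat \<Rightarrow> rat mat set" where
  "Gamma0 n N = rat_mat ` {M \<in> Sp n. \<forall>i<n. \<forall>j<n. int N dvd M $$ (n + i, j)}"

text \<open>
  The parabolic \<open>P\<^sub>n\<^sub>,\<^sub>r\<close>. Rows and columns are cut into blocks of sizes
  \<open>r, n - r, r, n - r\<close>; the zero blocks are those in column block 2 of the row blocks
  1 and 3, and those in the column blocks 1, 2, 3 of row block 4.
\<close>

definition parabolic :: "nat \<Rightarrow> nat \<Rightarrow> rat mat set" where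
  "parabolic n r = {M \<in> Sp n.
     (\<forall>i<r. \<forall>j\<in>{r..<n}. M $$ (i, j) = 0 \<and> M $$ (n + i, j) = 0) \<and>
     (\<forall>i\<in>{r..<n}. \<forall>j<n + r. M $$ (n + i, j) = 0)}"

definition omega :: "nat \<Rightarrow> nat \<Rightarrow> 'a mat \<Rightarrow> 'a mat" where
  "omega n r M =
     (let f = (\<lambda>i. if i < r then i else n + (i - r))
      in mat (2*r) (2*r) (\<lambda>(i, j). M $$ (f i, f j)))"

definition xi :: "nat \<Rightarrow> nat \<Rightarrow> 'a::comm_ring_1 mat \<Rightarrow> 'a mat" where
  "xi r n M = (case split_block M r r of (A, B, C, D) \<Rightarrow>
     four_block_mat
       (diag_block_mat [A, 1\<^sub>m (n - r)]) (diag_block_mat [B, 0\<^sub>m (n - r) (n - r)])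
       (diag_block_mat [C, 0\<^sub>m (n - r) (n - r)]) (diag_block_mat [D, 1\<^sub>m (n - r)]))"

subsection \<open>The Satake compactification\<close>

text \<open>For \<open>r = 0\<close> this consists of the \<open>0 \<times> 0\<close> matrix only, which plays the role of \<open>\<infinity>\<close>.\<close>

definition Siegel :: "nat \<Rightarrow> complex mat set" where
  "Siegel r = {Z \<in> carrier_mat r r. transpose_mat Z = Z \<and>
     (\<forall>v\<in>carrier_vec r. v \<noteq> 0\<^sub>v r \<longrightarrow> 0 < v \<bullet> (map_mat Im Z *\<^sub>v v))}"

text \<open>
  A point of the Grassmannian, i.e. the class of a \<open>2n \<times> n\<close> matrix of rank \<open>n\<close> modulo
  right multiplication by \<open>GL\<^sub>n(\<complex>)\<close>, is represented by the column space of the matrix.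
\<close>

type_synonym plane = "complex vec set"

definition jpoint :: "nat \<Rightarrow> nat \<Rightarrow> complex mat \<Rightarrow> plane" where
  "jpoint r n Z =
     (\<lambda>x. (1\<^sub>m n @\<^sub>r diag_block_mat [minv Z, 0\<^sub>m (n - r) (n - r)]) *\<^sub>v x) ` carrier_vec n"

definition act :: "rat mat \<Rightarrow> plane \<Rightarrow> plane" where
  "act g V = (\<lambda>v. map_mat of_rat g *\<^sub>v v) ` V"

definition Siegel_star :: "nat \<Rightarrow> plane set" where
  "Siegel_star n = {act \<rho> (jpoint r n Z) | r \<rho> Z. r \<le> n \<and> \<rho> \<in> Sp n \<and> Z \<in> Siegel r}"

text \<open>A point of a quotient by a group \<open>G\<close> is a \<open>G\<close>-orbit of planes.\<close>

definition orbit :: "rat mat set \<Rightarrow> plane \<Rightarrow> plane set" where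
  "orbit G V = (\<lambda>g. act g V) ` G"

definition Satake :: "nat \<Rightarrow> rat mat set \<Rightarrow> plane set set" where
  "Satake n G = orbit G ` Siegel_star n"

subsection \<open>Cusps\<close>

definition boundary_group :: "nat \<Rightarrow> rat mat set \<Rightarrow> nat \<Rightarrow> rat mat \<Rightarrow> rat mat set" where
  "boundary_group n G r \<gamma> = omega n r ` ({minv \<gamma> * g * \<gamma> | g. g \<in> G} \<inter> parabolic n r)"

text \<open>
  With \<open>\<Gamma>\<^sub>\<gamma>\<close> the boundary group of \<open>\<gamma>\<close>, the boundary component is embedded by
  \<open>\<Gamma>\<^sub>\<gamma> \<rho> j\<^sub>s\<^sub>,\<^sub>r(Z) \<mapsto> G \<gamma> \<xi>\<^sub>r\<^sub>,\<^sub>n(\<rho>) j\<^sub>s\<^sub>,\<^sub>n(Z)\<close>. The following is the image of a set \<open>S\<close> of points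
  under this map.
\<close>

definition boundary_image ::
    "nat \<Rightarrow> rat mat set \<Rightarrow> nat \<Rightarrow> rat mat \<Rightarrow> plane set set \<Rightarrow> plane set set" where
  "boundary_image n G r \<gamma> S =
     {orbit G (act (\<gamma> * xi r n \<rho>) (jpoint s n Z)) | s \<rho> Z.
        s \<le> r \<and> \<rho> \<in> Sp r \<and> Z \<in> Siegel s \<and>
        orbit (boundary_group n G r \<gamma>) (act \<rho> (jpoint s r Z)) \<in> S}"

text \<open>A cusp is the whole embedded boundary component, including its own boundary.\<close>

definition cusp :: "nat \<Rightarrow> rat mat set \<Rightarrow> nat \<Rightarrow> rat mat \<Rightarrow> plane set set" where
  "cusp n G r \<gamma> = boundary_image n G r \<gamma> (Satake r (boundary_group n G r \<gamma>))"

definition cusps :: "nat \<Rightarrow> rat mat set \<Rightarrow> nat \<Rightarrow> plane set set set" where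
  "cusps n G r = cusp n G r ` Sp n"

definition lies_on :: "nat \<Rightarrow> rat mat set \<Rightarrow> nat \<Rightarrow> nat \<Rightarrow> plane set set \<Rightarrow> plane set set \<Rightarrow> bool" where
  "lies_on n G s r Y X \<longleftrightarrow>
     (\<exists>\<gamma>\<in>Sp n. X = cusp n G r \<gamma> \<and>
        Y \<in> boundary_image n G r \<gamma> ` cusps r (boundary_group n G r \<gamma>) s)"

subsection \<open>Cusps and tuples of divisors\<close>

definition mat_cong :: "nat \<Rightarrow> int mat \<Rightarrow> int mat \<Rightarrow> nat \<Rightarrow> bool" where
  "mat_cong m A B k \<longleftrightarrow> (\<forall>i<2*m. \<forall>j<2*m. [A $$ (i, j) = B $$ (i, j)] (mod int k))"

definition gamma_elt :: "nat \<Rightarrow> nat \<Rightarrow> nat \<Rightarrow> int mat \<Rightarrow> bool" where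
  "gamma_elt N m l g \<longleftrightarrow>
     g \<in> Sp m \<and> mat_cong m g (Jmat m) (l^2) \<and> mat_cong m g (1\<^sub>m (2*m)) ((N div l)^2)"

text \<open>
  \<open>std_rep n N m ls \<gamma>\<close>: \<open>\<gamma>\<close> is a product
  \<open>\<xi>\<^sub>m\<^sub>,\<^sub>n(g\<^sub>m) \<xi>\<^sub>m\<^sub>-\<^sub>1\<^sub>,\<^sub>n(g\<^sub>m\<^sub>-\<^sub>1) \<cdots>\<close> with one factor for each entry of \<open>ls\<close>, the factor \<open>g\<^sub>k\<close>
  being some choice of \<open>\<gamma>\<^sup>(\<^sup>k\<^sup>)(l)\<close>, where \<open>l\<close> is the entry belonging to it.
\<close>

fun std_rep :: "nat \<Rightarrow> nat \<Rightarrow> nat \<Rightarrow> nat list \<Rightarrow> int mat \<Rightarrow> bool" where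
  "std_rep n N m [] \<gamma> \<longleftrightarrow> \<gamma> = 1\<^sub>m (2*n)"
| "std_rep n N m (l # ls) \<gamma> \<longleftrightarrow>
     (\<exists>g h. gamma_elt N m l g \<and> std_rep n N (m - 1) ls h \<and> \<gamma> = xi m n g * h)"

definition is_tuple :: "nat \<Rightarrow> nat list \<Rightarrow> bool" where
  "is_tuple N ls \<longleftrightarrow> (\<forall>l\<in>set ls. l > 0 \<and> l dvd N) \<and> sorted_wrt coprime ls"

text \<open>
  The list \<open>ls\<close> is \<open>[l\<^sub>n\<^sub>-\<^sub>r, \<dots>, l\<^sub>1]\<close>, in this order; \<open>X\<close> is the \<open>r\<close>-cusp identified with it.
\<close>

definition has_tuple :: "nat \<Rightarrow> nat \<Rightarrow> nat \<Rightarrow> nat list \<Rightarrow> plane set set \<Rightarrow> bool" where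
  "has_tuple n N r ls X \<longleftrightarrow>
     is_tuple N ls \<and> length ls = n - r \<and>
     (\<exists>\<gamma>. std_rep n N n ls \<gamma> \<and> X = cusp n (Gamma0 n N) r (rat_mat \<gamma>))"

end

theory Submission
  imports Defs "Jordan_Normal_Form.Determinant"
begin

text \<open>
  Let \<open>W\<^sub>r\<close> be the span of the basis vectors \<open>r, \<dots>, n - 1\<close>. The maximal real subspace of the
  complex plane \<open>\<gamma> j\<^sub>r\<^sub>,\<^sub>n(\<i>)\<close> is \<open>\<gamma> W\<^sub>r\<close>, so \<open>r\<close>-cusps are orbits of rational isotropic subspaces of
  dimension \<open>n - r\<close>, and a cusp together with a cusp lying on it is an orbit of a flag of two such
  subspaces. For squarefree \<open>N\<close> an Iwasawa--Bruhat decomposition brings every flag into the form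
  \<open>w W\<^sub>s \<supseteq> w W\<^sub>r\<close> with \<open>w\<close> a Weyl element modulo each prime \<open>p | N\<close> that is \<open>1\<close> or \<open>J\<close> on every
  coordinate plane. Permuting the planes within each block shows that the orbit of the flag
  is determined by the two ranks modulo \<open>p\<close> of the projections of its members to the quotient by the
  Lagrangian subspace fixed by \<open>\<Gamma>\<^sub>0(N)\<close>. These ranks are invariants of the orbits of the two members;
  hence flags with a common smaller member and equivalent larger members are equivalent, which is (1).
  For (2), the rank of a hyperplane is that of the whole space or one less, independently for every
  \<open>p\<close>: the number \<open>c\<^sub>i\<close> collects the primes dividing \<open>l\<^sub>i\<close> whose rank \<open>i\<close> is kept.
\<close>

section \<open>Symplectic matrices\<close>

text \<open>Representatives are to be chosen independently at the primes p | N, yet all matrices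
  have to be symplectic over the integers. No strong approximation is invoked: an integer e that is
  0 or 1 modulo every p | N is fed into the matrix (1 - e^2, e^3 - 2e; e, 1 - e^2), which has
  determinant 1 identically, is the identity for e = 0 and J for e = 1. Weyl elements, coordinate
  swaps and existing standard representatives are all built from it, and the freedom left in Bezout
  coefficients is spent on congruences modulo the p | N. Squarefreeness allows membership in
  Gamma_0(N) to be tested prime by prime.

  A tuple is the same datum as the function that sends p to its rank: p | l_i means rank i, and the
  primes of rank 0 divide no entry. Statements about tuples thus become statements about one integer
  per prime. In (1) the equivalence of flags must still be pulled back to the boundary group: an
  element of Gamma_0(N) that preserves \<gamma> W_r acts on the boundary component through
  \<open>omega\<close>.\<close>

lemma sum_lessThan_double: "(\<Sum>k<2*n. f k) = (\<Sum>k<n. f k) + (\<Sum>k<n. f (n + k))"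
  for f :: "nat \<Rightarrow> 'a::comm_monoid_add"
proof -
  have "{..<2*n} = {..<n} \<union> {n..<2*n}" "{..<n} \<inter> {n..<2*n} = {}" by auto
  hence "(\<Sum>k<2*n. f k) = (\<Sum>k<n. f k) + (\<Sum>k\<in>{n..<2*n}. f k)"
    by (simp add: sum.union_disjoint)
  also have "(\<Sum>k\<in>{n..<2*n}. f k) = (\<Sum>k<n. f (n + k))"
    by (rule sum.reindex_bij_witness[of _ "\<lambda>k. n + k" "\<lambda>k. k - n"]) auto
  finally show ?thesis .
qed

lemma mult_vec_index_double:
  fixes M :: "'a::comm_ring_1 mat"
  assumes "M \<in> carrier_mat m (2*n)" "v \<in> carrier_vec (2*n)" "i < m"
  shows "(M *\<^sub>v v) $ i = (\<Sum>k<n. M $$ (i, k) * v $ k) + (\<Sum>k<n. M $$ (i, n + k) * v $ (n + k))"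
  using assms by (simp add: scalar_prod_def lessThan_atLeast0[symmetric] sum_lessThan_double)

lemma mult_vec_index:
  fixes M :: "'a::comm_ring_1 mat"
  assumes "M \<in> carrier_mat m n" "v \<in> carrier_vec n" "i < m"
  shows "(M *\<^sub>v v) $ i = (\<Sum>k<n. M $$ (i, k) * v $ k)"
  using assms by (simp add: scalar_prod_def lessThan_atLeast0[symmetric])

lemma mult_mat_index_double:
  fixes M :: "'a::comm_ring_1 mat"
  assumes "M \<in> carrier_mat m (2*n)" "L \<in> carrier_mat (2*n) p" "i < m" "j < p"
  shows "(M * L) $$ (i, j) = (\<Sum>k<n. M $$ (i, k) * L $$ (k, j)) + (\<Sum>k<n. M $$ (i, n + k) * L $$ (n + k, j))"
  using assms by (simp add: scalar_prod_def lessThan_atLeast0[symmetric] sum_lessThan_double)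

lemma sum_delta_mult:
  fixes z :: "'a::comm_ring_1" and k n :: nat
  assumes "k < n"
  shows "(\<Sum>l<n. (if k = l then z else 0) * f l) = z * f k"
    "(\<Sum>l<n. f l * (if l = k then u l else 0)) = f k * u k"
proof -
  have d: "(\<Sum>l<n. if l = k then x else 0) = x" for x :: 'a using assms by simp
  have "(\<Sum>l<n. (if k = l then z else 0) * f l) = (\<Sum>l<n. if l = k then z * f k else 0)"
    by (rule sum.cong) auto
  thus "(\<Sum>l<n. (if k = l then z else 0) * f l) = z * f k" unfolding d .
  have "(\<Sum>l<n. f l * (if l = k then u l else 0)) = (\<Sum>l<n. if l = k then f k * u k else 0)"
    by (rule sum.cong) auto
  thus "(\<Sum>l<n. f l * (if l = k then u l else 0)) = f k * u k" unfolding d .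
qed

text \<open>Identities between block-structured matrices are later checked on vectors, where each
  factor acts coordinate by coordinate.\<close>

lemma mat_eq_via_action:
  fixes A :: "'a::comm_ring_1 mat"
  assumes "A \<in> carrier_mat m n" "B \<in> carrier_mat m n"
    "\<And>v. v \<in> carrier_vec n \<Longrightarrow> A *\<^sub>v v = B *\<^sub>v v"
  shows "A = B"
proof (rule eq_matI)
  fix i j assume ij: "i < dim_row B" "j < dim_col B"
  have "A *\<^sub>v unit_vec n j = B *\<^sub>v unit_vec n j" by (rule assms(3)) simp
  hence "(A *\<^sub>v unit_vec n j) $ i = (B *\<^sub>v unit_vec n j) $ i" by simp
  thus "A $$ (i, j) = B $$ (i, j)" using assms(1,2) ij
    by (simp add: scalar_prod_right_unit)
qed (use assms in auto)

text \<open>Over a commutative ring det B det A = 1 makes det B times the adjugate of A a right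
  inverse, and a right inverse coincides with a left one. The integral matrices need this
  generality.\<close>

lemma left_inverse_imp_right_inverse:
  fixes A :: "'a::comm_ring_1 mat"
  assumes A: "A \<in> carrier_mat n n" and B: "B \<in> carrier_mat n n" and BA: "B * A = 1\<^sub>m n"
  shows "A * B = 1\<^sub>m n"
proof -
  define C where "C = det B \<cdot>\<^sub>m adj_mat A"
  have ad: "adj_mat A \<in> carrier_mat n n" "A * adj_mat A = det A \<cdot>\<^sub>m 1\<^sub>m n"
    using adj_mat[OF A] by auto
  have C: "C \<in> carrier_mat n n" using ad by (simp add: C_def)
  have d: "det B * det A = 1" using det_mult[OF B A] BA by simp
  have "A * C = det B \<cdot>\<^sub>m (det A \<cdot>\<^sub>m 1\<^sub>m n)"
    using ad A by (simp add: C_def mult_smult_distrib)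
  also have "\<dots> = 1\<^sub>m n" by (rule eq_matI) (auto simp: d mult.assoc[symmetric])
  finally have AC: "A * C = 1\<^sub>m n" .
  have "B = B * (A * C)" using AC B by simp
  also have "\<dots> = B * A * C" using A B C by (intro assoc_mult_mat[symmetric]) auto
  also have "\<dots> = C" using BA C by simp
  finally show ?thesis using AC by simp
qed

text \<open>Guards against the default value of \<open>minv\<close>: a one-sided inverse shows that
  \<open>mat_inverse\<close> succeeds and identifies its result.\<close>

lemma minv_eq:
  assumes "A \<in> carrier_mat n n" "B \<in> carrier_mat n n" "B * A = 1\<^sub>m n"
  shows "minv A = B"
proof -
  have AB: "A * B = 1\<^sub>m n" using assms left_inverse_imp_right_inverse by blast
  have "A \<in> Units (ring_mat TYPE('a) n ())"
    unfolding Units_def using assms AB by (auto simp: ring_mat_simps)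
  then obtain C where C: "mat_inverse A = Some C" using mat_inverse(1)[OF assms(1)] by fastforce
  with mat_inverse(2)[OF assms(1) C] have c: "A * C = 1\<^sub>m n" "C \<in> carrier_mat n n" by auto
  have "B = B * (A * C)" using c assms by simp
  also have "\<dots> = B * A * C" using assms c by (intro assoc_mult_mat[symmetric]) auto
  also have "\<dots> = C" using assms c by simp
  finally show ?thesis using C by (simp add: minv_def)
qed

section \<open>The symplectic form and the inverse of a symplectic matrix\<close>

definition sform :: "nat \<Rightarrow> 'a::comm_ring_1 vec \<Rightarrow> 'a vec \<Rightarrow> 'a" where
  "sform n v w = (\<Sum>k<n. v $ (n + k) * w $ k - v $ k * w $ (n + k))"

lemma Jmat_carrier [simp]: "Jmat n \<in> carrier_mat (2*n) (2*n)"
  by (auto simp: Jmat_def mult_2)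

lemma dim_Jmat [simp]: "dim_row (Jmat n) = 2*n" "dim_col (Jmat n) = 2*n"
  by (simp_all add: Jmat_def)

lemma Jmat_index: "i < 2*n \<Longrightarrow> j < 2*n \<Longrightarrow>
    Jmat n $$ (i, j) = (if i < n then if j = n + i then -1 else 0 else if j + n = i then 1 else 0)"
  by (auto simp: Jmat_def)

lemma Jmat_mult_vec:
  assumes "v \<in> carrier_vec (2*n)"
  shows "Jmat n *\<^sub>v v = vec (2*n) (\<lambda>i. if i < n then - v $ (n + i) else v $ (i - n))"
proof (rule eq_vecI)
  fix i assume i: "i < dim_vec (vec (2*n) (\<lambda>i. if i < n then - v $ (n + i) else v $ (i - n)))"
  have "(Jmat n *\<^sub>v v) $ i = (\<Sum>k<n. Jmat n $$ (i, k) * v $ k) + (\<Sum>k<n. Jmat n $$ (i, n + k) * v $ (n + k))"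
    using i assms by (intro mult_vec_index_double) auto
  also have "\<dots> = (if i < n then - v $ (n + i) else v $ (i - n))"
  proof (cases "i < n")
    case True
    hence "(\<Sum>k<n. Jmat n $$ (i, k) * v $ k) = 0" by (auto intro!: sum.neutral simp: Jmat_index)
    moreover have "(\<Sum>k<n. Jmat n $$ (i, n + k) * v $ (n + k)) = (\<Sum>k<n. if k = i then - v $ (n + i) else 0)"
      using True by (intro sum.cong) (auto simp: Jmat_index)
    ultimately show ?thesis using True by simp
  next
    case False
    hence "(\<Sum>k<n. Jmat n $$ (i, n+k) * v $ (n+k)) = 0" using i by (auto intro!: sum.neutral simp: Jmat_index)
    moreover have "(\<Sum>k<n. Jmat n $$ (i, k) * v $ k) = (\<Sum>k<n. if k = i - n then v $ (i - n) else 0)"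
      using False i by (intro sum.cong) (auto simp: Jmat_index)
    ultimately show ?thesis using False i by simp
  qed
  finally show "(Jmat n *\<^sub>v v) $ i = vec (2*n) (\<lambda>i. if i < n then - v $ (n + i) else v $ (i - n)) $ i"
    using i by simp
qed (use assms in auto)

lemma sform_Jmat:
  assumes "v \<in> carrier_vec (2*n)" "w \<in> carrier_vec (2*n)"
  shows "sform n v w = v \<bullet> (Jmat n *\<^sub>v w)"
  using assms
  by (simp add: Jmat_mult_vec scalar_prod_def lessThan_atLeast0[symmetric] sum_lessThan_double
      sform_def sum_subtractf sum_negf)

lemma sform_unit_vec:
  assumes "i < 2*n" "j < 2*n"
  shows "sform n (unit_vec (2*n) i) (unit_vec (2*n) j) = Jmat n $$ (i, j)"
  using assms
  by (simp add: sform_Jmat scalar_prod_left_unit[of _ "2*n"] mult_mat_vec_def scalar_prod_right_unit)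

lemma Sp_carrier: "M \<in> Sp n \<Longrightarrow> M \<in> carrier_mat (2*n) (2*n)"
  by (simp add: Sp_def)

lemma sform_mult:
  assumes M: "M \<in> carrier_mat (2*n) (2*n)" and v: "v \<in> carrier_vec (2*n)" and w: "w \<in> carrier_vec (2*n)"
  shows "sform n (M *\<^sub>v v) (M *\<^sub>v w) = v \<bullet> ((transpose_mat M * Jmat n * M) *\<^sub>v w)"
proof -
  have c: "M *\<^sub>v v \<in> carrier_vec (2*n)" "M *\<^sub>v w \<in> carrier_vec (2*n)"
    using M v w by (auto intro: mult_mat_vec_carrier)
  have Jc: "Jmat n *\<^sub>v (M *\<^sub>v w) \<in> carrier_vec (2*n)"
    by (rule mult_mat_vec_carrier[OF Jmat_carrier c(2)])
  have T: "transpose_mat M \<in> carrier_mat (2*n) (2*n)" using M by simp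
  have "sform n (M *\<^sub>v v) (M *\<^sub>v w) = (M *\<^sub>v v) \<bullet> (Jmat n *\<^sub>v (M *\<^sub>v w))"
    by (rule sform_Jmat[OF c])
  also have "\<dots> = (Jmat n *\<^sub>v (M *\<^sub>v w)) \<bullet> (M *\<^sub>v v)"
    by (rule comm_scalar_prod[OF c(1) Jc])
  also have "\<dots> = (transpose_mat M *\<^sub>v (Jmat n *\<^sub>v (M *\<^sub>v w))) \<bullet> v"
    by (rule transpose_vec_mult_scalar[OF M v Jc, symmetric])
  also have "\<dots> = v \<bullet> (transpose_mat M *\<^sub>v (Jmat n *\<^sub>v (M *\<^sub>v w)))"
    by (rule comm_scalar_prod[OF mult_mat_vec_carrier[OF T Jc] v])
  also have "transpose_mat M *\<^sub>v (Jmat n *\<^sub>v (M *\<^sub>v w)) = transpose_mat M * Jmat n *\<^sub>v (M *\<^sub>v w)"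
    by (rule assoc_mult_mat_vec[OF T Jmat_carrier c(2), symmetric])
  also have "\<dots> = (transpose_mat M * Jmat n * M) *\<^sub>v w"
    by (rule assoc_mult_mat_vec[OF mult_carrier_mat[OF T Jmat_carrier] M w, symmetric])
  finally show ?thesis .
qed

lemma Sp_sform:
  assumes "M \<in> Sp n" "v \<in> carrier_vec (2*n)" "w \<in> carrier_vec (2*n)"
  shows "sform n (M *\<^sub>v v) (M *\<^sub>v w) = sform n v w"
  using assms sform_mult[of M n v w] by (simp add: Sp_def sform_Jmat)

text \<open>The entries of M^T J M are the values of the form on the images of pairs of unit
  vectors.\<close>

lemma Sp_I:
  assumes M: "M \<in> carrier_mat (2*n) (2*n)"
    and "\<And>v w. v \<in> carrier_vec (2*n) \<Longrightarrow> w \<in> carrier_vec (2*n) \<Longrightarrow> sform n (M *\<^sub>v v) (M *\<^sub>v w) = sform n v w"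
  shows "M \<in> Sp n"
proof -
  have "transpose_mat M * Jmat n * M = Jmat n"
  proof (rule eq_matI)
    fix i j assume "i < dim_row (Jmat n :: 'a mat)" "j < dim_col (Jmat n :: 'a mat)"
    hence ij: "i < 2*n" "j < 2*n" by (auto simp: Jmat_def)
    have "sform n (M *\<^sub>v unit_vec (2*n) i) (M *\<^sub>v unit_vec (2*n) j) = Jmat n $$ (i, j)"
      using assms(2) sform_unit_vec[OF ij] by simp
    thus "(transpose_mat M * Jmat n * M) $$ (i, j) = Jmat n $$ (i, j)"
      unfolding sform_mult[OF M unit_vec_carrier unit_vec_carrier] using ij M
      by (subst (asm) scalar_prod_left_unit[of _ "2*n"])
        (auto simp: mult_mat_vec_def scalar_prod_right_unit simp del: index_mult_mat(1))
  qed (use M in \<open>auto simp: Jmat_def\<close>)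
  thus ?thesis using M by (simp add: Sp_def)
qed

lemma Sp_one [simp]: "1\<^sub>m (2*n) \<in> Sp n"
  by (rule Sp_I) auto

lemma Sp_mult:
  assumes "A \<in> Sp n" "B \<in> Sp n" shows "A * B \<in> Sp n"
proof (rule Sp_I)
  note c = Sp_carrier[OF assms(1)] Sp_carrier[OF assms(2)]
  show "A * B \<in> carrier_mat (2*n) (2*n)" using c by auto
  fix v w :: "'a vec" assume v: "v \<in> carrier_vec (2*n)" "w \<in> carrier_vec (2*n)"
  hence B: "B *\<^sub>v v \<in> carrier_vec (2*n)" "B *\<^sub>v w \<in> carrier_vec (2*n)" using c by auto
  show "sform n (A * B *\<^sub>v v) (A * B *\<^sub>v w) = sform n v w"
    unfolding assoc_mult_mat_vec[OF c v(1)] assoc_mult_mat_vec[OF c v(2)]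
    using Sp_sform[OF assms(1) B] Sp_sform[OF assms(2) v] by simp
qed

definition sinv :: "nat \<Rightarrow> 'a::comm_ring_1 mat \<Rightarrow> 'a mat" where
  "sinv n M = mat (2*n) (2*n) (\<lambda>(i, j).
     if i < n then (if j < n then M $$ (n + j, n + i) else - M $$ (j - n, n + i))
     else (if j < n then - M $$ (n + j, i - n) else M $$ (j - n, i - n)))"

lemma sinv_carrier [simp]: "sinv n M \<in> carrier_mat (2*n) (2*n)"
  by (simp add: sinv_def)

lemma Sp_columns:
  assumes "M \<in> Sp n" "i < 2*n" "j < 2*n"
  shows "(\<Sum>k<n. M $$ (n + k, i) * M $$ (k, j) - M $$ (k, i) * M $$ (n + k, j)) = Jmat n $$ (i, j)"
proof -
  note c = Sp_carrier[OF assms(1)]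
  have "sform n (M *\<^sub>v unit_vec (2*n) i) (M *\<^sub>v unit_vec (2*n) j) = Jmat n $$ (i, j)"
    using Sp_sform[OF assms(1)] sform_unit_vec[OF assms(2,3)] by simp
  thus ?thesis using c assms(2,3) unfolding sform_def
    by (simp add: scalar_prod_right_unit)
qed

lemma dim_sinv [simp]: "dim_row (sinv n M) = 2*n" "dim_col (sinv n M) = 2*n"
  by (simp_all add: sinv_def)

lemma sinv_left: "M \<in> Sp n \<Longrightarrow> sinv n M * M = 1\<^sub>m (2*n)"
proof (rule eq_matI)
  assume M: "M \<in> Sp n"
  note c = Sp_carrier[OF M]
  fix i j assume "i < dim_row (1\<^sub>m (2*n) :: 'a mat)" "j < dim_col (1\<^sub>m (2*n) :: 'a mat)"
  hence ij: "i < 2*n" "j < 2*n" by auto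
  have "(sinv n M * M) $$ (i, j) = (\<Sum>k<n. sinv n M $$ (i, k) * M $$ (k, j)) + (\<Sum>k<n. sinv n M $$ (i, n + k) * M $$ (n + k, j))"
    using ij c by (intro mult_mat_index_double[of _ "2*n" _ _ "2*n"]) auto
  also have "\<dots> = (if i = j then 1 else 0)"
  proof (cases "i < n")
    case True
    hence "Jmat n $$ (n + i, j) = (if i = j then 1 else 0 :: 'a)"
      using ij Jmat_index[of "n + i" n j] by auto
    thus ?thesis using True Sp_columns[OF M, of "n + i" j] ij
      by (simp add: sinv_def sum_subtractf sum_negf)
  next
    case False
    hence "Jmat n $$ (i - n, j) = (if i = j then - 1 else 0 :: 'a)"
      using ij by (subst Jmat_index) auto
    moreover have "i - n < n" using False ij by simp
    ultimately show ?thesis using False Sp_columns[OF M, of "i - n" j] ij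
      by (simp add: sinv_def sum_subtractf sum_negf algebra_simps)
  qed
  finally show "(sinv n M * M) $$ (i, j) = 1\<^sub>m (2*n) $$ (i, j)" using ij by simp
qed (use Sp_carrier in auto)

lemma sinv_right: "M \<in> Sp n \<Longrightarrow> M * sinv n M = 1\<^sub>m (2*n)"
  by (rule left_inverse_imp_right_inverse) (auto simp: sinv_left Sp_carrier)

lemma sinv_Sp: assumes "M \<in> Sp n" shows "sinv n M \<in> Sp n"
proof (rule Sp_I)
  fix v w :: "'a vec" assume v: "v \<in> carrier_vec (2*n)" "w \<in> carrier_vec (2*n)"
  have "sform n (sinv n M *\<^sub>v v) (sinv n M *\<^sub>v w) = sform n (M *\<^sub>v (sinv n M *\<^sub>v v)) (M *\<^sub>v (sinv n M *\<^sub>v w))"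
    using v by (intro Sp_sform[symmetric] assms mult_mat_vec_carrier[of _ "2*n" "2*n"]) simp_all
  also have "\<dots> = sform n v w"
    using v sinv_right[OF assms] Sp_carrier[OF assms]
    by (simp add: assoc_mult_mat_vec[symmetric, of _ "2*n" "2*n" _ "2*n"])
  finally show "sform n (sinv n M *\<^sub>v v) (sinv n M *\<^sub>v w) = sform n v w" .
qed simp

lemma minv_Sp: "M \<in> Sp n \<Longrightarrow> minv M = sinv n M"
  by (rule minv_eq) (auto simp: sinv_left Sp_carrier)

lemma Sp_cancel_left:
  assumes "M \<in> Sp n" "A \<in> carrier_mat (2*n) k"
  shows "sinv n M * (M * A) = A" "M * (sinv n M * A) = A"
  using assms Sp_carrier[OF assms(1)]
  by (simp_all add: assoc_mult_mat[symmetric, of _ "2*n" "2*n" _ "2*n" _ k] sinv_left sinv_right)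

lemma Sp_cancel_right:
  assumes "M \<in> Sp n" "A \<in> carrier_mat k (2*n)"
  shows "A * sinv n M * M = A" "A * M * sinv n M = A"
  using assms Sp_carrier[OF assms(1)]
  by (simp_all add: assoc_mult_mat[of _ k "2*n" _ "2*n" _ "2*n"] sinv_left sinv_right)

lemma sinv_unique:
  assumes "M \<in> Sp n" "A \<in> carrier_mat (2*n) (2*n)" "A * M = 1\<^sub>m (2*n)"
  shows "sinv n M = A"
proof -
  have "A * M * sinv n M = A" by (rule Sp_cancel_right(2)[OF assms(1,2)])
  thus ?thesis unfolding assms(3) by (simp add: left_mult_one_mat[of _ "2*n" "2*n"])
qed

lemma sinv_mult:
  assumes "A \<in> Sp n" "B \<in> Sp n" shows "sinv n (A * B) = sinv n B * sinv n A"
proof (rule sinv_unique)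
  note c = Sp_carrier[OF assms(1)] Sp_carrier[OF assms(2)]
  have "sinv n B * sinv n A * (A * B) = sinv n B * (sinv n A * (A * B))"
    using c by (intro assoc_mult_mat[of _ "2*n" "2*n" _ "2*n" _ "2*n"]) auto
  thus "sinv n B * sinv n A * (A * B) = 1\<^sub>m (2*n)"
    using Sp_cancel_left(1)[OF assms(1) c(2)] sinv_left[OF assms(2)] by simp
qed (use assms in \<open>auto simp: Sp_mult\<close>)

lemma sinv_sinv: assumes "M \<in> Sp n" shows "sinv n (sinv n M) = M"
  by (rule sinv_unique) (use assms in \<open>auto simp: sinv_Sp sinv_right Sp_carrier\<close>)

section \<open>Passage between integral and rational matrices; the congruence subgroup\<close>

lemma rat_mat_Sp:
  assumes "M \<in> Sp n" shows "rat_mat M \<in> Sp n"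
proof -
  have c: "M \<in> carrier_mat (2*n) (2*n)" using assms by (rule Sp_carrier)
  have J: "rat_mat (Jmat n) = Jmat n" by (rule eq_matI) (auto simp: Jmat_index Jmat_def)
  have "transpose_mat (rat_mat M) * Jmat n * rat_mat M = rat_mat (transpose_mat M * Jmat n * M)"
    using c by (simp add: of_int_hom.mat_hom_mult[of _ "2*n" "2*n" _ "2*n"] J map_mat_transpose)
  thus ?thesis using assms c J by (simp add: Sp_def)
qed

lemma rat_mat_sinv: "M \<in> carrier_mat (2*n) (2*n) \<Longrightarrow> rat_mat (sinv n M) = sinv n (rat_mat M)"
  by (rule eq_matI) (auto simp: sinv_def)

lemma rat_mat_mult: "A \<in> carrier_mat n m \<Longrightarrow> B \<in> carrier_mat m k \<Longrightarrow> rat_mat (A * B) = rat_mat A * rat_mat B"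
  by (rule of_int_hom.mat_hom_mult)

lemma rat_mat_inj: "rat_mat A = rat_mat B \<Longrightarrow> A = B"
  by (rule of_int_hom.mat_hom_inj)

definition GammaZ :: "nat \<Rightarrow> nat \<Rightarrow> int mat set" where
  "GammaZ n N = {M \<in> Sp n. \<forall>i<n. \<forall>j<n. int N dvd M $$ (n + i, j)}"

lemma Gamma0_eq: "Gamma0 n N = rat_mat ` GammaZ n N"
  by (simp add: Gamma0_def GammaZ_def)

lemma GammaZ_mult:
  assumes "A \<in> GammaZ n N" "B \<in> GammaZ n N" shows "A * B \<in> GammaZ n N"
proof -
  have c: "A \<in> Sp n" "B \<in> Sp n" using assms by (auto simp: GammaZ_def)
  note cc = Sp_carrier[OF c(1)] Sp_carrier[OF c(2)]
  { fix i j assume ij: "i < n" "j < n"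
    have "(A * B) $$ (n+i, j) = (\<Sum>k<n. A $$ (n+i, k) * B $$ (k, j)) + (\<Sum>k<n. A $$ (n+i, n + k) * B $$ (n + k, j))"
      using cc ij by (intro mult_mat_index_double[of _ "2*n" _ _ "2*n"]) auto
    moreover have "int N dvd \<dots>"
      using assms ij by (intro dvd_add dvd_sum) (auto simp: GammaZ_def)
    ultimately have "int N dvd (A * B) $$ (n+i, j)" by simp }
  thus ?thesis using Sp_mult[OF c] by (simp add: GammaZ_def)
qed

lemma GammaZ_sinv: "A \<in> GammaZ n N \<Longrightarrow> sinv n A \<in> GammaZ n N"
  using sinv_Sp[of A n] by (auto simp: GammaZ_def) (simp add: sinv_def)

lemma GammaZ_one: "1\<^sub>m (2*n) \<in> GammaZ n N"
  by (simp add: GammaZ_def)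

definition is_subgroup :: "nat \<Rightarrow> rat mat set \<Rightarrow> bool" where
  "is_subgroup n G \<longleftrightarrow> G \<subseteq> Sp n \<and> 1\<^sub>m (2*n) \<in> G \<and> (\<forall>a\<in>G. \<forall>b\<in>G. a * b \<in> G) \<and> (\<forall>a\<in>G. sinv n a \<in> G)"

lemma Gamma0_subgroup: "is_subgroup n (Gamma0 n N)"
proof -
  have "1\<^sub>m (2*n) = rat_mat (1\<^sub>m (2*n))" by (simp add: of_int_hom.mat_hom_one)
  hence "1\<^sub>m (2*n) \<in> Gamma0 n N" unfolding Gamma0_eq using GammaZ_one by blast
  moreover have "rat_mat a * rat_mat b \<in> Gamma0 n N" if "a \<in> GammaZ n N" "b \<in> GammaZ n N" for a b
  proof -
    have "a \<in> carrier_mat (2*n) (2*n)" "b \<in> carrier_mat (2*n) (2*n)"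
      using that by (auto simp: GammaZ_def Sp_carrier)
    thus ?thesis using GammaZ_mult[OF that] by (auto simp: Gamma0_eq rat_mat_mult[symmetric])
  qed
  moreover have "sinv n (rat_mat a) \<in> Gamma0 n N" if "a \<in> GammaZ n N" for a
  proof -
    have "a \<in> carrier_mat (2*n) (2*n)"
      using that by (auto simp: GammaZ_def Sp_carrier)
    thus ?thesis using GammaZ_sinv[OF that] by (auto simp: Gamma0_eq rat_mat_sinv[symmetric])
  qed
  moreover have "Gamma0 n N \<subseteq> Sp n" by (auto simp: Gamma0_eq GammaZ_def rat_mat_Sp)
  ultimately show ?thesis by (auto simp: is_subgroup_def Gamma0_eq)
qed

section \<open>The parabolic subgroups\<close>

text \<open>\<open>emb\<close> lists the coordinates of the first r planes among those of all n
  planes; \<open>res\<close> forgets the other planes. On the annihilator of W_r the latter is the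
  projection to the quotient by W_r.\<close>

definition emb :: "nat \<Rightarrow> nat \<Rightarrow> nat \<Rightarrow> nat" where
  "emb r n i = (if i < r then i else n + (i - r))"

definition res :: "nat \<Rightarrow> nat \<Rightarrow> 'a vec \<Rightarrow> 'a vec" where
  "res r n v = vec (2*r) (\<lambda>i. v $ emb r n i)"

lemma emb_less: "r \<le> n \<Longrightarrow> i < 2*r \<Longrightarrow> emb r n i < 2*n"
  by (auto simp: emb_def)

lemma emb_simps [simp]: "i < r \<Longrightarrow> emb r n i = i" "emb r n (r + i) = n + i"
  by (auto simp: emb_def)

lemma res_carrier [simp]: "res r n v \<in> carrier_vec (2*r)"
  by (simp add: res_def)

lemma res_index [simp]: "i < r \<Longrightarrow> res r n v $ i = v $ i" "i < r \<Longrightarrow> res r n v $ (r + i) = v $ (n + i)"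
  by (auto simp: res_def)

lemma vec_eq_res:
  assumes "u \<in> carrier_vec (2*n)" "v \<in> carrier_vec (2*n)" "r \<le> n" "res r n u = res r n v"
    "\<And>i. r \<le> i \<Longrightarrow> i < n \<Longrightarrow> u $ i = v $ i \<and> u $ (n + i) = v $ (n + i)"
  shows "u = v"
proof (rule eq_vecI)
  fix i assume "i < dim_vec v"
  hence i: "i < 2*n" using assms(2) by auto
  consider "i < r" | "r \<le> i" "i < n" | "n \<le> i" "i < n + r" | "n + r \<le> i" by linarith
  thus "u $ i = v $ i"
  proof cases
    case 1 thus ?thesis using arg_cong[OF assms(4), of "\<lambda>x. x $ i"] by simp
  next
    case 2 thus ?thesis using assms(5) by simp
  next
    case 3
    hence "u $ (n + (i - n)) = v $ (n + (i - n))"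
      using arg_cong[OF assms(4), of "\<lambda>x. x $ (r + (i - n))"] by (subst (asm) (1 2) res_index) auto
    thus ?thesis using 3 by simp
  next
    case 4 thus ?thesis using assms(5)[of "i - n"] i by auto
  qed
qed (use assms in auto)

lemma dim_omega [simp]: "dim_row (omega n r M) = 2*r" "dim_col (omega n r M) = 2*r"
  by (simp_all add: omega_def Let_def)

lemma omega_carrier [simp]: "omega n r M \<in> carrier_mat (2*r) (2*r)"
  by (simp add: omega_def Let_def)

lemma omega_index: "i < 2*r \<Longrightarrow> j < 2*r \<Longrightarrow> omega n r M $$ (i, j) = M $$ (emb r n i, emb r n j)"
  by (simp add: omega_def Let_def emb_def)

lemma omega_map_mat: "r \<le> n \<Longrightarrow> M \<in> carrier_mat (2*n) (2*n) \<Longrightarrow> omega n r (map_mat f M) = map_mat f (omega n r M)"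
  by (rule eq_matI) (auto simp: omega_index emb_less)

lemma omega_one: "r \<le> n \<Longrightarrow> omega n r (1\<^sub>m (2*n)) = 1\<^sub>m (2*r)"
proof (rule eq_matI)
  fix i j assume rn: "r \<le> n" and "i < dim_row (1\<^sub>m (2*r) :: 'a mat)" "j < dim_col (1\<^sub>m (2*r) :: 'a mat)"
  hence ij: "i < 2*r" "j < 2*r" by auto
  moreover have "emb r n i = emb r n j \<longleftrightarrow> i = j" using ij rn by (auto simp: emb_def split: if_splits)
  ultimately show "omega n r (1\<^sub>m (2*n)) $$ (i, j) = 1\<^sub>m (2*r) $$ (i, j)"
    using emb_less[OF rn] by (simp add: omega_index)
qed auto

text \<open>Unlike \<open>parabolic\<close> this also applies to the integral and complex matrices below.\<close>

definition parab :: "nat \<Rightarrow> nat \<Rightarrow> 'a::zero mat \<Rightarrow> bool" where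
  "parab n r M \<longleftrightarrow> (\<forall>i<r. \<forall>j\<in>{r..<n}. M $$ (i, j) = 0 \<and> M $$ (n + i, j) = 0) \<and>
     (\<forall>i\<in>{r..<n}. \<forall>j<n + r. M $$ (n + i, j) = 0)"

lemma parabolic_eq: "parabolic n r = {M \<in> Sp n. parab n r M}"
  by (auto simp: parabolic_def parab_def)

lemma parab_emb:
  assumes "parab n r M" "i < 2*r" "k \<in> {r..<n}" shows "M $$ (emb r n i, k) = 0"
proof (cases "i < r")
  case False
  hence "i - r < r" using assms(2) by simp
  hence "M $$ (n + (i - r), k) = 0" using assms(1,3) unfolding parab_def by blast
  thus ?thesis using False by (simp add: emb_def)
qed (use assms in \<open>auto simp: parab_def\<close>)

lemma sum_restrict: "r \<le> n \<Longrightarrow> (\<And>k. r \<le> k \<Longrightarrow> k < n \<Longrightarrow> f k = 0) \<Longrightarrow> (\<Sum>k<n. f k) = (\<Sum>k<r. f k)"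
  for f :: "nat \<Rightarrow> 'a::comm_monoid_add"
  by (rule sum.mono_neutral_right) auto

text \<open>The conditions on x say that it lies in the annihilator of W_r. A parabolic matrix
  preserves this annihilator and acts on its quotient by W_r through \<open>omega\<close>.\<close>

lemma parab_res:
  fixes M :: "'a::comm_ring_1 mat"
  assumes M: "M \<in> carrier_mat (2*n) (2*n)" and p: "parab n r M" and rn: "r \<le> n"
    and x: "x \<in> carrier_vec (2*n)" "\<And>i. r \<le> i \<Longrightarrow> i < n \<Longrightarrow> x $ (n + i) = 0"
  shows "res r n (M *\<^sub>v x) = omega n r M *\<^sub>v res r n x"
    "r \<le> i \<Longrightarrow> i < n \<Longrightarrow> (M *\<^sub>v x) $ (n + i) = 0"
proof -
  show "res r n (M *\<^sub>v x) = omega n r M *\<^sub>v res r n x"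
  proof (rule eq_vecI)
    fix i assume "i < dim_vec (omega n r M *\<^sub>v res r n x)"
    hence i: "i < 2*r" by simp
    have "res r n (M *\<^sub>v x) $ i = (M *\<^sub>v x) $ emb r n i" using i by (simp add: res_def)
    also have "\<dots> = (\<Sum>k<n. M $$ (emb r n i, k) * x $ k) + (\<Sum>k<n. M $$ (emb r n i, n + k) * x $ (n + k))"
      by (rule mult_vec_index_double[OF M x(1)]) (use emb_less[OF rn i] in simp)
    also have "(\<Sum>k<n. M $$ (emb r n i, k) * x $ k) = (\<Sum>k<r. M $$ (emb r n i, k) * x $ k)"
      using parab_emb[OF p i] by (intro sum_restrict[OF rn]) auto
    also have "(\<Sum>k<n. M $$ (emb r n i, n + k) * x $ (n + k)) = (\<Sum>k<r. M $$ (emb r n i, n + k) * x $ (n + k))"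
      using x(2) by (intro sum_restrict[OF rn]) auto
    also have "(\<Sum>k<r. M $$ (emb r n i, k) * x $ k) + (\<Sum>k<r. M $$ (emb r n i, n + k) * x $ (n + k))
        = (\<Sum>k<r. omega n r M $$ (i, k) * res r n x $ k) + (\<Sum>k<r. omega n r M $$ (i, r + k) * res r n x $ (r + k))"
      using i by (simp add: omega_index)
    also have "\<dots> = (omega n r M *\<^sub>v res r n x) $ i"
      by (rule mult_vec_index_double[symmetric]) (use i in auto)
    finally show "res r n (M *\<^sub>v x) $ i = (omega n r M *\<^sub>v res r n x) $ i" .
  qed (simp add: res_def)
  assume i: "r \<le> i" "i < n"
  have "(M *\<^sub>v x) $ (n + i) = (\<Sum>k<n. M $$ (n + i, k) * x $ k) + (\<Sum>k<n. M $$ (n + i, n + k) * x $ (n + k))"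
    by (rule mult_vec_index_double[OF M x(1)]) (use i in simp)
  also have "(\<Sum>k<n. M $$ (n + i, k) * x $ k) = 0"
    using p i rn by (intro sum.neutral) (auto simp: parab_def)
  also have "(\<Sum>k<n. M $$ (n + i, n + k) * x $ (n + k)) = 0"
  proof (rule sum.neutral, rule ballI)
    fix k assume "k \<in> {..<n}"
    thus "M $$ (n + i, n + k) * x $ (n + k) = 0"
      using p i x(2)[of k] by (cases "k < r") (auto simp: parab_def)
  qed
  finally show "(M *\<^sub>v x) $ (n + i) = 0" by simp
qed

lemma parab_mult:
  fixes A B :: "'a::comm_ring_1 mat"
  assumes A: "A \<in> carrier_mat (2*n) (2*n)" "parab n r A"
    and B: "B \<in> carrier_mat (2*n) (2*n)" "parab n r B" and rn: "r \<le> n"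
  shows "parab n r (A * B)"
proof -
  note idx = mult_mat_index_double[OF A(1) B(1)]
  have z: "(\<Sum>k<n. A $$ (i, k) * B $$ (k, j)) + (\<Sum>k<n. A $$ (i, n + k) * B $$ (n + k, j)) = 0"
    if "i \<in> emb r n ` {..<2*r}" "j \<in> {r..<n}" for i j
  proof -
    have "(\<Sum>k<n. A $$ (i, k) * B $$ (k, j)) = 0"
    proof (rule sum.neutral, rule ballI)
      fix k assume "k \<in> {..<n}"
      thus "A $$ (i, k) * B $$ (k, j) = 0"
        using that parab_emb[OF A(2)] B(2) by (cases "k < r") (auto simp: parab_def)
    qed
    moreover have "(\<Sum>k<n. A $$ (i, n + k) * B $$ (n + k, j)) = 0"
    proof (rule sum.neutral, rule ballI)
      fix k assume "k \<in> {..<n}"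
      thus "A $$ (i, n + k) * B $$ (n + k, j) = 0"
        using that B(2) by (cases "k < r") (auto simp: parab_def)
    qed
    ultimately show ?thesis by simp
  qed
  show ?thesis unfolding parab_def
  proof (intro conjI allI impI ballI)
    fix i j assume ij: "i < r" "j \<in> {r..<n}"
    have e: "i \<in> emb r n ` {..<2*r}" "n + i \<in> emb r n ` {..<2*r}"
      using ij by (auto simp: image_iff intro: bexI[of _ i] bexI[of _ "r + i"])
    show "(A * B) $$ (i, j) = 0" using z[OF e(1) ij(2)] ij rn by (subst idx) auto
    show "(A * B) $$ (n + i, j) = 0" using z[OF e(2) ij(2)] ij rn by (subst idx) auto
  next
    fix i j assume ij: "i \<in> {r..<n}" "j < n + r"
    have "(\<Sum>k<n. A $$ (n + i, k) * B $$ (k, j)) = 0"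
      using A(2) ij by (intro sum.neutral) (auto simp: parab_def)
    moreover have "(\<Sum>k<n. A $$ (n + i, n + k) * B $$ (n + k, j)) = 0"
    proof (rule sum.neutral, rule ballI)
      fix k assume "k \<in> {..<n}"
      thus "A $$ (n + i, n + k) * B $$ (n + k, j) = 0"
        using ij A(2) B(2) by (cases "k < r") (auto simp: parab_def)
    qed
    ultimately show "(A * B) $$ (n + i, j) = 0" using ij rn by (subst idx) auto
  qed
qed

lemma parab_sinv: "r \<le> n \<Longrightarrow> parab n r M \<Longrightarrow> parab n r (sinv n M)"
proof -
  assume rn: "r \<le> n" and p: "parab n r M"
  have "M $$ (n + j, i) = 0" if "j < n" "r \<le> i" "i < n" for i j
    using p that by (cases "j < r") (auto simp: parab_def)
  thus ?thesis using rn p by (auto simp: parab_def sinv_def)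
qed

lemma parab_one: "r \<le> n \<Longrightarrow> parab n r (1\<^sub>m (2*n))"
  by (auto simp: parab_def)

lemma parab_map_mat: "f 0 = 0 \<Longrightarrow> M \<in> carrier_mat (2*n) (2*n) \<Longrightarrow> r \<le> n \<Longrightarrow> parab n r M \<Longrightarrow> parab n r (map_mat f M)"
  by (auto simp: parab_def)

lemma parab_rat_mat:
  assumes "M \<in> carrier_mat (2*n) (2*n)" "r \<le> n" "parab n r (rat_mat M)"
  shows "parab n r M"
proof -
  have "M $$ (i, j) = 0" if "i < 2*n" "j < 2*n" "rat_mat M $$ (i, j) = 0" for i j
    using assms(1) that by simp
  thus ?thesis using assms(2,3) unfolding parab_def by auto
qed

lemma omega_mult:
  fixes A B :: "'a::comm_ring_1 mat"
  assumes A: "A \<in> carrier_mat (2*n) (2*n)" "parab n r A"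
    and B: "B \<in> carrier_mat (2*n) (2*n)" "parab n r B" and rn: "r \<le> n"
  shows "omega n r (A * B) = omega n r A * omega n r B"
proof (rule eq_matI)
  fix i j assume "i < dim_row (omega n r A * omega n r B)" "j < dim_col (omega n r A * omega n r B)"
  hence ij: "i < 2*r" "j < 2*r" by auto
  have ej: "emb r n j < n + r" using ij by (auto simp: emb_def)
  have "omega n r (A * B) $$ (i, j) = (A * B) $$ (emb r n i, emb r n j)" using ij by (simp add: omega_index)
  also have "\<dots> = (\<Sum>k<n. A $$ (emb r n i, k) * B $$ (k, emb r n j)) + (\<Sum>k<n. A $$ (emb r n i, n + k) * B $$ (n + k, emb r n j))"
    by (rule mult_mat_index_double[OF A(1) B(1)]) (use ij emb_less[OF rn] in auto)
  also have "(\<Sum>k<n. A $$ (emb r n i, k) * B $$ (k, emb r n j)) = (\<Sum>k<r. A $$ (emb r n i, k) * B $$ (k, emb r n j))"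
    using parab_emb[OF A(2) ij(1)] by (intro sum_restrict[OF rn]) auto
  also have "(\<Sum>k<n. A $$ (emb r n i, n + k) * B $$ (n + k, emb r n j)) = (\<Sum>k<r. A $$ (emb r n i, n + k) * B $$ (n + k, emb r n j))"
    using B(2) ej by (intro sum_restrict[OF rn]) (auto simp: parab_def)
  also have "(\<Sum>k<r. A $$ (emb r n i, k) * B $$ (k, emb r n j)) + (\<Sum>k<r. A $$ (emb r n i, n + k) * B $$ (n + k, emb r n j))
     = (\<Sum>k<r. omega n r A $$ (i, k) * omega n r B $$ (k, j)) + (\<Sum>k<r. omega n r A $$ (i, r + k) * omega n r B $$ (r + k, j))"
    using ij by (simp add: omega_index)
  also have "\<dots> = (omega n r A * omega n r B) $$ (i, j)"
    by (rule mult_mat_index_double[of _ "2*r" _ _ "2*r", symmetric]) (use ij in auto)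
  finally show "omega n r (A * B) $$ (i, j) = (omega n r A * omega n r B) $$ (i, j)" .
qed auto

lemma sform_res:
  assumes "r \<le> n" "\<And>i. r \<le> i \<Longrightarrow> i < n \<Longrightarrow> x $ (n + i) = 0" "\<And>i. r \<le> i \<Longrightarrow> i < n \<Longrightarrow> y $ (n + i) = 0"
  shows "sform n x y = sform r (res r n x) (res r n y)"
  unfolding sform_def using assms by (subst sum_restrict[of r n]) auto

text \<open>The form on the annihilator of W_r descends to the quotient by W_r, where
  \<open>omega\<close> acts.\<close>

lemma omega_Sp:
  fixes M :: "'a::comm_ring_1 mat"
  assumes M: "M \<in> Sp n" "parab n r M" and rn: "r \<le> n"
  shows "omega n r M \<in> Sp r"
proof (rule Sp_I)
  fix v w :: "'a vec" assume v: "v \<in> carrier_vec (2*r)" and w: "w \<in> carrier_vec (2*r)"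
  \<comment> \<open>A section of the projection to the quotient: extension by zero.\<close>
  define ex where "ex = (\<lambda>u :: 'a vec. vec (2*n) (\<lambda>i. if i < r then u $ i else if n \<le> i \<and> i < n + r then u $ (r + (i - n)) else 0))"
  have ex: "ex u \<in> carrier_vec (2*n)" "\<And>i. r \<le> i \<Longrightarrow> i < n \<Longrightarrow> ex u $ (n + i) = 0" for u
    by (auto simp: ex_def)
  have rex: "res r n (ex u) = u" if "u \<in> carrier_vec (2*r)" for u
    using that rn by (intro eq_vecI) (auto simp: res_def ex_def emb_def)
  note c = Sp_carrier[OF M(1)]
  note pr = parab_res[OF c M(2) rn ex]
  have "sform r (omega n r M *\<^sub>v v) (omega n r M *\<^sub>v w) = sform r (res r n (M *\<^sub>v ex v)) (res r n (M *\<^sub>v ex w))"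
    by (simp add: pr(1) rex v w)
  also have "\<dots> = sform n (M *\<^sub>v ex v) (M *\<^sub>v ex w)"
    by (rule sform_res[symmetric]) (use rn pr(2) in auto)
  also have "\<dots> = sform n (ex v) (ex w)" by (rule Sp_sform[OF M(1) ex(1) ex(1)])
  also have "\<dots> = sform r v w" using sform_res[OF rn ex(2) ex(2)] rex v w by simp
  finally show "sform r (omega n r M *\<^sub>v v) (omega n r M *\<^sub>v w) = sform r v w" .
qed simp

lemma omega_sinv:
  assumes M: "M \<in> Sp n" "parab n r M" and rn: "r \<le> n"
  shows "omega n r (sinv n M) = sinv r (omega n r M)"
proof (rule sinv_unique[symmetric])
  show "omega n r (sinv n M) * omega n r M = 1\<^sub>m (2*r)"
    using omega_mult[OF _ parab_sinv[OF rn M(2)] Sp_carrier[OF M(1)] M(2) rn] sinv_left[OF M(1)] omega_one[OF rn]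
    by (metis sinv_carrier)
qed (use omega_Sp[OF M rn] in auto)

section \<open>The splitting of the parabolic subgroup\<close>

definition inF :: "nat \<Rightarrow> nat \<Rightarrow> nat \<Rightarrow> bool" where "inF r n i \<longleftrightarrow> i < r \<or> (n \<le> i \<and> i < n + r)"
definition unemb :: "nat \<Rightarrow> nat \<Rightarrow> nat \<Rightarrow> nat" where "unemb r n i = (if i < r then i else r + (i - n))"

lemma diag_block_mat_pair:
  "diag_block_mat [A, B] = four_block_mat A (0\<^sub>m (dim_row A) (dim_col B)) (0\<^sub>m (dim_row B) (dim_col A)) B"
  by (subst diag_block_mat.simps(2)) (simp only: Let_def diag_block_mat_singleton)

lemma diag_block_mat_corner:
  assumes "r \<le> n"
  shows "diag_block_mat [mat r r f, 1\<^sub>m (n - r)] =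
      mat n n (\<lambda>(i, j). if i < r \<and> j < r then f (i, j) else if i = j then 1 else 0)"
    "diag_block_mat [mat r r f, 0\<^sub>m (n - r) (n - r)] =
      mat n n (\<lambda>(i, j). if i < r \<and> j < r then f (i, j) else 0)"
  unfolding diag_block_mat_pair using assms by (auto intro!: eq_matI)

lemma xi_blocks:
  assumes "M \<in> carrier_mat (2*r) (2*r)" "r \<le> n"
  shows "xi r n M = four_block_mat
     (mat n n (\<lambda>(i, j). if i < r \<and> j < r then M $$ (i, j) else if i = j then 1 else 0))
     (mat n n (\<lambda>(i, j). if i < r \<and> j < r then M $$ (i, j + r) else 0))
     (mat n n (\<lambda>(i, j). if i < r \<and> j < r then M $$ (i + r, j) else 0))
     (mat n n (\<lambda>(i, j). if i < r \<and> j < r then M $$ (i + r, j + r) else if i = j then 1 else 0))"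
proof -
  have d: "dim_row M - r = r" "dim_col M - r = r" using assms by auto
  show ?thesis
    unfolding xi_def split_block_def Let_def d prod.case diag_block_mat_corner[OF assms(2)] ..
qed

lemma xi_carrier: "M \<in> carrier_mat (2*r) (2*r) \<Longrightarrow> r \<le> n \<Longrightarrow> xi r n M \<in> carrier_mat (2*n) (2*n)"
  unfolding mult_2[of n] by (subst xi_blocks) simp_all

lemma dim_xi [simp]:
  assumes "M \<in> carrier_mat (2*r) (2*r)" "r \<le> n"
  shows "dim_row (xi r n M) = 2*n" "dim_col (xi r n M) = 2*n"
  using xi_carrier[OF assms] by auto

lemma xi_index:
  assumes "M \<in> carrier_mat (2*r) (2*r)" "r \<le> n" "i < 2*n" "j < 2*n"
  shows "xi r n M $$ (i, j) = (if inF r n i \<and> inF r n j then M $$ (unemb r n i, unemb r n j)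
     else if i = j then 1 else 0)"
proof -
  have i: "i < n \<or> (\<exists>i'<n. i = n + i')" using assms(3) by presburger
  have j: "j < n \<or> (\<exists>j'<n. j = n + j')" using assms(4) by presburger
  show ?thesis
    unfolding xi_blocks[OF assms(1,2)] inF_def unemb_def using i j assms(2)
    by (elim disjE exE conjE) (simp_all add: add.commute[of _ r])
qed

lemma unemb_emb [simp]: "r \<le> n \<Longrightarrow> i < 2*r \<Longrightarrow> unemb r n (emb r n i) = i"
  by (auto simp: unemb_def emb_def)

lemma inF_emb [simp]: "r \<le> n \<Longrightarrow> i < 2*r \<Longrightarrow> inF r n (emb r n i)"
  by (auto simp: inF_def emb_def)

text \<open>On the first r planes \<open>xi\<close> acts as M, on the others as the identity.
  Symplecticity and multiplicativity are derived from this description.\<close>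

lemma xi_res:
  assumes M: "M \<in> carrier_mat (2*r) (2*r)" and rn: "r \<le> n" and v: "v \<in> carrier_vec (2*n)"
  shows "res r n (xi r n M *\<^sub>v v) = M *\<^sub>v res r n v"
    "r \<le> i \<Longrightarrow> i < n \<Longrightarrow> (xi r n M *\<^sub>v v) $ i = v $ i"
    "r \<le> i \<Longrightarrow> i < n \<Longrightarrow> (xi r n M *\<^sub>v v) $ (n + i) = v $ (n + i)"
proof -
  note idx = mult_vec_index_double[OF xi_carrier[OF M rn] v]
  note xidx = xi_index[OF M rn]
  have nF: "inF r n k" "inF r n (n + k)" "unemb r n k = k" "unemb r n (n + k) = r + k" if "k < r" for k
    using that rn by (auto simp: inF_def unemb_def)
  show "res r n (xi r n M *\<^sub>v v) = M *\<^sub>v res r n v"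
  proof (rule eq_vecI)
    fix i assume "i < dim_vec (M *\<^sub>v res r n v)"
    hence i: "i < 2*r" using M by simp
    have "res r n (xi r n M *\<^sub>v v) $ i = (xi r n M *\<^sub>v v) $ emb r n i" using i by (simp add: res_def)
    also have "\<dots> = (\<Sum>k<n. xi r n M $$ (emb r n i, k) * v $ k) + (\<Sum>k<n. xi r n M $$ (emb r n i, n + k) * v $ (n + k))"
      using emb_less[OF rn i] by (rule idx)
    also have "(\<Sum>k<n. xi r n M $$ (emb r n i, k) * v $ k) = (\<Sum>k<r. xi r n M $$ (emb r n i, k) * v $ k)"
      using i emb_less[OF rn i] rn by (intro sum_restrict[OF rn]) (auto simp: xidx inF_def, auto simp: emb_def split: if_splits)
    also have "(\<Sum>k<n. xi r n M $$ (emb r n i, n + k) * v $ (n + k)) = (\<Sum>k<r. xi r n M $$ (emb r n i, n + k) * v $ (n + k))"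
      using i emb_less[OF rn i] rn by (intro sum_restrict[OF rn]) (auto simp: xidx inF_def, auto simp: emb_def split: if_splits)
    also have "(\<Sum>k<r. xi r n M $$ (emb r n i, k) * v $ k) + (\<Sum>k<r. xi r n M $$ (emb r n i, n + k) * v $ (n + k))
        = (\<Sum>k<r. M $$ (i, k) * res r n v $ k) + (\<Sum>k<r. M $$ (i, r + k) * res r n v $ (r + k))"
      using i rn emb_less[OF rn i]
      by (intro arg_cong2[where f = "(+)"] sum.cong refl; subst xidx; simp add: nF)
    also have "\<dots> = (M *\<^sub>v res r n v) $ i"
      by (rule mult_vec_index_double[symmetric]) (use i M in auto)
    finally show "res r n (xi r n M *\<^sub>v v) $ i = (M *\<^sub>v res r n v) $ i" .
  qed (use M in \<open>simp add: res_def\<close>)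
  assume i: "r \<le> i" "i < n"
  have "(xi r n M *\<^sub>v v) $ i = (\<Sum>k<n. xi r n M $$ (i, k) * v $ k) + (\<Sum>k<n. xi r n M $$ (i, n + k) * v $ (n + k))"
    by (rule idx) (use i in simp)
  also have "\<dots> = (\<Sum>k<n. if k = i then v $ i else 0) + 0"
    using i by (intro arg_cong2[where f = "(+)"] sum.cong sum.neutral) (auto simp: xidx inF_def)
  finally show "(xi r n M *\<^sub>v v) $ i = v $ i" using i by simp
  have "(xi r n M *\<^sub>v v) $ (n + i) = (\<Sum>k<n. xi r n M $$ (n + i, k) * v $ k) + (\<Sum>k<n. xi r n M $$ (n + i, n + k) * v $ (n + k))"
    by (rule idx) (use i in simp)
  also have "\<dots> = 0 + (\<Sum>k<n. if k = i then v $ (n + i) else 0)"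
    using i by (intro arg_cong2[where f = "(+)"] sum.cong sum.neutral) (auto simp: xidx inF_def)
  finally show "(xi r n M *\<^sub>v v) $ (n + i) = v $ (n + i)" using i by simp
qed

lemma sform_split:
  assumes "r \<le> n"
  shows "sform n x y = sform r (res r n x) (res r n y) + (\<Sum>k\<in>{r..<n}. x $ (n + k) * y $ k - x $ k * y $ (n + k))"
proof -
  have "{..<n} = {..<r} \<union> {r..<n}" using assms by auto
  hence "sform n x y = (\<Sum>k<r. x $ (n + k) * y $ k - x $ k * y $ (n + k)) + (\<Sum>k\<in>{r..<n}. x $ (n + k) * y $ k - x $ k * y $ (n + k))"
    unfolding sform_def by (simp add: sum.union_disjoint ivl_disj_int)
  thus ?thesis by (simp add: sform_def)
qed

lemma xi_Sp: assumes M: "M \<in> Sp r" and rn: "r \<le> n" shows "xi r n M \<in> Sp n"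
proof (rule Sp_I)
  note c = Sp_carrier[OF M]
  show "xi r n M \<in> carrier_mat (2*n) (2*n)" by (rule xi_carrier[OF c rn])
  fix v w :: "'a vec" assume v: "v \<in> carrier_vec (2*n)" and w: "w \<in> carrier_vec (2*n)"
  show "sform n (xi r n M *\<^sub>v v) (xi r n M *\<^sub>v w) = sform n v w"
    using xi_res[OF c rn v] xi_res[OF c rn w] Sp_sform[OF M, of "res r n v" "res r n w"]
    by (simp add: sform_split[OF rn])
qed

lemma xi_mult:
  fixes A B :: "'a::comm_ring_1 mat"
  assumes A: "A \<in> carrier_mat (2*r) (2*r)" and B: "B \<in> carrier_mat (2*r) (2*r)" and rn: "r \<le> n"
  shows "xi r n (A * B) = xi r n A * xi r n B"
proof (rule mat_eq_via_action)
  note cc = xi_carrier[OF A rn] xi_carrier[OF B rn]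
  show "xi r n (A * B) \<in> carrier_mat (2*n) (2*n)" by (rule xi_carrier[OF _ rn]) (use A B in auto)
  show "xi r n A * xi r n B \<in> carrier_mat (2*n) (2*n)" using cc by auto
  fix v :: "'a vec" assume v: "v \<in> carrier_vec (2*n)"
  have AB: "A * B \<in> carrier_mat (2*r) (2*r)" using A B by auto
  have Bv: "xi r n B *\<^sub>v v \<in> carrier_vec (2*n)" using cc v by auto
  have "xi r n (A * B) *\<^sub>v v = xi r n A *\<^sub>v (xi r n B *\<^sub>v v)"
  proof (rule vec_eq_res[OF _ _ rn])
    show "xi r n (A * B) *\<^sub>v v \<in> carrier_vec (2*n)" using xi_carrier[OF AB rn] v by auto
    show "xi r n A *\<^sub>v (xi r n B *\<^sub>v v) \<in> carrier_vec (2*n)" using cc Bv by auto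
    show "res r n (xi r n (A * B) *\<^sub>v v) = res r n (xi r n A *\<^sub>v (xi r n B *\<^sub>v v))"
      unfolding xi_res(1)[OF AB rn v] xi_res(1)[OF A rn Bv] xi_res(1)[OF B rn v]
      by (rule assoc_mult_mat_vec[OF A B]) simp
  qed (simp add: xi_res[OF AB rn v] xi_res[OF A rn Bv] xi_res[OF B rn v])
  also have "\<dots> = xi r n A * xi r n B *\<^sub>v v" by (rule assoc_mult_mat_vec[OF cc v, symmetric])
  finally show "xi r n (A * B) *\<^sub>v v = xi r n A * xi r n B *\<^sub>v v" .
qed

lemma xi_one: "r \<le> n \<Longrightarrow> xi r n (1\<^sub>m (2*r)) = 1\<^sub>m (2*n)"
  by (rule eq_matI) (auto simp: xi_index inF_def unemb_def)

lemma xi_map_mat: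
  assumes "M \<in> carrier_mat (2*r) (2*r)" "r \<le> n" "f 0 = 0" "f 1 = 1"
  shows "xi r n (map_mat f M) = map_mat f (xi r n M)"
proof (rule eq_matI)
  have c: "map_mat f M \<in> carrier_mat (2*r) (2*r)" using assms by simp
  fix i j assume "i < dim_row (map_mat f (xi r n M))" "j < dim_col (map_mat f (xi r n M))"
  hence ij: "i < 2*n" "j < 2*n" using assms by auto
  have u: "unemb r n k < 2*r" if "inF r n k" for k
    using that assms(2) by (auto simp: inF_def unemb_def)
  show "xi r n (map_mat f M) $$ (i, j) = map_mat f (xi r n M) $$ (i, j)"
    using ij assms u by (simp add: xi_index[OF c assms(2) ij] xi_index[OF assms(1,2) ij])
qed (use assms in auto)

lemma omega_xi: "M \<in> carrier_mat (2*r) (2*r) \<Longrightarrow> r \<le> n \<Longrightarrow> omega n r (xi r n M) = M"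
  by (rule eq_matI) (auto simp: omega_index xi_index emb_less)

lemma parab_xi_ge: "M \<in> carrier_mat (2*r) (2*r) \<Longrightarrow> r \<le> t \<Longrightarrow> t \<le> n \<Longrightarrow> parab n t (xi r n M)"
  by (auto simp: parab_def xi_index inF_def unemb_def)

lemma parab_xi_le: "M \<in> carrier_mat (2*r) (2*r) \<Longrightarrow> s \<le> r \<Longrightarrow> r \<le> n \<Longrightarrow> parab r s M \<Longrightarrow> parab n s (xi r n M)"
  by (auto simp: parab_def xi_index inF_def unemb_def)

lemma parab_omega: "s \<le> r \<Longrightarrow> r \<le> n \<Longrightarrow> parab n s M \<Longrightarrow> parab r s (omega n r M)"
  by (auto simp: parab_def omega_index emb_def)

section \<open>The geometry of the cusps\<close>

lemma act_mult:
  assumes "A \<in> carrier_mat (2*n) (2*n)" "B \<in> carrier_mat (2*n) (2*n)" "V \<subseteq> carrier_vec (2*n)"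
  shows "act (A * B) V = act A (act B V)"
proof -
  have "(map_mat of_rat (A * B) :: complex mat) *\<^sub>v v = map_mat of_rat A *\<^sub>v (map_mat of_rat B *\<^sub>v v)" if "v \<in> V" for v
    using assms that unfolding of_rat_hom.mat_hom_mult[OF assms(1,2)]
    by (intro assoc_mult_mat_vec[of _ "2*n" "2*n" _ "2*n"]) auto
  thus ?thesis by (auto simp: act_def image_iff)
qed

lemma act_carrier: "A \<in> carrier_mat (2*n) (2*n) \<Longrightarrow> V \<subseteq> carrier_vec (2*n) \<Longrightarrow> act A V \<subseteq> carrier_vec (2*n)"
  by (auto simp: act_def)

lemma act_one: "V \<subseteq> carrier_vec (2*n) \<Longrightarrow> act (1\<^sub>m (2*n)) V = V"
  by (auto simp: act_def of_rat_hom.mat_hom_one subset_eq image_iff)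

lemma act_sinv:
  assumes "M \<in> Sp n" "V \<subseteq> carrier_vec (2*n)"
  shows "act (sinv n M) (act M V) = V" "act M (act (sinv n M) V) = V"
  using act_mult[OF sinv_carrier Sp_carrier[OF assms(1)] assms(2), of M] act_mult[OF Sp_carrier[OF assms(1)] sinv_carrier assms(2), of M]
    assms by (simp_all add: sinv_left sinv_right act_one)

lemma orbit_eq_iff:
  assumes G: "is_subgroup n G" and U: "U \<subseteq> carrier_vec (2*n)" and V: "V \<subseteq> carrier_vec (2*n)"
  shows "orbit G U = orbit G V \<longleftrightarrow> (\<exists>g\<in>G. U = act g V)"
proof
  assume e: "orbit G U = orbit G V"
  have "U = act (1\<^sub>m (2*n)) U" using act_one[OF U] by simp
  hence "U \<in> orbit G U" using G unfolding orbit_def is_subgroup_def by blast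
  thus "\<exists>g\<in>G. U = act g V" unfolding e by (auto simp: orbit_def)
next
  assume "\<exists>g\<in>G. U = act g V"
  then obtain g where g: "g \<in> G" "U = act g V" by blast
  have gS: "g \<in> Sp n" "\<And>h. h \<in> G \<Longrightarrow> h \<in> carrier_mat (2*n) (2*n)" using G g Sp_carrier by (auto simp: is_subgroup_def)
  have 1: "act h U = act (h * g) V" if "h \<in> G" for h
    using act_mult[OF gS(2)[OF that] gS(2)[OF g(1)] V] g(2) by simp
  have 2: "act h V = act (h * sinv n g) U" if "h \<in> G" for h
    using act_mult[OF gS(2)[OF that] sinv_carrier U] act_sinv(1)[OF gS(1) V] g(2) by simp
  have "h * g \<in> G" "h * sinv n g \<in> G" if "h \<in> G" for h
    using G g that by (auto simp: is_subgroup_def)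
  thus "orbit G U = orbit G V" using 1 2 unfolding orbit_def by blast
qed

text \<open>The preimage in the annihilator of the span of the basis vectors \<open>r, \<dots>, n - 1\<close>.\<close>

definition lift :: "nat \<Rightarrow> nat \<Rightarrow> plane \<Rightarrow> plane" where
  "lift r n V = {x \<in> carrier_vec (2*n). (\<forall>i\<in>{r..<n}. x $ (n + i) = 0) \<and> res r n x \<in> V}"

lemma lift_carrier: "lift r n V \<subseteq> carrier_vec (2*n)"
  by (auto simp: lift_def)

text \<open>Transitivity of the boundary embeddings, through which a cusp of a boundary component
  becomes a cusp of the whole space.\<close>

lemma lift_lift: "s \<le> r \<Longrightarrow> r \<le> n \<Longrightarrow> lift r n (lift s r V) = lift s n V"
proof -
  assume a: "s \<le> r" "r \<le> n"
  have r: "res s r (res r n x) = res s n x" for x :: "complex vec"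
    using a by (intro eq_vecI) (auto simp: res_def emb_def)
  have "(\<forall>i\<in>{r..<n}. x $ (n + i) = 0) \<and> (\<forall>i\<in>{s..<r}. res r n x $ (r + i) = 0) \<longleftrightarrow> (\<forall>i\<in>{s..<n}. x $ (n + i) = 0)"
    for x :: "complex vec"
  proof -
    have "{s..<n} = {s..<r} \<union> {r..<n}" using a by auto
    thus ?thesis by auto
  qed
  hence "(\<forall>i\<in>{r..<n}. x $ (n + i) = 0) \<and> res r n x \<in> lift s r V \<longleftrightarrow> (\<forall>i\<in>{s..<n}. x $ (n + i) = 0) \<and> res s n x \<in> V"
    for x unfolding lift_def using r[of x] by auto
  thus ?thesis unfolding lift_def[of r n] lift_def[of s n] by auto
qed

lemma act_lift_subset:
  assumes p: "p \<in> Sp n" "parab n r p" and rn: "r \<le> n"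
  shows "act p (lift r n V) \<subseteq> lift r n (act (omega n r p) V)"
proof
  let ?p = "map_mat of_rat p :: complex mat"
  have c: "?p \<in> carrier_mat (2*n) (2*n)" using Sp_carrier[OF p(1)] by simp
  have pp: "parab n r ?p" using parab_map_mat[of of_rat, OF _ Sp_carrier[OF p(1)] rn p(2)] by simp
  fix y assume "y \<in> act p (lift r n V)"
  then obtain x where x: "x \<in> lift r n V" "y = ?p *\<^sub>v x" by (auto simp: act_def)
  have x': "x \<in> carrier_vec (2*n)" "\<And>i. r \<le> i \<Longrightarrow> i < n \<Longrightarrow> x $ (n + i) = 0" "res r n x \<in> V"
    using x(1) by (auto simp: lift_def)
  have pr: "res r n y = omega n r ?p *\<^sub>v res r n x" "\<And>i. r \<le> i \<Longrightarrow> i < n \<Longrightarrow> y $ (n + i) = 0"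
    unfolding x(2) using parab_res[OF c pp rn x'(1)] x'(2) by blast+
  have "res r n y = map_mat of_rat (omega n r p) *\<^sub>v res r n x"
    unfolding pr(1) omega_map_mat[OF rn Sp_carrier[OF p(1)]] ..
  thus "y \<in> lift r n (act (omega n r p) V)"
    using pr(2) x' mult_mat_vec_carrier[OF c x'(1)] x(2) unfolding lift_def act_def by auto
qed

text \<open>The inclusion \<open>act_lift_subset\<close> is applied to p and to its inverse.\<close>

lemma act_lift:
  assumes p: "p \<in> Sp n" "parab n r p" and rn: "r \<le> n" and V: "V \<subseteq> carrier_vec (2*r)"
  shows "act p (lift r n V) = lift r n (act (omega n r p) V)"
proof
  show "act p (lift r n V) \<subseteq> lift r n (act (omega n r p) V)" by (rule act_lift_subset[OF p rn])
  note oS = omega_Sp[OF p rn]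
  have "act (sinv n p) (lift r n (act (omega n r p) V)) \<subseteq> lift r n (act (omega n r (sinv n p)) (act (omega n r p) V))"
    by (rule act_lift_subset[OF sinv_Sp[OF p(1)] parab_sinv[OF rn p(2)] rn])
  also have "\<dots> = lift r n V" unfolding omega_sinv[OF p rn] act_sinv(1)[OF oS V] ..
  finally have "act p (act (sinv n p) (lift r n (act (omega n r p) V))) \<subseteq> act p (lift r n V)"
    unfolding act_def by (rule image_mono)
  thus "lift r n (act (omega n r p) V) \<subseteq> act p (lift r n V)"
    unfolding act_sinv(2)[OF p(1) lift_carrier] .
qed

text \<open>Write Z = X + iY and let v = a + ib lie in the kernel. Then Xa = Yb and Xb = -Ya, and
  the symmetry of X gives b.Yb = b.Xa = Xb.a = -a.Ya; positivity of Y forces v = 0. Without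
  invertibility nothing would be known about \<open>minv Z\<close>, not even its size.\<close>

lemma Siegel_invertible:
  assumes Z: "Z \<in> Siegel r"
  shows "minv Z \<in> carrier_mat r r"
proof -
  have c: "Z \<in> carrier_mat r r" and sym: "transpose_mat Z = Z"
    and pos: "\<And>v. v \<in> carrier_vec r \<Longrightarrow> v \<noteq> 0\<^sub>v r \<Longrightarrow> 0 < v \<bullet> (map_mat Im Z *\<^sub>v v)"
    using Z by (auto simp: Siegel_def)
  have "det Z \<noteq> 0"
  proof
    assume "det Z = 0"
    then obtain v where v: "v \<in> carrier_vec r" "v \<noteq> 0\<^sub>v r" "Z *\<^sub>v v = 0\<^sub>v r"
      using det_0_iff_vec_prod_zero_field[OF c] by blast
    define a b X Y where "a = map_vec Re v" and "b = map_vec Im v" and "X = map_mat Re Z" and "Y = map_mat Im Z"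
    have cc: "a \<in> carrier_vec r" "b \<in> carrier_vec r" "X \<in> carrier_mat r r" "Y \<in> carrier_mat r r"
      using v c by (auto simp: a_def b_def X_def Y_def)
    have XT: "transpose_mat X = X"
      using arg_cong[OF sym, of "map_mat Re"] by (simp add: X_def map_mat_transpose)
    have comp: "(\<Sum>k<r. Z $$ (i, k) * v $ k) = 0" if "i < r" for i
      using arg_cong[OF v(3), of "\<lambda>u. u $ i"] that
      by (simp only: mult_vec_index[OF c v(1) that]) simp
    have 1: "X *\<^sub>v a = Y *\<^sub>v b"
    proof (rule eq_vecI)
      fix i assume "i < dim_vec (Y *\<^sub>v b)"
      hence i: "i < r" using cc by simp
      have "(\<Sum>k<r. X $$ (i, k) * a $ k) - (\<Sum>k<r. Y $$ (i, k) * b $ k) = Re (\<Sum>k<r. Z $$ (i, k) * v $ k)"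
        using i c v(1) by (simp add: X_def Y_def a_def b_def sum_subtractf)
      thus "(X *\<^sub>v a) $ i = (Y *\<^sub>v b) $ i"
        unfolding mult_vec_index[OF cc(3,1) i] mult_vec_index[OF cc(4,2) i] comp[OF i] by simp
    qed (use cc in auto)
    have 2: "X *\<^sub>v b = - (Y *\<^sub>v a)"
    proof (rule eq_vecI)
      fix i assume "i < dim_vec (- (Y *\<^sub>v a))"
      hence i: "i < r" using cc by simp
      have "(\<Sum>k<r. X $$ (i, k) * b $ k) + (\<Sum>k<r. Y $$ (i, k) * a $ k) = Im (\<Sum>k<r. Z $$ (i, k) * v $ k)"
        using i c v(1) by (simp add: X_def Y_def a_def b_def sum.distrib)
      hence "(X *\<^sub>v b) $ i + (Y *\<^sub>v a) $ i = 0"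
        unfolding mult_vec_index[OF cc(3,2) i] mult_vec_index[OF cc(4,1) i] comp[OF i] by simp
      thus "(X *\<^sub>v b) $ i = (- (Y *\<^sub>v a)) $ i" using i cc
        by (subst index_uminus_vec) (simp_all add: eq_neg_iff_add_eq_0 del: index_mult_mat_vec)
    qed (use cc in auto)
    have Ya: "Y *\<^sub>v a \<in> carrier_vec r" and Xb: "X *\<^sub>v b \<in> carrier_vec r"
      using cc by (auto intro: mult_mat_vec_carrier)
    have "b \<bullet> (Y *\<^sub>v b) = b \<bullet> (X *\<^sub>v a)" using 1 by simp
    also have "\<dots> = (X *\<^sub>v b) \<bullet> a" using transpose_vec_mult_scalar[OF cc(3) cc(1) cc(2)] XT by simp
    also have "\<dots> = a \<bullet> (X *\<^sub>v b)" by (rule comm_scalar_prod[OF Xb cc(1)])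
    also have "\<dots> = - (a \<bullet> (Y *\<^sub>v a))" unfolding 2 using scalar_prod_uminus_right[of a "Y *\<^sub>v a"] cc Ya by simp
    finally have sum0: "a \<bullet> (Y *\<^sub>v a) + b \<bullet> (Y *\<^sub>v b) = 0" by simp
    have nn: "u \<bullet> (Y *\<^sub>v u) \<ge> 0" if "u \<in> carrier_vec r" for u
    proof (cases "u = 0\<^sub>v r")
      case True
      have "Y *\<^sub>v u \<in> carrier_vec r" using cc(4) that by (auto intro: mult_mat_vec_carrier)
      thus ?thesis unfolding True by simp
    qed (use pos[OF that] in \<open>auto simp: Y_def\<close>)
    have "a \<noteq> 0\<^sub>v r \<or> b \<noteq> 0\<^sub>v r"
    proof (rule ccontr)
      assume "\<not> ?thesis"
      hence z: "a = 0\<^sub>v r" "b = 0\<^sub>v r" by auto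
      have "v = 0\<^sub>v r"
      proof (rule eq_vecI)
        fix i assume "i < dim_vec (0\<^sub>v r :: complex vec)"
        hence i: "i < r" by simp
        have "Re (v $ i) = 0" "Im (v $ i) = 0"
          using arg_cong[OF z(1), of "\<lambda>u. u $ i"] arg_cong[OF z(2), of "\<lambda>u. u $ i"] i v(1) by (auto simp: a_def b_def)
        thus "v $ i = 0\<^sub>v r $ i" using i by (simp add: complex_eq_iff)
      qed (use v in auto)
      thus False using v(2) by simp
    qed
    thus False using pos[of a] pos[of b] nn[of a] nn[of b] cc sum0 unfolding Y_def[symmetric] by fastforce
  qed
  hence "Z \<in> Units (ring_mat TYPE(complex) r ())"
    by (rule det_non_zero_imp_unit[OF c])
  then obtain B where B: "mat_inverse Z = Some B" using mat_inverse(1)[OF c] by fastforce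
  thus ?thesis using mat_inverse(2)[OF c B] by (simp add: minv_def)
qed

text \<open>The column space is the graph of diag(Z^-1, 0), which turns membership into linear
  equations for the lower half of x.\<close>

lemma jpoint_eq:
  assumes Z: "Z \<in> Siegel s" and sn: "s \<le> n"
  shows "jpoint s n Z = {x \<in> carrier_vec (2*n).
    (\<forall>i<s. x $ (n + i) = (\<Sum>k<s. minv Z $$ (i, k) * x $ k)) \<and> (\<forall>i\<in>{s..<n}. x $ (n + i) = 0)}"
proof -
  define D where "D = diag_block_mat [minv Z, 0\<^sub>m (n - s) (n - s)]"
  have d: "dim_row (minv Z) = s" "dim_col (minv Z) = s" using Siegel_invertible[OF Z] by auto
  have Dc: "D \<in> carrier_mat n n" unfolding D_def diag_block_mat_pair
    by (rule carrier_matI) (simp_all only: index_mat_four_block d index_zero_mat, simp_all add: sn)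
  have Di: "D $$ (i, k) = (if i < s \<and> k < s then minv Z $$ (i, k) else 0)" if "i < n" "k < n" for i k
    using that sn unfolding D_def diag_block_mat_pair by (auto simp add: d)
  have Dx: "(D *\<^sub>v x) $ i = (if i < s then \<Sum>k<s. minv Z $$ (i, k) * x $ k else 0)"
    if x: "x \<in> carrier_vec n" and i: "i < n" for x i
  proof -
    have "(D *\<^sub>v x) $ i = (\<Sum>k<n. D $$ (i, k) * x $ k)" by (rule mult_vec_index[OF Dc x i])
    also have "\<dots> = (\<Sum>k<s. D $$ (i, k) * x $ k)" using i by (intro sum_restrict[OF sn]) (auto simp: Di)
    also have "\<dots> = (if i < s then \<Sum>k<s. minv Z $$ (i, k) * x $ k else 0)"
      using i sn by (auto simp: Di)
    finally show ?thesis .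
  qed
  have J: "jpoint s n Z = (\<lambda>x. x @\<^sub>v (D *\<^sub>v x)) ` carrier_vec n"
    unfolding jpoint_def D_def[symmetric]
    by (rule image_cong) (simp_all add: mat_mult_append[OF one_carrier_mat Dc])
  show ?thesis
  proof (intro equalityI subsetI)
    fix y assume "y \<in> jpoint s n Z"
    then obtain x where x: "x \<in> carrier_vec n" "y = x @\<^sub>v (D *\<^sub>v x)" unfolding J by blast
    have yi: "y $ (n + i) = (if i < s then \<Sum>k<s. minv Z $$ (i, k) * x $ k else 0)" if "i < n" for i
      using x Dc that Dx[OF x(1) that] by simp
    have yk: "y $ k = x $ k" if "k < n" for k using x Dc that by simp
    have yc: "y \<in> carrier_vec (2*n)" unfolding x(2) mult_2
      by (intro append_carrier_vec x(1) mult_mat_vec_carrier[OF Dc])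
    show "y \<in> {x \<in> carrier_vec (2*n). (\<forall>i<s. x $ (n + i) = (\<Sum>k<s. minv Z $$ (i, k) * x $ k)) \<and> (\<forall>i\<in>{s..<n}. x $ (n + i) = 0)}"
      using yi yk yc sn by auto
  next
    fix y assume y: "y \<in> {x \<in> carrier_vec (2*n). (\<forall>i<s. x $ (n + i) = (\<Sum>k<s. minv Z $$ (i, k) * x $ k)) \<and> (\<forall>i\<in>{s..<n}. x $ (n + i) = 0)}"
    define x where "x = vec n (\<lambda>i. y $ i)"
    have x: "x \<in> carrier_vec n" by (simp add: x_def)
    have "y = x @\<^sub>v (D *\<^sub>v x)"
    proof (rule eq_vecI)
      fix i assume "i < dim_vec (x @\<^sub>v (D *\<^sub>v x))"
      hence "i < n + n" using carrier_vecD[OF x] carrier_matD[OF Dc] by simp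
      hence i: "i < n \<or> (\<exists>i'<n. i = n + i')" by presburger
      thus "y $ i = (x @\<^sub>v (D *\<^sub>v x)) $ i"
      proof (elim disjE exE conjE)
        assume "i < n" thus ?thesis using x Dc by (simp add: x_def)
      next
        fix i' assume i': "i' < n" "i = n + i'"
        have "y $ (n + i') = (if i' < s then \<Sum>k<s. minv Z $$ (i', k) * y $ k else 0)" using y i' by auto
        also have "\<dots> = (D *\<^sub>v x) $ i'" unfolding Dx[OF x i'(1)] using sn by (auto simp: x_def)
        finally show ?thesis using i' x Dc by simp
      qed
    qed (use y x Dc in auto)
    thus "y \<in> jpoint s n Z" unfolding J using x by blast
  qed
qed

text \<open>Both planes have the same equations once those for the coordinates n + i with s <= i < n
  are split at r. The boundary embedding thereby becomes \<open>lift\<close>, independent of how a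
  point is written as \<rho> j(Z).\<close>

lemma lift_jpoint:
  assumes Z: "Z \<in> Siegel s" and sr: "s \<le> r" and rn: "r \<le> n"
  shows "jpoint s n Z = lift r n (jpoint s r Z)"
proof -
  have "{s..<n} = {s..<r} \<union> {r..<n}" using sr rn by auto
  moreover have "res r n x \<in> jpoint s r Z \<longleftrightarrow>
      (\<forall>i<s. x $ (n + i) = (\<Sum>k<s. minv Z $$ (i, k) * x $ k)) \<and> (\<forall>i\<in>{s..<r}. x $ (n + i) = 0)" for x
    using sr by (auto simp: jpoint_eq[OF Z sr])
  ultimately show ?thesis using jpoint_eq[OF Z le_trans[OF sr rn]] by (auto simp: lift_def)
qed

lemma jpoint_carrier: "Z \<in> Siegel s \<Longrightarrow> s \<le> n \<Longrightarrow> jpoint s n Z \<subseteq> carrier_vec (2*n)"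
  by (auto simp: jpoint_eq)

lemma Siegel_star_carrier: "V \<in> Siegel_star r \<Longrightarrow> V \<subseteq> carrier_vec (2*r)"
  unfolding Siegel_star_def using act_carrier[OF Sp_carrier jpoint_carrier] by blast

text \<open>With 0 in V the lift of V contains W_r, the subspace by which a cusp is recognised
  later.\<close>

lemma Siegel_star_zero: assumes "V \<in> Siegel_star r" shows "0\<^sub>v (2*r) \<in> V"
proof -
  obtain s \<rho> Z where V: "V = act \<rho> (jpoint s r Z)" "s \<le> r" "\<rho> \<in> Sp r" "Z \<in> Siegel s"
    using assms by (auto simp: Siegel_star_def)
  have "0\<^sub>v (2*r) \<in> jpoint s r Z" unfolding jpoint_eq[OF V(4,2)] using V(2) by auto
  moreover have "map_mat of_rat \<rho> *\<^sub>v 0\<^sub>v (2*r) = (0\<^sub>v (2*r) :: complex vec)"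
    using Sp_carrier[OF V(3)] by auto
  ultimately show ?thesis unfolding V(1) act_def by (metis image_eqI)
qed

lemma Siegel_star_act: assumes "V \<in> Siegel_star r" "\<rho> \<in> Sp r" shows "act \<rho> V \<in> Siegel_star r"
proof -
  obtain s \<rho>' Z where V: "V = act \<rho>' (jpoint s r Z)" "s \<le> r" "\<rho>' \<in> Sp r" "Z \<in> Siegel s"
    using assms(1) by (auto simp: Siegel_star_def)
  have "act \<rho> V = act (\<rho> * \<rho>') (jpoint s r Z)"
    unfolding V(1)
    by (rule act_mult[OF Sp_carrier[OF assms(2)] Sp_carrier[OF V(3)] jpoint_carrier[OF V(4,2)], symmetric])
  thus ?thesis using Sp_mult[OF assms(2) V(3)] V by (auto simp: Siegel_star_def)
qed

lemma jpoint_Siegel_star: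
  assumes "Z \<in> Siegel s" "s \<le> r" shows "jpoint s r Z \<in> Siegel_star r"
proof -
  have "jpoint s r Z = act (1\<^sub>m (2*r)) (jpoint s r Z)"
    using act_one[OF jpoint_carrier[OF assms]] by simp
  thus ?thesis using assms Sp_one[of r] unfolding Siegel_star_def by blast
qed

lemma act_xi_lift:
  assumes "\<rho> \<in> Sp r" "r \<le> n" "V \<subseteq> carrier_vec (2*r)"
  shows "act (xi r n \<rho>) (lift r n V) = lift r n (act \<rho> V)"
  using act_lift[OF xi_Sp[OF assms(1,2)] parab_xi_ge[OF Sp_carrier[OF assms(1)]] assms(2,3)]
    omega_xi[OF Sp_carrier[OF assms(1)]] assms(2) by simp

lemma Siegel_star_lift: assumes "V \<in> Siegel_star r" "r \<le> n" shows "lift r n V \<in> Siegel_star n"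
proof -
  obtain s \<rho> Z where V: "V = act \<rho> (jpoint s r Z)" "s \<le> r" "\<rho> \<in> Sp r" "Z \<in> Siegel s"
    using assms(1) by (auto simp: Siegel_star_def)
  have "lift r n V = act (xi r n \<rho>) (jpoint s n Z)"
    unfolding V(1) lift_jpoint[OF V(4,2) assms(2)] by (intro act_xi_lift[symmetric] V assms(2) jpoint_carrier)
  thus ?thesis using xi_Sp[OF V(3) assms(2)] V le_trans[OF V(2) assms(2)] unfolding Siegel_star_def
    by blast
qed

section \<open>Boundary groups and embedded boundary components\<close>

lemma boundary_image_eq:
  assumes rn: "r \<le> n" and \<gamma>: "\<gamma> \<in> Sp n"
  shows "boundary_image n G r \<gamma> S =
    {orbit G (act \<gamma> (lift r n V)) | V. V \<in> Siegel_star r \<and> orbit (boundary_group n G r \<gamma>) V \<in> S}"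
proof -
  have e: "act (\<gamma> * xi r n \<rho>) (jpoint s n Z) = act \<gamma> (lift r n (act \<rho> (jpoint s r Z)))"
    if "s \<le> r" "\<rho> \<in> Sp r" "Z \<in> Siegel s" for s \<rho> Z
  proof -
    have c: "jpoint s r Z \<subseteq> carrier_vec (2*r)" "jpoint s n Z \<subseteq> carrier_vec (2*n)"
      using jpoint_carrier[OF that(3,1)] jpoint_carrier[OF that(3) le_trans[OF that(1) rn]] .
    have "act (\<gamma> * xi r n \<rho>) (jpoint s n Z) = act \<gamma> (act (xi r n \<rho>) (jpoint s n Z))"
      by (rule act_mult[OF Sp_carrier[OF \<gamma>] xi_carrier[OF Sp_carrier[OF that(2)] rn] c(2)])
    also have "act (xi r n \<rho>) (jpoint s n Z) = lift r n (act \<rho> (jpoint s r Z))"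
      unfolding lift_jpoint[OF that(3,1) rn] by (rule act_xi_lift[OF that(2) rn c(1)])
    finally show ?thesis .
  qed
  have "boundary_image n G r \<gamma> S = {orbit G (act \<gamma> (lift r n (act \<rho> (jpoint s r Z)))) | s \<rho> Z.
        s \<le> r \<and> \<rho> \<in> Sp r \<and> Z \<in> Siegel s \<and>
        orbit (boundary_group n G r \<gamma>) (act \<rho> (jpoint s r Z)) \<in> S}"
    unfolding boundary_image_def by (intro Collect_cong ex_cong1) (auto simp: e)
  thus ?thesis unfolding Siegel_star_def by auto
qed

lemma cusp_eq:
  assumes rn: "r \<le> n" and \<gamma>: "\<gamma> \<in> Sp n"
  shows "cusp n G r \<gamma> = {orbit G (act \<gamma> (lift r n V)) | V. V \<in> Siegel_star r}"
  unfolding cusp_def boundary_image_eq[OF assms] Satake_def by blast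

lemma assoc_mult_square:
  fixes A :: "'a::comm_ring_1 mat"
  shows "A \<in> carrier_mat n n \<Longrightarrow> B \<in> carrier_mat n n \<Longrightarrow> C \<in> carrier_mat n n \<Longrightarrow> A * B * C = A * (B * C)"
  by (rule assoc_mult_mat)

text \<open>Parametrised by the parabolic element q instead of the element of G, so that closure
  under products and inverses can be checked on q.\<close>

lemma boundary_group_eq:
  assumes G: "G \<subseteq> Sp n" and \<gamma>: "\<gamma> \<in> Sp n"
  shows "boundary_group n G r \<gamma> = omega n r ` {q \<in> Sp n. parab n r q \<and> \<gamma> * q * sinv n \<gamma> \<in> G}"
proof -
  note c = Sp_carrier[OF \<gamma>] sinv_carrier[of n \<gamma>]
  have gc: "g \<in> carrier_mat (2*n) (2*n)" if "g \<in> G" for g using G that Sp_carrier by blast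
  have 1: "\<gamma> * (sinv n \<gamma> * g * \<gamma>) * sinv n \<gamma> = g" if g: "g \<in> carrier_mat (2*n) (2*n)" for g
  proof -
    have gg: "g * \<gamma> \<in> carrier_mat (2*n) (2*n)" using g c(1) by (rule mult_carrier_mat)
    have "\<gamma> * (sinv n \<gamma> * g * \<gamma>) = g * \<gamma>"
      unfolding assoc_mult_square[OF c(2) g c(1)] by (rule Sp_cancel_left(2)[OF \<gamma> gg])
    thus ?thesis using Sp_cancel_right(2)[OF \<gamma> g] by simp
  qed
  have 2: "sinv n \<gamma> * (\<gamma> * q * sinv n \<gamma>) * \<gamma> = q" if q: "q \<in> carrier_mat (2*n) (2*n)" for q
  proof -
    have qq: "q * sinv n \<gamma> \<in> carrier_mat (2*n) (2*n)" using q c(2) by (rule mult_carrier_mat)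
    show ?thesis unfolding assoc_mult_square[OF c(1) q c(2)] Sp_cancel_left(1)[OF \<gamma> qq]
      by (rule Sp_cancel_right(1)[OF \<gamma> q])
  qed
  have "{sinv n \<gamma> * g * \<gamma> | g. g \<in> G} \<inter> parabolic n r = {q \<in> Sp n. parab n r q \<and> \<gamma> * q * sinv n \<gamma> \<in> G}"
  proof (intro equalityI subsetI)
    fix q assume "q \<in> {sinv n \<gamma> * g * \<gamma> | g. g \<in> G} \<inter> parabolic n r"
    then obtain g where g: "g \<in> G" "q = sinv n \<gamma> * g * \<gamma>" "q \<in> Sp n" "parab n r q" by (auto simp: parabolic_eq)
    show "q \<in> {q \<in> Sp n. parab n r q \<and> \<gamma> * q * sinv n \<gamma> \<in> G}"
      using g(1,3,4) 1[OF gc[OF g(1)]] unfolding g(2) by simp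
  next
    fix q assume q: "q \<in> {q \<in> Sp n. parab n r q \<and> \<gamma> * q * sinv n \<gamma> \<in> G}"
    hence "q = sinv n \<gamma> * (\<gamma> * q * sinv n \<gamma>) * \<gamma>" using 2[OF Sp_carrier] by simp
    thus "q \<in> {sinv n \<gamma> * g * \<gamma> | g. g \<in> G} \<inter> parabolic n r" using q unfolding parabolic_eq by blast
  qed
  thus ?thesis unfolding boundary_group_def minv_Sp[OF \<gamma>] by simp
qed

lemma conj_mult:
  assumes \<gamma>: "\<gamma> \<in> Sp n" and a: "a \<in> carrier_mat (2*n) (2*n)" and b: "b \<in> carrier_mat (2*n) (2*n)"
  shows "\<gamma> * (a * b) * sinv n \<gamma> = (\<gamma> * a * sinv n \<gamma>) * (\<gamma> * b * sinv n \<gamma>)"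
proof -
  note c = Sp_carrier[OF \<gamma>] sinv_carrier[of n \<gamma>]
  note m = mult_carrier_mat
  have bs: "b * sinv n \<gamma> \<in> carrier_mat (2*n) (2*n)" using b c(2) by (rule m)
  have ga: "\<gamma> * a \<in> carrier_mat (2*n) (2*n)" using c(1) a by (rule m)
  have gbs: "\<gamma> * (b * sinv n \<gamma>) \<in> carrier_mat (2*n) (2*n)" using c(1) bs by (rule m)
  have "(\<gamma> * a * sinv n \<gamma>) * (\<gamma> * b * sinv n \<gamma>) = \<gamma> * a * (sinv n \<gamma> * (\<gamma> * (b * sinv n \<gamma>)))"
    unfolding assoc_mult_square[OF c(1) b c(2)] by (rule assoc_mult_square[OF ga c(2) gbs])
  also have "sinv n \<gamma> * (\<gamma> * (b * sinv n \<gamma>)) = b * sinv n \<gamma>"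
    by (rule Sp_cancel_left(1)[OF \<gamma> bs])
  also have "\<gamma> * a * (b * sinv n \<gamma>) = \<gamma> * a * b * sinv n \<gamma>"
    by (rule assoc_mult_square[OF ga b c(2), symmetric])
  finally show ?thesis unfolding assoc_mult_square[OF c(1) a b] by simp
qed

text \<open>\<open>omega\<close> is a homomorphism on parabolic elements, so it maps subgroups to
  subgroups. This makes the criterion for equality of cusps applicable to the boundary component
  itself.\<close>

lemma boundary_group_subgroup:
  assumes G: "is_subgroup n G" and \<gamma>: "\<gamma> \<in> Sp n" and rn: "r \<le> n"
  shows "is_subgroup r (boundary_group n G r \<gamma>)"
proof -
  have GS: "G \<subseteq> Sp n" using G by (simp add: is_subgroup_def)
  define Q where "Q = {q \<in> Sp n. parab n r q \<and> \<gamma> * q * sinv n \<gamma> \<in> G}"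
  have one: "1\<^sub>m (2*n) \<in> Q"
    using G Sp_carrier[OF \<gamma>] rn by (simp add: Q_def parab_one sinv_right[OF \<gamma>] is_subgroup_def)
  have mul: "a * b \<in> Q" "omega n r (a * b) = omega n r a * omega n r b" if "a \<in> Q" "b \<in> Q" for a b
  proof -
    have ab: "a \<in> Sp n" "b \<in> Sp n" "parab n r a" "parab n r b" using that by (auto simp: Q_def)
    note c = Sp_carrier[OF ab(1)] Sp_carrier[OF ab(2)]
    show "a * b \<in> Q" using that G conj_mult[OF \<gamma> c] Sp_mult[OF ab(1,2)] parab_mult[OF c(1) ab(3) c(2) ab(4) rn]
      by (auto simp: Q_def is_subgroup_def)
    show "omega n r (a * b) = omega n r a * omega n r b" by (rule omega_mult[OF c(1) ab(3) c(2) ab(4) rn])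
  qed
  have inv: "sinv n a \<in> Q" "omega n r (sinv n a) = sinv r (omega n r a)" if "a \<in> Q" for a
  proof -
    have a: "a \<in> Sp n" "parab n r a" "\<gamma> * a * sinv n \<gamma> \<in> G" using that by (auto simp: Q_def)
    have "\<gamma> * sinv n a * sinv n \<gamma> = sinv n (\<gamma> * a * sinv n \<gamma>)"
      unfolding sinv_mult[OF Sp_mult[OF \<gamma> a(1)] sinv_Sp[OF \<gamma>]] sinv_mult[OF \<gamma> a(1)] sinv_sinv[OF \<gamma>]
      by (rule assoc_mult_square[OF Sp_carrier[OF \<gamma>] sinv_carrier sinv_carrier])
    thus "sinv n a \<in> Q" using a G sinv_Sp[OF a(1)] parab_sinv[OF rn a(2)] by (auto simp: Q_def is_subgroup_def)
    show "omega n r (sinv n a) = sinv r (omega n r a)" by (rule omega_sinv[OF a(1,2) rn])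
  qed
  show ?thesis unfolding is_subgroup_def boundary_group_eq[OF GS \<gamma>] Q_def[symmetric]
  proof (intro conjI)
    show "omega n r ` Q \<subseteq> Sp r" using omega_Sp rn by (auto simp: Q_def)
    show "1\<^sub>m (2*r) \<in> omega n r ` Q" using one omega_one[OF rn] by (metis image_eqI)
    show "\<forall>a\<in>omega n r ` Q. \<forall>b\<in>omega n r ` Q. a * b \<in> omega n r ` Q"
      using mul by (auto simp: image_iff) metis
    show "\<forall>a\<in>omega n r ` Q. sinv r a \<in> omega n r ` Q" using inv by (auto simp: image_iff) metis
  qed
qed

text \<open>For \<open>R = {r\<^sub>1, \<dots>}\<close> this relates \<open>\<gamma>\<close> and \<open>\<gamma>'\<close> iff some element of \<open>G\<close> maps the flag of the
  isotropic subspaces \<open>\<gamma> W\<^sub>r\<close>, \<open>r \<in> R\<close>, to that of \<open>\<gamma>'\<close>, where \<open>W\<^sub>r\<close> is spanned by the basis vectors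
  \<open>r, \<dots>, n - 1\<close>.\<close>

definition fequiv :: "nat \<Rightarrow> rat mat set \<Rightarrow> nat set \<Rightarrow> rat mat \<Rightarrow> rat mat \<Rightarrow> bool" where
  "fequiv n G R \<gamma> \<gamma>' \<longleftrightarrow> (\<exists>g\<in>G. \<exists>p\<in>Sp n. (\<forall>r\<in>R. parab n r p) \<and> \<gamma>' = g * \<gamma> * p)"

section \<open>Equivalence of flags and its relation to cusps\<close>

lemma fequiv_sym:
  assumes G: "is_subgroup n G" and R: "R \<subseteq> {..n}" and \<gamma>: "\<gamma> \<in> Sp n" and e: "fequiv n G R \<gamma> \<gamma>'"
  shows "fequiv n G R \<gamma>' \<gamma>"
proof -
  obtain g p where g: "g \<in> G" "p \<in> Sp n" "\<forall>r\<in>R. parab n r p" "\<gamma>' = g * \<gamma> * p"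
    using e by (auto simp: fequiv_def)
  have gS: "g \<in> Sp n" using G g by (auto simp: is_subgroup_def)
  note c = Sp_carrier[OF gS] Sp_carrier[OF \<gamma>] Sp_carrier[OF g(2)]
  have "g * \<gamma> \<in> carrier_mat (2*n) (2*n)" using c by auto
  hence "sinv n g * \<gamma>' * sinv n p = \<gamma>"
    unfolding g(4) using c Sp_cancel_left(1)[OF gS c(2)] Sp_cancel_right(2)[OF g(2) c(2)]
    by (subst assoc_mult_square[of "sinv n g" "2*n" "g * \<gamma>" p, symmetric]) auto
  moreover have "sinv n g \<in> G" using G g by (simp add: is_subgroup_def)
  moreover have "\<forall>r\<in>R. parab n r (sinv n p)" using g(3) R parab_sinv by blast
  ultimately show ?thesis unfolding fequiv_def using sinv_Sp[OF g(2)] by metis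
qed

lemma fequiv_trans:
  assumes G: "is_subgroup n G" and R: "R \<subseteq> {..n}" and \<gamma>: "\<gamma> \<in> Sp n"
    and e: "fequiv n G R \<gamma> \<gamma>'" "fequiv n G R \<gamma>' \<gamma>''"
  shows "fequiv n G R \<gamma> \<gamma>''"
proof -
  obtain g p where g: "g \<in> G" "p \<in> Sp n" "\<forall>r\<in>R. parab n r p" "\<gamma>' = g * \<gamma> * p"
    using e by (auto simp: fequiv_def)
  obtain h q where h: "h \<in> G" "q \<in> Sp n" "\<forall>r\<in>R. parab n r q" "\<gamma>'' = h * \<gamma>' * q"
    using e by (auto simp: fequiv_def)
  have gS: "g \<in> Sp n" "h \<in> Sp n" using G g h by (auto simp: is_subgroup_def)
  note c = Sp_carrier[OF gS(1)] Sp_carrier[OF gS(2)] Sp_carrier[OF \<gamma>] Sp_carrier[OF g(2)] Sp_carrier[OF h(2)]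
  note m = mult_carrier_mat[of _ "2*n" "2*n" _ "2*n"] and as = assoc_mult_square[of _ "2*n"]
  have "\<gamma>'' = h * (g * \<gamma>) * p * q"
    unfolding h(4) g(4) using as[OF c(2) m[OF c(1) c(3)] c(4)] by simp
  also have "\<dots> = h * (g * \<gamma>) * (p * q)" by (rule as[OF m[OF c(2) m[OF c(1,3)]] c(4,5)])
  also have "h * (g * \<gamma>) = h * g * \<gamma>" by (rule as[OF c(2,1,3), symmetric])
  finally have "\<gamma>'' = (h * g) * \<gamma> * (p * q)" .
  moreover have "h * g \<in> G" using G g h by (simp add: is_subgroup_def)
  moreover have "\<forall>r\<in>R. parab n r (p * q)"
    using g(3) h(3) R parab_mult[OF c(4) _ c(5)] by blast
  ultimately show ?thesis unfolding fequiv_def using Sp_mult[OF g(2) h(2)] by blast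
qed

lemma fequiv_mono: "fequiv n G R \<gamma> \<gamma>' \<Longrightarrow> R' \<subseteq> R \<Longrightarrow> fequiv n G R' \<gamma> \<gamma>'"
  unfolding fequiv_def by blast

lemma fequiv_right:
  assumes "is_subgroup n G" "\<gamma> \<in> Sp n" "p \<in> Sp n" "\<And>r. r \<in> R \<Longrightarrow> parab n r p"
  shows "fequiv n G R \<gamma> (\<gamma> * p)"
proof -
  have "\<gamma> * p = 1\<^sub>m (2*n) * \<gamma> * p" using Sp_carrier[OF assms(2)] by simp
  moreover have "1\<^sub>m (2*n) \<in> G" using assms(1) by (simp add: is_subgroup_def)
  ultimately show ?thesis unfolding fequiv_def using assms(3,4) by blast
qed

lemma fequiv_left:
  assumes "R \<subseteq> {..n}" "\<gamma> \<in> Sp n" "g \<in> G" "g \<in> Sp n"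
  shows "fequiv n G R \<gamma> (g * \<gamma>)"
proof -
  have "g * \<gamma> = g * \<gamma> * 1\<^sub>m (2*n)"
    using right_mult_one_mat[OF mult_carrier_mat[OF Sp_carrier[OF assms(4)] Sp_carrier[OF assms(2)]]] by simp
  moreover have "\<forall>r\<in>R. parab n r (1\<^sub>m (2*n))" using assms(1) by (auto intro!: parab_one)
  ultimately show ?thesis unfolding fequiv_def using assms(3) Sp_one by blast
qed

text \<open>An isotropic subspace is stable only together with its annihilator.\<close>

lemma Sp_stabilizer_parab:
  assumes q: "q \<in> Sp n" and rn: "r \<le> n"
    and z: "\<And>i j. i < r \<Longrightarrow> j \<in> {r..<n} \<Longrightarrow> q $$ (i, j) = 0"
      "\<And>i j. i < n \<Longrightarrow> j \<in> {r..<n} \<Longrightarrow> q $$ (n + i, j) = 0"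
  shows "parab n r q"
proof -
  define m A B where "m = n - r" and "A = mat m m (\<lambda>(a, b). q $$ (r + a, r + b))"
    and "B = mat m m (\<lambda>(a, b). q $$ (n + r + b, n + r + a))"
  have ir: "{..<n} = {..<r} \<union> (\<lambda>a. r + a) ` {..<m}"
  proof -
    have "(\<lambda>a. r + a) ` {..<m} = {r..<n}"
      using image_add_atLeastLessThan[of r 0 m] rn by (simp add: m_def lessThan_atLeast0 add.commute)
    thus ?thesis using rn by auto
  qed
  \<comment> \<open>In column k both the lower half and the rows above r vanish, so its symplectic
    relation with column j involves only the rows r, ..., n - 1 of column k.\<close>
  have col: "(\<Sum>a<m. q $$ (n + r + a, j) * q $$ (r + a, k)) = Jmat n $$ (j, k)"
    if "j < 2*n" "k \<in> {r..<n}" for j k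
  proof -
    have "Jmat n $$ (j, k) = (\<Sum>i<n. q $$ (n + i, j) * q $$ (i, k))"
      using Sp_columns[OF q, of j k] that z(2)[of _ k] by simp
    also have "\<dots> = (\<Sum>i\<in>(\<lambda>a. r + a) ` {..<m}. q $$ (n + i, j) * q $$ (i, k))"
      using ir that z(1)[of _ k] by (intro sum.mono_neutral_right) auto
    also have "\<dots> = (\<Sum>a<m. q $$ (n + r + a, j) * q $$ (r + a, k))"
      by (subst sum.reindex) (auto simp: add.assoc)
    finally show ?thesis by simp
  qed
  have AB: "A \<in> carrier_mat m m" "B \<in> carrier_mat m m" by (simp_all add: A_def B_def)
  have BA1: "B * A = 1\<^sub>m m"
  proof (rule eq_matI)
    fix a b assume "a < dim_row (1\<^sub>m m :: 'a mat)" "b < dim_col (1\<^sub>m m :: 'a mat)"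
    hence ab: "a < m" "b < m" by auto
    have "(B * A) $$ (a, b) = (\<Sum>c<m. q $$ (n + r + c, n + r + a) * q $$ (r + c, r + b))"
      using ab by (simp add: A_def B_def scalar_prod_def lessThan_atLeast0)
    also have "\<dots> = Jmat n $$ (n + r + a, r + b)" using ab rn by (intro col) (auto simp: m_def)
    also have "\<dots> = 1\<^sub>m m $$ (a, b)" using ab rn by (subst Jmat_index) (auto simp: m_def)
    finally show "(B * A) $$ (a, b) = 1\<^sub>m m $$ (a, b)" .
  qed (use AB in auto)
  have AB1: "A * B = 1\<^sub>m m" by (rule left_inverse_imp_right_inverse[OF AB BA1])
  have "q $$ (n + i, j) = 0" if i: "i \<in> {r..<n}" and j: "j < n + r" for i j
  proof -
    define y where "y = vec m (\<lambda>a. q $$ (n + r + a, j))"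
    have y: "y \<in> carrier_vec m" by (simp add: y_def)
    \<comment> \<open>For j < n + r the form of column j with the columns r, ..., n - 1 is zero.
      These relations are A^T y = 0 for the lower part y of column j, and A is invertible.\<close>
    have "transpose_mat A *\<^sub>v y = 0\<^sub>v m"
    proof (rule eq_vecI)
      fix b assume "b < dim_vec (0\<^sub>v m :: 'a vec)"
      hence b: "b < m" by simp
      have "(transpose_mat A *\<^sub>v y) $ b = (\<Sum>a<m. q $$ (n + r + a, j) * q $$ (r + a, r + b))"
        using b by (simp add: A_def y_def scalar_prod_def lessThan_atLeast0 mult.commute)
      also have "\<dots> = Jmat n $$ (j, r + b)" using b j rn by (intro col) (auto simp: m_def)
      also have "\<dots> = 0" using b j rn by (subst Jmat_index) (auto simp: m_def)
      finally show "(transpose_mat A *\<^sub>v y) $ b = 0\<^sub>v m $ b" using b by simp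
    qed (use AB in auto)
    hence "transpose_mat B *\<^sub>v (transpose_mat A *\<^sub>v y) = 0\<^sub>v m" using AB by auto
    moreover have "transpose_mat B *\<^sub>v (transpose_mat A *\<^sub>v y) = (transpose_mat B * transpose_mat A) *\<^sub>v y"
      using AB y by (intro assoc_mult_mat_vec[symmetric]) auto
    moreover have "transpose_mat B * transpose_mat A = 1\<^sub>m m"
      using transpose_mult[OF AB] AB1 by simp
    ultimately have "y = 0\<^sub>v m" using y by simp
    moreover have im: "i - r < m" "n + (r + (i - r)) = n + i" using i by (auto simp: m_def)
    ultimately have "y $ (i - r) = 0" by simp
    thus ?thesis using im(1) i unfolding y_def by (simp only: index_vec add.assoc im(2))
  qed
  thus ?thesis using z rn by (auto simp: parab_def)
qed

lemma imaginary_unit_Siegel: "\<i> \<cdot>\<^sub>m 1\<^sub>m r \<in> Siegel r"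
proof -
  have "0 < v \<bullet> (map_mat Im (\<i> \<cdot>\<^sub>m 1\<^sub>m r) *\<^sub>v v)" if v: "v \<in> carrier_vec r" "v \<noteq> 0\<^sub>v r" for v :: "real vec"
  proof -
    have "map_mat Im (\<i> \<cdot>\<^sub>m 1\<^sub>m r) = 1\<^sub>m r" by (rule eq_matI) auto
    moreover have "\<exists>i<r. v $ i \<noteq> 0" using v by (metis eq_vecI carrier_vecD index_zero_vec)
    then obtain i where "i < r" "v $ i \<noteq> 0" by blast
    hence "0 < (\<Sum>k<r. v $ k * v $ k)" by (intro sum_pos2[of _ i]) (auto simp: zero_less_mult_iff)
    ultimately show ?thesis using v(1) by (simp add: scalar_prod_def lessThan_atLeast0)
  qed
  moreover have "transpose_mat (\<i> \<cdot>\<^sub>m 1\<^sub>m r) = \<i> \<cdot>\<^sub>m 1\<^sub>m r" by (rule eq_matI) auto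
  ultimately show ?thesis by (auto simp: Siegel_def)
qed

lemma minv_imaginary_unit: "minv (\<i> \<cdot>\<^sub>m 1\<^sub>m r) = (- \<i>) \<cdot>\<^sub>m 1\<^sub>m r"
proof (rule minv_eq)
  have "((- \<i>) \<cdot>\<^sub>m 1\<^sub>m r) * (\<i> \<cdot>\<^sub>m 1\<^sub>m r) = (- \<i>) \<cdot>\<^sub>m (\<i> \<cdot>\<^sub>m (1\<^sub>m r * 1\<^sub>m r :: complex mat))"
    by (subst mult_smult_assoc_mat[of _ r r _ r]) (auto simp: mult_smult_distrib[of _ r r _ r])
  also have "\<dots> = 1\<^sub>m r" by (rule eq_matI) auto
  finally show "((- \<i>) \<cdot>\<^sub>m 1\<^sub>m r) * (\<i> \<cdot>\<^sub>m 1\<^sub>m r) = 1\<^sub>m r" .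
qed auto

text \<open>The only real points of the plane \<open>j\<^sub>r\<^sub>,\<^sub>n(\<i>)\<close> are in the span of \<open>r, \<dots>, n - 1\<close>, so that the
  rational isotropic subspace of a cusp can be read off from one of its points.\<close>

lemma real_point_of_jpoint:
  assumes x: "x \<in> lift r n (jpoint r r (\<i> \<cdot>\<^sub>m 1\<^sub>m r))" and real: "\<And>i. i < 2*n \<Longrightarrow> Im (x $ i) = 0" and rn: "r \<le> n"
  shows "i < r \<Longrightarrow> x $ i = 0" "i < n \<Longrightarrow> x $ (n + i) = 0"
proof -
  have l: "x $ (n + i) = - \<i> * x $ i" if "i < r" for i
  proof -
    have "x $ (n + i) = (\<Sum>k<r. ((- \<i>) \<cdot>\<^sub>m 1\<^sub>m r) $$ (i, k) * x $ k)"
      using x that by (simp add: lift_def jpoint_eq[OF imaginary_unit_Siegel] minv_imaginary_unit)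
    also have "\<dots> = (\<Sum>k<r. if k = i then - \<i> * x $ i else 0)"
      using that by (intro sum.cong) auto
    finally show ?thesis using that by simp
  qed
  have z: "x $ i = 0 \<and> x $ (n + i) = 0" if "i < r" for i
    using l[OF that] real[of i] real[of "n + i"] that rn by (simp add: complex_eq_iff)
  thus "i < r \<Longrightarrow> x $ i = 0" by blast
  assume "i < n"
  thus "x $ (n + i) = 0" using x z by (cases "i < r") (auto simp: lift_def)
qed

lemma cusp_subset:
  assumes G: "is_subgroup n G" and rn: "r \<le> n" and \<gamma>: "\<gamma> \<in> Sp n" and e: "fequiv n G {r} \<gamma> \<gamma>'"
  shows "cusp n G r \<gamma>' \<subseteq> cusp n G r \<gamma>"
proof -
  obtain g p where g: "g \<in> G" "p \<in> Sp n" "parab n r p" "\<gamma>' = g * \<gamma> * p"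
    using e by (auto simp: fequiv_def)
  have gS: "g \<in> Sp n" using G g by (auto simp: is_subgroup_def)
  note c = Sp_carrier[OF gS] Sp_carrier[OF \<gamma>] Sp_carrier[OF g(2)]
  have \<gamma>': "\<gamma>' \<in> Sp n" unfolding g(4) by (intro Sp_mult gS \<gamma> g)
  show ?thesis
  proof
    fix X assume "X \<in> cusp n G r \<gamma>'"
    then obtain V where V: "V \<in> Siegel_star r" "X = orbit G (act \<gamma>' (lift r n V))"
      unfolding cusp_eq[OF rn \<gamma>'] by blast
    have "act \<gamma>' (lift r n V) = act (g * \<gamma>) (act p (lift r n V))"
      unfolding g(4) by (rule act_mult[OF mult_carrier_mat[OF c(1,2)] c(3) lift_carrier])
    also have "act p (lift r n V) = lift r n (act (omega n r p) V)"
      by (rule act_lift[OF g(2,3) rn Siegel_star_carrier[OF V(1)]])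
    also have "act (g * \<gamma>) \<dots> = act g (act \<gamma> \<dots>)" by (rule act_mult[OF c(1,2) lift_carrier])
    finally have "act \<gamma>' (lift r n V) = act g (act \<gamma> (lift r n (act (omega n r p) V)))" .
    hence "X = orbit G (act \<gamma> (lift r n (act (omega n r p) V)))"
      unfolding V(2) using g(1)
      by (subst orbit_eq_iff[OF G act_carrier[OF Sp_carrier[OF \<gamma>'] lift_carrier] act_carrier[OF c(2) lift_carrier]]) auto
    thus "X \<in> cusp n G r \<gamma>" unfolding cusp_eq[OF rn \<gamma>]
      using Siegel_star_act[OF V(1) omega_Sp[OF g(2,3) rn]] by blast
  qed
qed

text \<open>The direction from equality follows one point: the plane over j(i) is the image under q
  of the lift of some V', where V' may a priori be a boundary point. That lift contains W_r because
  0 lies in V'. The images of the basis vectors of W_r are rational, hence real, points of the plane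
  over j(i), so q maps W_r into itself and is parabolic.\<close>

lemma cusp_eq_iff:
  assumes G: "is_subgroup n G" and rn: "r \<le> n" and \<gamma>: "\<gamma> \<in> Sp n" and \<gamma>': "\<gamma>' \<in> Sp n"
  shows "cusp n G r \<gamma> = cusp n G r \<gamma>' \<longleftrightarrow> fequiv n G {r} \<gamma> \<gamma>'"
proof
  assume e: "cusp n G r \<gamma> = cusp n G r \<gamma>'"
  define V0 where "V0 = jpoint r r (\<i> \<cdot>\<^sub>m 1\<^sub>m r)"
  have V0: "V0 \<in> Siegel_star r" unfolding V0_def by (rule jpoint_Siegel_star[OF imaginary_unit_Siegel]) simp
  have "orbit G (act \<gamma> (lift r n V0)) \<in> cusp n G r \<gamma>'"
    unfolding e[symmetric] cusp_eq[OF rn \<gamma>] using V0 by blast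
  then obtain V' where V': "V' \<in> Siegel_star r" "orbit G (act \<gamma> (lift r n V0)) = orbit G (act \<gamma>' (lift r n V'))"
    unfolding cusp_eq[OF rn \<gamma>'] by blast
  note c = Sp_carrier[OF \<gamma>] Sp_carrier[OF \<gamma>']
  obtain g where g: "g \<in> G" "act \<gamma> (lift r n V0) = act g (act \<gamma>' (lift r n V'))"
    using V'(2) orbit_eq_iff[OF G act_carrier[OF c(1) lift_carrier] act_carrier[OF c(2) lift_carrier]] by blast
  have gS: "g \<in> Sp n" using G g by (auto simp: is_subgroup_def)
  note gc = Sp_carrier[OF gS]
  define q where "q = sinv n \<gamma> * (g * \<gamma>')"
  have q: "q \<in> Sp n" unfolding q_def by (intro Sp_mult sinv_Sp \<gamma> gS \<gamma>')
  note qc = Sp_carrier[OF q]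
  have "act q (lift r n V') = act (sinv n \<gamma>) (act (g * \<gamma>') (lift r n V'))"
    unfolding q_def by (rule act_mult[OF sinv_carrier mult_carrier_mat[OF gc c(2)] lift_carrier])
  also have "\<dots> = lift r n V0"
    unfolding act_mult[OF gc c(2) lift_carrier] g(2)[symmetric] by (rule act_sinv(1)[OF \<gamma> lift_carrier])
  finally have aq: "act q (lift r n V') = lift r n V0" .
  have z: "i < r \<Longrightarrow> q $$ (i, j) = 0" "i < n \<Longrightarrow> q $$ (n + i, j) = 0" if j: "j \<in> {r..<n}" for i j
  proof -
    have "res r n (unit_vec (2*n) j) = (0\<^sub>v (2*r) :: complex vec)"
      using j rn by (intro eq_vecI) (auto simp: res_def emb_def)
    hence "unit_vec (2*n) j \<in> lift r n V'"
      using Siegel_star_zero[OF V'(1)] j by (simp add: lift_def)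
    hence x: "map_mat of_rat q *\<^sub>v unit_vec (2*n) j \<in> lift r n (jpoint r r (\<i> \<cdot>\<^sub>m 1\<^sub>m r))" (is "?x \<in> _")
      using aq unfolding act_def V0_def by blast
    have xi: "?x $ i = of_rat (q $$ (i, j))" if "i < 2*n" for i
      using that j qc by (simp add: scalar_prod_right_unit)
    have re: "Im (?x $ i) = 0" if "i < 2*n" for i
      unfolding xi[OF that] by (cases "q $$ (i, j)") (simp add: of_rat_rat Im_divide)
    note rp = real_point_of_jpoint[OF x re rn]
    show "i < r \<Longrightarrow> q $$ (i, j) = 0" using rp(1)[of i] xi[of i] rn by simp
    show "i < n \<Longrightarrow> q $$ (n + i, j) = 0" using rp(2)[of i] xi[of "n + i"] by simp
  qed
  have pq: "parab n r q" by (rule Sp_stabilizer_parab[OF q rn]) (use z in auto)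
  have gg: "g * \<gamma>' = \<gamma> * q" unfolding q_def
    using Sp_cancel_left(2)[OF \<gamma> mult_carrier_mat[OF gc c(2)]] by simp
  have "\<gamma>' = sinv n g * (\<gamma> * q)" unfolding gg[symmetric] using Sp_cancel_left(1)[OF gS c(2)] by simp
  also have "\<dots> = sinv n g * \<gamma> * q" by (rule assoc_mult_square[OF sinv_carrier c(1) qc, symmetric])
  finally show "fequiv n G {r} \<gamma> \<gamma>'" unfolding fequiv_def using q pq g(1) G by (auto simp: is_subgroup_def)
next
  assume e: "fequiv n G {r} \<gamma> \<gamma>'"
  show "cusp n G r \<gamma> = cusp n G r \<gamma>'"
    using cusp_subset[OF G rn \<gamma> e] cusp_subset[OF G rn \<gamma>' fequiv_sym[OF G _ \<gamma> e]] rn by auto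
qed

text \<open>The content is that the embedding is well defined on orbits (\<open>key\<close>): an
  element of the boundary group is \<open>omega\<close> of some q whose conjugate by \<gamma> lies
  in G, and that conjugate identifies the embedded points.\<close>

lemma boundary_image_cusp:
  assumes G: "is_subgroup n G" and rn: "r \<le> n" and sr: "s \<le> r" and \<gamma>: "\<gamma> \<in> Sp n" and \<rho>: "\<rho> \<in> Sp r"
  shows "boundary_image n G r \<gamma> (cusp r (boundary_group n G r \<gamma>) s \<rho>) = cusp n G s (\<gamma> * xi r n \<rho>)"
proof -
  define H where "H = boundary_group n G r \<gamma>"
  have GS: "G \<subseteq> Sp n" using G by (simp add: is_subgroup_def)
  have H: "is_subgroup r H" unfolding H_def by (rule boundary_group_subgroup[OF G \<gamma> rn])
  note c = Sp_carrier[OF \<gamma>] xi_carrier[OF Sp_carrier[OF \<rho>] rn]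
  have \<gamma>\<rho>: "\<gamma> * xi r n \<rho> \<in> Sp n" by (intro Sp_mult \<gamma> xi_Sp[OF \<rho> rn])
  define U where "U = (\<lambda>V. act \<rho> (lift s r V))"
  have U: "U V \<in> Siegel_star r" if "V \<in> Siegel_star s" for V
    unfolding U_def by (rule Siegel_star_act[OF Siegel_star_lift[OF that sr] \<rho>])
  have lU: "act (\<gamma> * xi r n \<rho>) (lift s n V) = act \<gamma> (lift r n (U V))" for V
  proof -
    have "act (\<gamma> * xi r n \<rho>) (lift s n V) = act \<gamma> (act (xi r n \<rho>) (lift r n (lift s r V)))"
      unfolding lift_lift[OF sr rn] by (rule act_mult[OF c lift_carrier])
    thus ?thesis unfolding act_xi_lift[OF \<rho> rn lift_carrier] U_def .
  qed
  have key: "orbit G (act \<gamma> (lift r n W)) = orbit G (act \<gamma> (lift r n (U V)))"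
    if V: "V \<in> Siegel_star s" and W: "W \<in> Siegel_star r" "orbit H W = orbit H (U V)" for V W
  proof -
    note UVc = Siegel_star_carrier[OF U[OF V]]
    obtain \<delta> where \<delta>: "\<delta> \<in> H" "W = act \<delta> (U V)"
      using W(2) orbit_eq_iff[OF H Siegel_star_carrier[OF W(1)] UVc] by blast
    obtain q where q: "q \<in> Sp n" "parab n r q" "\<gamma> * q * sinv n \<gamma> \<in> G" "\<delta> = omega n r q"
      using \<delta>(1) unfolding H_def boundary_group_eq[OF GS \<gamma>] by blast
    note qc = Sp_carrier[OF q(1)]
    have "act (\<gamma> * q * sinv n \<gamma>) (act \<gamma> (lift r n (U V))) = act (\<gamma> * q) (act (sinv n \<gamma>) (act \<gamma> (lift r n (U V))))"
      by (rule act_mult[OF mult_carrier_mat[OF c(1) qc] sinv_carrier act_carrier[OF c(1) lift_carrier]])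
    also have "\<dots> = act \<gamma> (act q (lift r n (U V)))"
      unfolding act_sinv(1)[OF \<gamma> lift_carrier] by (rule act_mult[OF c(1) qc lift_carrier])
    also have "\<dots> = act \<gamma> (lift r n W)" unfolding act_lift[OF q(1,2) rn UVc] \<delta>(2) q(4) ..
    finally show ?thesis
      using q(3) by (subst orbit_eq_iff[OF G act_carrier[OF c(1) lift_carrier] act_carrier[OF c(1) lift_carrier]]) auto
  qed
  have "boundary_image n G r \<gamma> (cusp r H s \<rho>) =
      {orbit G (act \<gamma> (lift r n W)) | W. W \<in> Siegel_star r \<and> (\<exists>V\<in>Siegel_star s. orbit H W = orbit H (U V))}"
    unfolding boundary_image_eq[OF rn \<gamma>] H_def[symmetric] cusp_eq[OF sr \<rho>] U_def by auto
  also have "\<dots> = {orbit G (act \<gamma> (lift r n (U V))) | V. V \<in> Siegel_star s}"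
  proof (intro equalityI subsetI)
    fix X assume "X \<in> {orbit G (act \<gamma> (lift r n W)) | W. W \<in> Siegel_star r \<and> (\<exists>V\<in>Siegel_star s. orbit H W = orbit H (U V))}"
    then obtain W V where "X = orbit G (act \<gamma> (lift r n W))" "W \<in> Siegel_star r" "V \<in> Siegel_star s" "orbit H W = orbit H (U V)"
      by blast
    thus "X \<in> {orbit G (act \<gamma> (lift r n (U V))) | V. V \<in> Siegel_star s}" using key by blast
  next
    fix X assume "X \<in> {orbit G (act \<gamma> (lift r n (U V))) | V. V \<in> Siegel_star s}"
    thus "X \<in> {orbit G (act \<gamma> (lift r n W)) | W. W \<in> Siegel_star r \<and> (\<exists>V\<in>Siegel_star s. orbit H W = orbit H (U V))}"
      using U by blast
  qed
  also have "\<dots> = cusp n G s (\<gamma> * xi r n \<rho>)"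
    unfolding cusp_eq[OF le_trans[OF sr rn] \<gamma>\<rho>] lU ..
  finally show ?thesis unfolding H_def .
qed

section \<open>Plane-wise and Levi elements\<close>

lemma vec_eq_halves:
  assumes "u \<in> carrier_vec (2*n)" "v \<in> carrier_vec (2*n)"
    "\<And>i. i < n \<Longrightarrow> u $ i = v $ i" "\<And>i. i < n \<Longrightarrow> u $ (n + i) = v $ (n + i)"
  shows "u = v"
proof (rule eq_vecI)
  fix i assume "i < dim_vec v"
  hence "i < n \<or> (\<exists>k<n. i = n + k)" using assms(2) by simp presburger
  thus "u $ i = v $ i" using assms by auto
qed (use assms in auto)

lemma eq_mat_halves:
  assumes A: "A \<in> carrier_mat (2*n) (2*n)" and B: "B \<in> carrier_mat (2*n) (2*n)"
    and e: "\<And>k l. k < n \<Longrightarrow> l < n \<Longrightarrow> A $$ (k, l) = B $$ (k, l)"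
    "\<And>k l. k < n \<Longrightarrow> l < n \<Longrightarrow> A $$ (k, n + l) = B $$ (k, n + l)"
    "\<And>k l. k < n \<Longrightarrow> l < n \<Longrightarrow> A $$ (n + k, l) = B $$ (n + k, l)"
    "\<And>k l. k < n \<Longrightarrow> l < n \<Longrightarrow> A $$ (n + k, n + l) = B $$ (n + k, n + l)"
  shows "A = B"
proof (rule eq_matI)
  fix i j assume "i < dim_row B" "j < dim_col B"
  hence "i < 2*n" "j < 2*n" using B by auto
  hence "i < n \<or> (\<exists>k<n. i = n + k)" "j < n \<or> (\<exists>k<n. j = n + k)" by presburger+
  thus "A $$ (i, j) = B $$ (i, j)" using e by auto
qed (use A B in auto)

lemma sinv_index:
  assumes "k < n" "l < n"
  shows "sinv n M $$ (k, l) = M $$ (n + l, n + k)" "sinv n M $$ (k, n + l) = - M $$ (l, n + k)"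
    "sinv n M $$ (n + k, l) = - M $$ (n + l, k)" "sinv n M $$ (n + k, n + l) = M $$ (l, k)"
  using assms by (auto simp: sinv_def)

text \<open>Acts on the plane of the coordinates \<open>i\<close> and \<open>n + i\<close> by \<open>(a\<^sub>i, b\<^sub>i; c\<^sub>i, d\<^sub>i)\<close>.\<close>

definition dg :: "nat \<Rightarrow> (nat \<Rightarrow> 'a) \<Rightarrow> (nat \<Rightarrow> 'a) \<Rightarrow> (nat \<Rightarrow> 'a) \<Rightarrow> (nat \<Rightarrow> 'a) \<Rightarrow> 'a::comm_ring_1 mat" where
  "dg n a b c d = mat (2*n) (2*n) (\<lambda>(i, j).
     if i < n then (if j = i then a i else if j = n + i then b i else 0)
     else (if n + j = i then c (i - n) else if j = i then d (i - n) else 0))"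

lemma dg_carrier [simp]: "dg n a b c d \<in> carrier_mat (2*n) (2*n)"
  by (simp add: dg_def)

lemma dim_dg [simp]: "dim_row (dg n a b c d) = 2*n" "dim_col (dg n a b c d) = 2*n"
  by (simp_all add: dg_def)

lemma dg_index:
  assumes "i < n" "j < n"
  shows "dg n a b c d $$ (i, j) = (if i = j then a i else 0)"
    "dg n a b c d $$ (i, n + j) = (if i = j then b i else 0)"
    "dg n a b c d $$ (n + i, j) = (if i = j then c i else 0)"
    "dg n a b c d $$ (n + i, n + j) = (if i = j then d i else 0)"
  using assms by (auto simp: dg_def)

lemma dg_mult_vec:
  fixes v :: "'a::comm_ring_1 vec"
  assumes v: "v \<in> carrier_vec (2*n)" and i: "i < n"
  shows "(dg n a b c d *\<^sub>v v) $ i = a i * v $ i + b i * v $ (n + i)"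
    "(dg n a b c d *\<^sub>v v) $ (n + i) = c i * v $ i + d i * v $ (n + i)"
proof -
  have "i < 2*n" "n + i < 2*n" using i by auto
  note idx = this[THEN mult_vec_index_double[OF dg_carrier v]]
  show "(dg n a b c d *\<^sub>v v) $ i = a i * v $ i + b i * v $ (n + i)"
    unfolding idx using i by (simp add: dg_index sum_delta_mult)
  show "(dg n a b c d *\<^sub>v v) $ (n + i) = c i * v $ i + d i * v $ (n + i)"
    unfolding idx using i by (simp add: dg_index sum_delta_mult)
qed

lemma dg_Sp:
  assumes "\<And>i. i < n \<Longrightarrow> a i * d i - b i * c i = 1"
  shows "dg n a b c d \<in> Sp n"
proof (rule Sp_I)
  fix v w :: "'a vec" assume v: "v \<in> carrier_vec (2*n)" and w: "w \<in> carrier_vec (2*n)"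
  have "(c i * x + d i * x') * (a i * y + b i * y') - (a i * x + b i * x') * (c i * y + d i * y') = x' * y - x * y'"
    if "i < n" for i x x' y y'
  proof -
    have "(c i * x + d i * x') * (a i * y + b i * y') - (a i * x + b i * x') * (c i * y + d i * y')
        = (a i * d i - b i * c i) * (x' * y - x * y')" by (simp add: algebra_simps)
    thus ?thesis using assms[OF that] by simp
  qed
  thus "sform n (dg n a b c d *\<^sub>v v) (dg n a b c d *\<^sub>v w) = sform n v w"
    unfolding sform_def by (intro sum.cong refl) (simp add: dg_mult_vec[OF v] dg_mult_vec[OF w] del: index_mult_mat_vec)
qed simp

lemma dg_cong:
  assumes "\<And>i. i < n \<Longrightarrow> a i = a' i \<and> b i = b' i \<and> c i = c' i \<and> d i = d' i"
  shows "dg n a b c d = dg n a' b' c' d'"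
  by (rule eq_matI) (auto simp: dg_def assms)

lemma dg_mult:
  "dg n a b c d * dg n a' b' c' d' = dg n (\<lambda>i. a i * a' i + b i * c' i) (\<lambda>i. a i * b' i + b i * d' i)
     (\<lambda>i. c i * a' i + d i * c' i) (\<lambda>i. c i * b' i + d i * d' i)"
proof (rule mat_eq_via_action)
  show "dg n a b c d * dg n a' b' c' d' \<in> carrier_mat (2*n) (2*n)" by (rule mult_carrier_mat[OF dg_carrier dg_carrier])
  fix v :: "'a vec" assume v: "v \<in> carrier_vec (2*n)"
  have v': "dg n a' b' c' d' *\<^sub>v v \<in> carrier_vec (2*n)" by (rule mult_mat_vec_carrier[OF dg_carrier v])
  show "dg n a b c d * dg n a' b' c' d' *\<^sub>v v = dg n (\<lambda>i. a i * a' i + b i * c' i) (\<lambda>i. a i * b' i + b i * d' i)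
     (\<lambda>i. c i * a' i + d i * c' i) (\<lambda>i. c i * b' i + d i * d' i) *\<^sub>v v"
    unfolding assoc_mult_mat_vec[OF dg_carrier dg_carrier v]
    by (rule vec_eq_halves[OF mult_mat_vec_carrier[OF dg_carrier v'] mult_mat_vec_carrier[OF dg_carrier v]])
      (simp_all only: dg_mult_vec[OF v] dg_mult_vec[OF v'], simp_all add: algebra_simps)
qed simp

lemma dg_one: "dg n (\<lambda>_. 1) (\<lambda>_. 0) (\<lambda>_. 0) (\<lambda>_. 1) = 1\<^sub>m (2*n)"
  by (rule eq_matI) (auto simp: dg_def)

lemma rat_mat_dg: "rat_mat (dg n a b c d) = dg n (\<lambda>i. of_int (a i)) (\<lambda>i. of_int (b i)) (\<lambda>i. of_int (c i)) (\<lambda>i. of_int (d i))"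
  by (rule eq_matI) (auto simp: dg_def)

text \<open>The block \<open>diag(A, A\<^sup>-\<^sup>T)\<close> where \<open>A\<close> is the elementary extension of
  \<open>(p, q; x, y) \<in> SL\<^sub>2\<close> in the coordinates \<open>i, j\<close>.\<close>

definition elem2 :: "nat \<Rightarrow> nat \<Rightarrow> 'a \<Rightarrow> 'a \<Rightarrow> 'a \<Rightarrow> 'a \<Rightarrow> nat \<Rightarrow> nat \<Rightarrow> 'a::comm_ring_1" where
  "elem2 i j p q x y k l = (if k = i then (if l = i then p else if l = j then q else 0)
     else if k = j then (if l = i then x else if l = j then y else 0) else if k = l then 1 else 0)"

definition levi :: "nat \<Rightarrow> nat \<Rightarrow> nat \<Rightarrow> 'a \<Rightarrow> 'a \<Rightarrow> 'a \<Rightarrow> 'a \<Rightarrow> 'a::comm_ring_1 mat" where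
  "levi n i j p q x y = mat (2*n) (2*n) (\<lambda>(k, l).
     if k < n then (if l < n then elem2 i j p q x y k l else 0)
     else (if l < n then 0 else elem2 i j y (- x) (- q) p (k - n) (l - n)))"

lemma levi_carrier [simp]: "levi n i j p q x y \<in> carrier_mat (2*n) (2*n)"
  by (simp add: levi_def)

lemma dim_levi [simp]: "dim_row (levi n i j p q x y) = 2*n" "dim_col (levi n i j p q x y) = 2*n"
  by (simp_all add: levi_def)

lemma levi_index:
  assumes "k < n" "l < n"
  shows "levi n i j p q x y $$ (k, l) = elem2 i j p q x y k l" "levi n i j p q x y $$ (k, n + l) = 0"
    "levi n i j p q x y $$ (n + k, l) = 0" "levi n i j p q x y $$ (n + k, n + l) = elem2 i j y (- x) (- q) p k l"
  using assms by (auto simp: levi_def)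

lemma sum_elem2:
  assumes "i < n" "j < n" "i \<noteq> j" "k < n"
  shows "(\<Sum>l<n. elem2 i j p q x y k l * f l) = (if k = i then p * f i + q * f j else if k = j then x * f i + y * f j else f k)"
proof -
  have "(\<Sum>l<n. elem2 i j p q x y k l * f l) = (\<Sum>l<n. (if l = i then elem2 i j p q x y k i * f i else 0)
      + (if l = j then elem2 i j p q x y k j * f j else 0) + (if l = k then (if k = i \<or> k = j then 0 else f k) else 0))"
    using assms(3) by (intro sum.cong) (auto simp: elem2_def)
  also have "\<dots> = (if k = i then p * f i + q * f j else if k = j then x * f i + y * f j else f k)"
    using assms by (simp add: sum.distrib elem2_def)
  finally show ?thesis .
qed

lemma levi_mult_vec:
  fixes v :: "'a::comm_ring_1 vec"
  assumes v: "v \<in> carrier_vec (2*n)" and ij: "i < n" "j < n" "i \<noteq> j" and k: "k < n"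
  shows "(levi n i j p q x y *\<^sub>v v) $ k = (if k = i then p * v $ i + q * v $ j else if k = j then x * v $ i + y * v $ j else v $ k)"
    "(levi n i j p q x y *\<^sub>v v) $ (n + k) = (if k = i then y * v $ (n + i) - x * v $ (n + j)
       else if k = j then p * v $ (n + j) - q * v $ (n + i) else v $ (n + k))"
proof -
  have kk: "k < 2*n" "n + k < 2*n" using k by auto
  note idx = kk[THEN mult_vec_index_double[OF levi_carrier v]]
  show "(levi n i j p q x y *\<^sub>v v) $ k = (if k = i then p * v $ i + q * v $ j else if k = j then x * v $ i + y * v $ j else v $ k)"
    unfolding idx using k sum_elem2[OF ij k, of p q x y "\<lambda>l. v $ l"] by (simp add: levi_index)
  show "(levi n i j p q x y *\<^sub>v v) $ (n + k) = (if k = i then y * v $ (n + i) - x * v $ (n + j)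
       else if k = j then p * v $ (n + j) - q * v $ (n + i) else v $ (n + k))"
    unfolding idx using k sum_elem2[OF ij k, of y "-x" "-q" p "\<lambda>l. v $ (n + l)"] by (simp add: levi_index)
qed

text \<open>The joint contribution of the planes i and j to the form is multiplied by the
  determinant of the 2 x 2 matrix; the other planes are fixed.\<close>

lemma levi_Sp:
  assumes ij: "i < n" "j < n" "i \<noteq> j" and det: "p * y - q * x = 1"
  shows "levi n i j p q x y \<in> Sp n"
proof (rule Sp_I)
  fix v w :: "'a vec" assume v: "v \<in> carrier_vec (2*n)" and w: "w \<in> carrier_vec (2*n)"
  let ?L = "levi n i j p q x y"
  have split: "(\<Sum>k<n. f k) = f i + f j + (\<Sum>k\<in>{..<n} - {i} - {j}. f k)" for f :: "nat \<Rightarrow> 'a"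
    using ij by (simp add: sum.remove[of "{..<n}" i] sum.remove[of "{..<n} - {i}" j] add.assoc)
  have alg: "((y * a - x * b) * (p * c + q * d) - (p * e + q * f) * (y * g - x * h))
       + ((p * b - q * a) * (x * c + y * d) - (x * e + y * f) * (p * h - q * g)) = (a * c - e * g) + (b * d - f * h)" for a b c d e f g h
  proof -
    have "((y * a - x * b) * (p * c + q * d) - (p * e + q * f) * (y * g - x * h))
       + ((p * b - q * a) * (x * c + y * d) - (x * e + y * f) * (p * h - q * g)) = (p * y - q * x) * ((a * c - e * g) + (b * d - f * h))"
      by (simp add: algebra_simps)
    thus ?thesis using det by simp
  qed
  have rest: "(\<Sum>k\<in>{..<n} - {i} - {j}. (?L *\<^sub>v v) $ (n + k) * (?L *\<^sub>v w) $ k - (?L *\<^sub>v v) $ k * (?L *\<^sub>v w) $ (n + k))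
     = (\<Sum>k\<in>{..<n} - {i} - {j}. v $ (n + k) * w $ k - v $ k * w $ (n + k))"
    by (rule sum.cong) (simp_all add: levi_mult_vec[OF v ij] levi_mult_vec[OF w ij] del: index_mult_mat_vec)
  have "i \<noteq> j" "j \<noteq> i" using ij by auto
  thus "sform n (?L *\<^sub>v v) (?L *\<^sub>v w) = sform n v w"
    unfolding sform_def split rest
    using alg[of "v $ (n + i)" "v $ (n + j)" "w $ i" "w $ j" "v $ i" "v $ j" "w $ (n + i)" "w $ (n + j)"] ij(1,2)
    by (simp add: levi_mult_vec[OF v ij] levi_mult_vec[OF w ij] del: index_mult_mat_vec)
qed simp

lemma levi_parab: "(i < r \<longleftrightarrow> j < r) \<Longrightarrow> r \<le> n \<Longrightarrow> i < n \<Longrightarrow> j < n \<Longrightarrow> parab n r (levi n i j p q x y)"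
  unfolding parab_def by (auto simp: levi_def elem2_def)

lemma sinv_levi: "i \<noteq> j \<Longrightarrow> sinv n (levi n i j p q x y) = levi n i j y (- q) (- x) p"
proof (rule eq_mat_halves)
  assume ij: "i \<noteq> j"
  have e: "elem2 i j y (- x) (- q) p l k = elem2 i j y (- q) (- x) p k l"
    "elem2 i j p q x y l k = elem2 i j p x q y k l" for k l
    using ij by (simp_all add: elem2_def)
  fix k l assume kl: "k < n" "l < n"
  show "sinv n (levi n i j p q x y) $$ (k, l) = levi n i j y (- q) (- x) p $$ (k, l)"
    "sinv n (levi n i j p q x y) $$ (k, n + l) = levi n i j y (- q) (- x) p $$ (k, n + l)"
    "sinv n (levi n i j p q x y) $$ (n + k, l) = levi n i j y (- q) (- x) p $$ (n + k, l)"
    "sinv n (levi n i j p q x y) $$ (n + k, n + l) = levi n i j y (- q) (- x) p $$ (n + k, n + l)"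
    using kl by (simp_all add: sinv_index levi_index e)
qed auto

lemma rat_mat_levi: "rat_mat (levi n i j p q x y) = levi n i j (of_int p) (of_int q) (of_int x) (of_int y)"
  by (rule eq_mat_halves[where n = n]) (simp_all add: levi_index elem2_def)

text \<open>Membership of \<open>X Y\<^sup>-\<^sup>1\<close> in \<open>\<Gamma>\<^sub>0(N)\<close> only depends on the lower halves of \<open>X\<close> and \<open>Y\<close>:
  the condition is \<open>C\<^sub>X D\<^sub>Y\<^sup>T \<equiv> D\<^sub>X C\<^sub>Y\<^sup>T\<close> modulo \<open>N\<close>.\<close>

lemma GammaZ_quotient:
  assumes X: "X \<in> Sp n" and Y: "Y \<in> Sp n"
    and dv: "\<And>a b. a < n \<Longrightarrow> b < n \<Longrightarrow>
      int N dvd (\<Sum>k<n. X $$ (n + a, k) * Y $$ (n + b, n + k) - X $$ (n + a, n + k) * Y $$ (n + b, k))"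
  shows "X * sinv n Y \<in> GammaZ n N"
proof -
  have "int N dvd (X * sinv n Y) $$ (n + a, b)" if ab: "a < n" "b < n" for a b
  proof -
    have "(X * sinv n Y) $$ (n + a, b) = (\<Sum>k<n. X $$ (n + a, k) * sinv n Y $$ (k, b))
        + (\<Sum>k<n. X $$ (n + a, n + k) * sinv n Y $$ (n + k, b))"
      by (rule mult_mat_index_double[OF Sp_carrier[OF X] sinv_carrier]) (use ab in auto)
    also have "\<dots> = (\<Sum>k<n. X $$ (n + a, k) * Y $$ (n + b, n + k) - X $$ (n + a, n + k) * Y $$ (n + b, k))"
      using ab by (simp add: sinv_def sum_subtractf sum_negf)
    finally show ?thesis using dv[OF ab] by simp
  qed
  thus ?thesis using Sp_mult[OF X sinv_Sp[OF Y]] by (simp add: GammaZ_def)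
qed

text \<open>The criterion \<open>GammaZ_quotient\<close> for X = dg' levi and Y = dg. With A the
  upper block of \<open>levi\<close>, entry (k, l) of the condition is c'_k A_kl d_l - d'_k
  (A^-T)_kl c_l, so only the diagonal and the pair i, j impose anything.\<close>

lemma GammaZ_levi:
  fixes a b c d a' b' c' d' :: "nat \<Rightarrow> int"
  assumes ij: "i < n" "j < n" "i \<noteq> j" and det: "p * y - q * x = 1"
    and d1: "\<And>k. k < n \<Longrightarrow> a k * d k - b k * c k = 1" and d2: "\<And>k. k < n \<Longrightarrow> a' k * d' k - b' k * c' k = 1"
    and off: "\<And>k. k < n \<Longrightarrow> k \<noteq> i \<Longrightarrow> k \<noteq> j \<Longrightarrow> int N dvd c' k * d k - d' k * c k"
    and ii: "int N dvd c' i * d i * p - d' i * c i * y"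
    and ij': "int N dvd c' i * d j * q + d' i * c j * x"
    and ji: "int N dvd c' j * d i * x + d' j * c i * q"
    and jj: "int N dvd c' j * d j * y - d' j * c j * p"
  shows "dg n a' b' c' d' * levi n i j p q x y * sinv n (dg n a b c d) \<in> GammaZ n N"
proof -
  let ?X = "dg n a' b' c' d'" and ?L = "levi n i j p q x y" and ?W = "dg n a b c d"
  have S: "?X \<in> Sp n" "?L \<in> Sp n" "?W \<in> Sp n" using dg_Sp[OF d1] dg_Sp[OF d2] levi_Sp[OF ij det] by auto
  have X: "?X * ?L \<in> Sp n" by (rule Sp_mult[OF S(1,2)])
  have XL: "(?X * ?L) $$ (n + k, l) = c' k * elem2 i j p q x y k l"
    "(?X * ?L) $$ (n + k, n + l) = d' k * elem2 i j y (- x) (- q) p k l" if kl: "k < n" "l < n" for k l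
  proof -
    have "n + k < 2*n" "l < 2*n" "n + l < 2*n" using kl by auto
    note idx = mult_mat_index_double[OF dg_carrier levi_carrier this(1) this(2)] mult_mat_index_double[OF dg_carrier levi_carrier this(1) this(3)]
    show "(?X * ?L) $$ (n + k, l) = c' k * elem2 i j p q x y k l"
      unfolding idx using kl by (simp add: dg_index levi_index sum_delta_mult)
    show "(?X * ?L) $$ (n + k, n + l) = d' k * elem2 i j y (- x) (- q) p k l"
      unfolding idx using kl by (simp add: dg_index levi_index sum_delta_mult)
  qed
  show ?thesis
  proof (rule GammaZ_quotient[OF X S(3)])
    fix k l assume kl: "k < n" "l < n"
    have "(\<Sum>m<n. (?X * ?L) $$ (n + k, m) * ?W $$ (n + l, n + m) - (?X * ?L) $$ (n + k, n + m) * ?W $$ (n + l, m))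
        = (\<Sum>m<n. if m = l then c' k * elem2 i j p q x y k l * d l - d' k * elem2 i j y (- x) (- q) p k l * c l else 0)"
      using kl by (intro sum.cong) (auto simp: XL dg_index simp del: index_mult_mat)
    also have "\<dots> = c' k * elem2 i j p q x y k l * d l - d' k * elem2 i j y (- x) (- q) p k l * c l"
      using kl by simp
    also have "int N dvd \<dots>"
    proof -
      consider "k = i" "l = i" | "k = i" "l = j" | "k = j" "l = i" | "k = j" "l = j"
        | "k = l" "k \<noteq> i" "k \<noteq> j" | "k \<noteq> l" "k \<notin> {i, j} \<or> l \<notin> {i, j}" by blast
      thus ?thesis
      proof cases
        case 5 thus ?thesis using off[of k] kl by (simp add: elem2_def)
      next
        case 6 thus ?thesis by (auto simp: elem2_def)
      qed (use ii ij' ji jj ij in \<open>simp_all add: elem2_def ac_simps\<close>)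
    qed
    finally show "int N dvd (\<Sum>m<n. (?X * ?L) $$ (n + k, m) * ?W $$ (n + l, n + m) - (?X * ?L) $$ (n + k, n + m) * ?W $$ (n + l, m))" .
  qed
qed

text \<open>On the plane \<open>j\<close> this is \<open>(1, -e; 0, 1) (1, 0; e, 1) (1, -e; 0, 1)\<close> with \<open>e = e\<^sub>j\<close>, the identity
  for \<open>e = 0\<close> and \<open>J\<close> for \<open>e = 1\<close>. Hence for \<open>e\<^sub>j\<close> idempotent modulo \<open>N\<close> it is a Weyl element
  modulo each prime divisor of \<open>N\<close>.\<close>

definition wm :: "nat \<Rightarrow> (nat \<Rightarrow> int) \<Rightarrow> int mat" where
  "wm n e = dg n (\<lambda>j. 1 - (e j)^2) (\<lambda>j. (e j)^3 - 2 * e j) e (\<lambda>j. 1 - (e j)^2)"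

lemma wm_det: "(1 - e^2) * (1 - e^2) - (e^3 - 2 * e) * e = (1::'a::comm_ring_1)"
  by (simp add: algebra_simps power2_eq_square power3_eq_cube)

lemma wm_Sp [simp]: "wm n e \<in> Sp n"
  unfolding wm_def by (rule dg_Sp) (rule wm_det)

section \<open>Idempotents modulo N and congruences at its prime divisors\<close>

definition idem :: "nat \<Rightarrow> int \<Rightarrow> bool" where
  "idem N e \<longleftrightarrow> (\<forall>p. prime p \<longrightarrow> p dvd N \<longrightarrow> int p dvd e \<or> int p dvd e - 1)"

text \<open>Chinese remainder theorem: with t the product of the prime divisors satisfying Q, u that
  of the others and kt + lu = 1, the integer lu is 1 modulo t and 0 modulo u.\<close>

lemma idem_exists:
  assumes "N > 0"
  shows "\<exists>e. idem N e \<and> (\<forall>p. prime p \<longrightarrow> p dvd N \<longrightarrow> (int p dvd e \<longleftrightarrow> \<not> Q p))"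
proof -
  define t where "t = (\<Prod>p | p \<in> prime_factors N \<and> Q p. int p)"
  define u where "u = (\<Prod>p | p \<in> prime_factors N \<and> \<not> Q p. int p)"
  have "coprime t u" unfolding t_def u_def
  proof (intro prod_coprime_left prod_coprime_right)
    fix a b assume "a \<in> {p \<in> prime_factors N. Q p}" "b \<in> {p \<in> prime_factors N. \<not> Q p}"
    hence "prime a" "prime b" "a \<noteq> b" by auto
    thus "coprime (int a) (int b)" by (simp add: primes_coprime)
  qed
  then obtain k l where kl: "k * t + l * u = 1" using bezout_int[of t u] by (auto simp: coprime_iff_gcd_eq_1)
  define e where "e = l * u"
  have "(Q p \<longrightarrow> int p dvd e - 1) \<and> (\<not> Q p \<longrightarrow> int p dvd e)" if p: "prime p" "p dvd N" for p
  proof -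
    have pf: "p \<in> prime_factors N" using p assms by (simp add: prime_factors_dvd)
    have fin: "finite {p \<in> prime_factors N. R p}" for R by simp
    have "Q p \<Longrightarrow> int p dvd t" unfolding t_def using pf by (intro dvd_prodI) auto
    moreover have "\<not> Q p \<Longrightarrow> int p dvd u" unfolding u_def using pf by (intro dvd_prodI) auto
    moreover have "e - 1 = - (k * t)" using kl by (simp add: e_def)
    ultimately show ?thesis by (auto simp: e_def)
  qed
  moreover have "\<not> int p dvd e" if "int p dvd e - 1" "prime p" for p
  proof
    assume "int p dvd e"
    hence "int p dvd e - (e - 1)" using that(1) by (rule dvd_diff)
    hence "int p dvd 1" by simp
    thus False using prime_gt_1_nat[OF that(2)] by (simp only: zdvd1_eq)
  qed
  ultimately show ?thesis unfolding idem_def by blast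
qed

text \<open>Corrects a Bezout coefficient x by a multiple of m so that it vanishes at all p | N
  where m is invertible. With t the product of these p and kt + lm = 1, the multiplier -lx works,
  since x - lxm = xkt.\<close>

lemma solve_linear_primes:
  assumes "N > 0"
  shows "\<exists>k. \<forall>p. prime p \<longrightarrow> p dvd N \<longrightarrow> \<not> int p dvd m \<longrightarrow> int p dvd x + k * m"
proof -
  define t where "t = (\<Prod>p | p \<in> prime_factors N \<and> \<not> int p dvd m. int p)"
  have "coprime t m" unfolding t_def
  proof (rule prod_coprime_left)
    fix a assume "a \<in> {p \<in> prime_factors N. \<not> int p dvd m}"
    hence "prime (int a)" "\<not> int a dvd m" by auto
    thus "coprime (int a) m" by (rule prime_imp_coprime)
  qed
  then obtain k l where kl: "k * t + l * m = 1" using bezout_int[of t m] by (auto simp: coprime_iff_gcd_eq_1)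
  have "int p dvd x + (- l * x) * m" if p: "prime p" "p dvd N" "\<not> int p dvd m" for p
  proof -
    have pf: "p \<in> prime_factors N" using p assms by (simp add: prime_factors_dvd)
    have "int p dvd t" unfolding t_def using pf p by (intro dvd_prodI) auto
    moreover have "x + (- l * x) * m = x * (k * t)"
    proof -
      have "x + (- l * x) * m = x * (k * t + l * m) - l * x * m" using kl by simp
      thus ?thesis by (simp add: algebra_simps)
    qed
    ultimately show ?thesis by simp
  qed
  thus ?thesis by blast
qed

text \<open>All multiplicities in N are at most 1, so congruences modulo N may be checked one prime
  at a time, where every e with \<open>idem\<close> is 0 or 1.\<close>

lemma squarefree_dvdI:
  fixes N :: nat and x :: int
  assumes "squarefree N" "N > 0" "\<And>p. prime p \<Longrightarrow> p dvd N \<Longrightarrow> int p dvd x"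
  shows "int N dvd x"
proof -
  have "N dvd nat \<bar>x\<bar>"
  proof (cases "x = 0")
    case False
    show ?thesis
    proof (rule multiplicity_le_imp_dvd)
      fix p :: nat assume p: "prime p"
      show "multiplicity p N \<le> multiplicity p (nat \<bar>x\<bar>)"
      proof (cases "p dvd N")
        case True
        have "multiplicity p N \<le> 1" using squarefree_factorial_semiring''[of N] assms(1,2) p by auto
        moreover have "p dvd nat \<bar>x\<bar>" using assms(3)[OF p True] by (simp add: nat_dvd_iff int_dvd_int_iff[symmetric] del: int_dvd_int_iff)
        hence "multiplicity p (nat \<bar>x\<bar>) \<ge> 1" using False p by (intro multiplicity_geI) auto
        ultimately show ?thesis by linarith
      qed (simp add: not_dvd_imp_multiplicity_0)
    qed (use assms False in auto)
  qed simp
  thus ?thesis by (simp add: int_dvd_int_iff[symmetric] del: int_dvd_int_iff)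
qed

lemma rat_pair_coprime:
  fixes x y :: rat
  obtains d a b where "coprime a b" "x = d * of_int a" "y = d * of_int b"
proof -
  obtain a1 b1 where 1: "x = of_int a1 / of_int b1" "b1 > 0" by (metis Fract_of_int_quotient Rat_cases)
  obtain a2 b2 where 2: "y = of_int a2 / of_int b2" "b2 > 0" by (metis Fract_of_int_quotient Rat_cases)
  define g where "g = gcd (a1 * b2) (a2 * b1)"
  show ?thesis
  proof (cases "g = 0")
    case True
    hence "x = 0" "y = 0" using 1 2 by (auto simp: g_def)
    \<comment> \<open>The zero pair is 0 times the coprime pair (1, 0).\<close>
    thus ?thesis using that[of 1 0 0] by simp
  next
    case False
    have "a1 * b2 = g * (a1 * b2 div g)" "a2 * b1 = g * (a2 * b1 div g)" by (auto simp: g_def)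
    hence e: "of_int a1 * of_int b2 = (of_int g * of_int (a1 * b2 div g) :: rat)"
      "of_int a2 * of_int b1 = (of_int g * of_int (a2 * b1 div g) :: rat)" by (metis of_int_mult)+
    have "coprime (a1 * b2 div g) (a2 * b1 div g)" using False unfolding g_def
      by (intro div_gcd_coprime) auto
    thus ?thesis
    proof (rule that[of _ _ "of_int g / (of_int b1 * of_int b2)"])
      have "x = of_int a1 * of_int b2 / (of_int b1 * of_int b2)" using 1 2 by (simp add: field_simps)
      thus "x = of_int g / (of_int b1 * of_int b2) * of_int (a1 * b2 div g)" unfolding e by simp
      have "y = of_int a2 * of_int b1 / (of_int b1 * of_int b2)" using 1 2 by (simp add: field_simps)
      thus "y = of_int g / (of_int b1 * of_int b2) * of_int (a2 * b1 div g)" unfolding e by simp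
    qed
  qed
qed

section \<open>Reduction of vectors\<close>

lemma GammaZ_Sp: "g \<in> GammaZ n N \<Longrightarrow> g \<in> Sp n"
  by (simp add: GammaZ_def)

lemma GammaZ_carrier: "g \<in> GammaZ n N \<Longrightarrow> rat_mat g \<in> carrier_mat (2*n) (2*n)"
  using Sp_carrier[OF rat_mat_Sp[OF GammaZ_Sp]] .

lemma rat_mat_mult_vec:
  assumes "g \<in> Sp n" "h \<in> Sp n" "v \<in> carrier_vec (2*n)"
  shows "rat_mat (g * h) *\<^sub>v v = rat_mat g *\<^sub>v (rat_mat h *\<^sub>v v)"
  unfolding rat_mat_mult[OF Sp_carrier[OF assms(1)] Sp_carrier[OF assms(2)]]
  by (rule assoc_mult_mat_vec[OF Sp_carrier[OF rat_mat_Sp[OF assms(1)]] Sp_carrier[OF rat_mat_Sp[OF assms(2)]] assms(3)])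

lemma rat_mat_wm:
  "rat_mat (wm n e) = dg n (\<lambda>j. 1 - (of_int (e j))^2) (\<lambda>j. (of_int (e j))^3 - 2 * of_int (e j)) (\<lambda>j. of_int (e j))
     (\<lambda>j. 1 - (of_int (e j))^2)"
  unfolding wm_def rat_mat_dg by (rule dg_cong) simp

lemma wm_mult_vec:
  assumes "v \<in> carrier_vec (2*n)" "i < n"
  shows "(rat_mat (wm n e) *\<^sub>v v) $ i = (1 - (of_int (e i))^2) * v $ i + ((of_int (e i))^3 - 2 * of_int (e i)) * v $ (n + i)"
    "(rat_mat (wm n e) *\<^sub>v v) $ (n + i) = of_int (e i) * v $ i + (1 - (of_int (e i))^2) * v $ (n + i)"
  unfolding rat_mat_wm dg_mult_vec[OF assms] by simp_all

lemma idem_0 [simp]: "idem N 0"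
  by (simp add: idem_def)

lemma idem_cases:
  assumes "idem N e" "prime p" "p dvd N"
  obtains "int p dvd e" | "\<not> int p dvd e" "int p dvd e - 1" "int p dvd 1 - e^2"
proof -
  have "1 - e^2 = (e - 1) * (- (e + 1))" by (simp add: algebra_simps power2_eq_square)
  thus ?thesis using assms that unfolding idem_def by (metis dvd_mult2)
qed

text \<open>In plane j the vector is \<mu> (x, y) with x, y coprime. Complete (x, y) to the first
  column of M in SL_2(Z) and apply w M^-1, where w is the matrix of \<open>wm\<close> for e: this
  sends (x, y) to the first column (1 - e^2, e) of w. With e equal to 0 exactly at the primes
  dividing y, a suitable M makes the lower left entry of w M^-1 divisible by N.\<close>

lemma reduce_plane:
  assumes N: "N > 0" "squarefree N" and v: "v \<in> carrier_vec (2*n)" and j: "j < n"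
  shows "\<exists>g\<in>GammaZ n N. \<exists>e \<mu>. idem N e \<and> (rat_mat g *\<^sub>v v) $ j = \<mu> * (1 - (of_int e)^2) \<and>
    (rat_mat g *\<^sub>v v) $ (n + j) = \<mu> * of_int e \<and>
    (\<forall>k<n. k \<noteq> j \<longrightarrow> (rat_mat g *\<^sub>v v) $ k = v $ k \<and> (rat_mat g *\<^sub>v v) $ (n + k) = v $ (n + k))"
proof -
  obtain \<mu> x y where xy: "coprime x y" "v $ j = \<mu> * of_int x" "v $ (n + j) = \<mu> * of_int y"
    using rat_pair_coprime .
  obtain z w where zw: "z * x + w * y = 1" using bezout_int[of x y] xy(1) by (auto simp: coprime_iff_gcd_eq_1)
  \<comment> \<open>The second column of M will be (Z', Z) with Z = z + ky. Where p does not divide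
    y, that is where e = 1, the entry uc = eZ - (1 - e^2) y demands Z = 0 modulo p.\<close>
  obtain k where k: "\<And>p. prime p \<Longrightarrow> p dvd N \<Longrightarrow> \<not> int p dvd y \<Longrightarrow> int p dvd z + k * y"
    using solve_linear_primes[OF N(1)] by blast
  obtain e where e: "idem N e" "\<And>p. prime p \<Longrightarrow> p dvd N \<Longrightarrow> int p dvd e \<longleftrightarrow> int p dvd y"
    using idem_exists[OF N(1), of "\<lambda>p. \<not> int p dvd y"] by auto
  define Z Z' where "Z = z + k * y" and "Z' = - w + k * x"
  have ZZ: "Z * x - Z' * y = 1" using zw by (simp add: Z_def Z'_def algebra_simps)
  \<comment> \<open>The entries of w M^-1, with M^-1 = (Z, -Z'; -y, x).\<close>
  define ua ub uc ud where "ua = (1 - e^2) * Z - (e^3 - 2 * e) * y" and "ub = - (1 - e^2) * Z' + (e^3 - 2 * e) * x"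
    and "uc = e * Z - (1 - e^2) * y" and "ud = - e * Z' + (1 - e^2) * x"
  have "ua * ud - ub * uc = ((1 - e^2) * (1 - e^2) - (e^3 - 2 * e) * e) * (Z * x - Z' * y)"
    unfolding ua_def ub_def uc_def ud_def by (simp add: algebra_simps)
  hence det: "ua * ud - ub * uc = 1" unfolding ZZ wm_det by simp
  have r1: "ua * x + ub * y = 1 - e^2"
  proof -
    have "ua * x + ub * y = (1 - e^2) * (Z * x - Z' * y)" unfolding ua_def ub_def by (simp add: algebra_simps)
    thus ?thesis unfolding ZZ by simp
  qed
  have r2: "uc * x + ud * y = e"
  proof -
    have "uc * x + ud * y = e * (Z * x - Z' * y)" unfolding uc_def ud_def by (simp add: algebra_simps)
    thus ?thesis unfolding ZZ by simp
  qed
  have uc: "int N dvd uc"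
  proof (rule squarefree_dvdI[OF N(2,1)])
    fix p assume p: "prime p" "p dvd N"
    from e(1) p show "int p dvd uc"
    proof (cases rule: idem_cases)
      case 1 thus ?thesis using e(2)[OF p] by (simp add: uc_def)
    next
      case 2 thus ?thesis using e(2)[OF p] k[OF p] by (simp add: uc_def Z_def)
    qed
  qed
  define g where "g = dg n (\<lambda>i. if i = j then ua else 1) (\<lambda>i. if i = j then ub else 0) (\<lambda>i. if i = j then uc else 0) (\<lambda>i. if i = j then ud else 1)"
  have "g \<in> Sp n" unfolding g_def by (rule dg_Sp) (simp add: det)
  hence g: "g \<in> GammaZ n N" using uc by (auto simp: GammaZ_def g_def dg_index)
  have gv: "(rat_mat g *\<^sub>v v) $ k = of_int (if k = j then ua else 1) * v $ k + of_int (if k = j then ub else 0) * v $ (n + k)"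
    "(rat_mat g *\<^sub>v v) $ (n + k) = of_int (if k = j then uc else 0) * v $ k + of_int (if k = j then ud else 1) * v $ (n + k)"
    if "k < n" for k
    unfolding g_def rat_mat_dg dg_mult_vec[OF v that] by simp_all
  have "(rat_mat g *\<^sub>v v) $ j = \<mu> * of_int (ua * x + ub * y)"
    unfolding gv[OF j] xy by (simp add: algebra_simps)
  moreover have "(rat_mat g *\<^sub>v v) $ (n + j) = \<mu> * of_int (uc * x + ud * y)"
    unfolding gv[OF j] xy by (simp add: algebra_simps)
  moreover have "(rat_mat g *\<^sub>v v) $ k = v $ k \<and> (rat_mat g *\<^sub>v v) $ (n + k) = v $ (n + k)" if "k < n" "k \<noteq> j" for k
    unfolding gv[OF that(1)] using that(2) by simp
  ultimately show ?thesis using g e(1) unfolding r1 r2 by (intro bexI[of _ g] exI[of _ e] exI[of _ \<mu>]) auto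
qed

text \<open>An integral Levi element clears the lower coordinate of plane i, and
  \<open>reduce_plane\<close> turns plane j into \<mu> (1 - e^2, e), which is w applied to (\<mu>,
  0). The resulting vector is W v0, where v0 has only upper coordinates in both planes, and a Levi
  element L clears the one in plane i. Since W L W^-1 need not lie in Gamma_0(N), the left factor W
  is replaced by a W' with W' L W^-1 in Gamma_0(N): the Bruhat cell of L modulo p decides whether
  the J of plane j moves to plane i.\<close>

lemma kill_plane:
  assumes N: "N > 0" "squarefree N" and v: "v \<in> carrier_vec (2*n)" and ij: "i < n" "j < n" "i \<noteq> j"
  shows "\<exists>g\<in>GammaZ n N. (rat_mat g *\<^sub>v v) $ i = 0 \<and> (rat_mat g *\<^sub>v v) $ (n + i) = 0 \<and>
    (\<forall>k<n. k \<noteq> i \<longrightarrow> k \<noteq> j \<longrightarrow> (rat_mat g *\<^sub>v v) $ k = v $ k \<and> (rat_mat g *\<^sub>v v) $ (n + k) = v $ (n + k))"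
proof -
  obtain d a b where ab: "coprime a b" "v $ (n + i) = d * of_int a" "v $ (n + j) = d * of_int b"
    using rat_pair_coprime .
  obtain c1 c2 where c: "c1 * a + c2 * b = 1" using bezout_int[of a b] ab(1) by (auto simp: coprime_iff_gcd_eq_1)
  define g1 where "g1 = levi n i j c2 (- c1) a b"
  have "g1 \<in> Sp n" unfolding g1_def using c by (intro levi_Sp[OF ij]) (simp add: algebra_simps)
  hence g1: "g1 \<in> GammaZ n N" by (auto simp: GammaZ_def g1_def levi_index)
  define v1 where "v1 = rat_mat g1 *\<^sub>v v"
  have v1: "v1 \<in> carrier_vec (2*n)" unfolding v1_def by (rule mult_mat_vec_carrier[OF GammaZ_carrier[OF g1] v])
  have v1i: "v1 $ (n + i) = 0" unfolding v1_def g1_def rat_mat_levi levi_mult_vec[OF v ij ij(1)] ab by simp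
  have v1k: "v1 $ k = v $ k" "v1 $ (n + k) = v $ (n + k)" if "k < n" "k \<noteq> i" "k \<noteq> j" for k
    unfolding v1_def g1_def rat_mat_levi levi_mult_vec[OF v ij that(1)] using that by auto
  obtain g2 e \<mu> where g2: "g2 \<in> GammaZ n N" "idem N e" "(rat_mat g2 *\<^sub>v v1) $ j = \<mu> * (1 - (of_int e)^2)"
    "(rat_mat g2 *\<^sub>v v1) $ (n + j) = \<mu> * of_int e"
    "\<And>k. k < n \<Longrightarrow> k \<noteq> j \<Longrightarrow> (rat_mat g2 *\<^sub>v v1) $ k = v1 $ k \<and> (rat_mat g2 *\<^sub>v v1) $ (n + k) = v1 $ (n + k)"
    using reduce_plane[OF N v1 ij(2)] by blast
  define v2 where "v2 = rat_mat g2 *\<^sub>v v1"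
  have v2: "v2 \<in> carrier_vec (2*n)" unfolding v2_def by (rule mult_mat_vec_carrier[OF GammaZ_carrier[OF g2(1)] v1])
  obtain \<nu> l m where lm: "coprime l m" "v2 $ i = \<nu> * of_int l" "\<mu> = \<nu> * of_int m"
    using rat_pair_coprime .
  obtain r s where rs: "r * l + s * m = 1" using bezout_int[of l m] lm(1) by (auto simp: coprime_iff_gcd_eq_1)
  \<comment> \<open>Makes the lower left entry r' of the 2 x 2 matrix (m, -l; r', s') vanish at the
    p not dividing m, so that at these p the J of plane j can stay in place.\<close>
  obtain k where k: "\<And>p. prime p \<Longrightarrow> p dvd N \<Longrightarrow> \<not> int p dvd m \<Longrightarrow> int p dvd r + k * m"
    using solve_linear_primes[OF N(1)] by blast
  define r' s' where "r' = r + k * m" and "s' = s - k * l"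
  have det: "m * s' - (- l) * r' = 1" using rs by (simp add: r'_def s'_def algebra_simps)
  obtain e1 where e1: "idem N e1" "\<And>p. prime p \<Longrightarrow> p dvd N \<Longrightarrow> int p dvd e1 \<longleftrightarrow> \<not> (\<not> int p dvd e \<and> int p dvd m)"
    using idem_exists[OF N(1), of "\<lambda>p. \<not> int p dvd e \<and> int p dvd m"] by auto
  obtain e2 where e2: "idem N e2" "\<And>p. prime p \<Longrightarrow> p dvd N \<Longrightarrow> int p dvd e2 \<longleftrightarrow> \<not> (\<not> int p dvd e \<and> \<not> int p dvd m)"
    using idem_exists[OF N(1), of "\<lambda>p. \<not> int p dvd e \<and> \<not> int p dvd m"] by auto
  \<comment> \<open>f describes W, with J in plane j where e = 1. In f' this J sits in plane i at
    the primes dividing m and in plane j at the others.\<close>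
  define f f' where "f = (\<lambda>t. if t = j then e else 0)" and "f' = (\<lambda>t. if t = i then e1 else if t = j then e2 else 0)"
  define L where "L = levi n i j m (- l) r' s'"
  have cases: "int p dvd e1 * m" "int p dvd e1 * (1 - e^2) * (- l) + (1 - e1^2) * e * r'"
    "int p dvd e2 * r'" "int p dvd e2 * (1 - e^2) * s' - (1 - e2^2) * e * m" if p: "prime p" "p dvd N" for p
  proof -
    have k': "\<not> int p dvd m \<Longrightarrow> int p dvd r'" using k[OF p] by (simp add: r'_def)
    from g2(2) p have "int p dvd e1 * m \<and> int p dvd e1 * (1 - e^2) * (- l) + (1 - e1^2) * e * r' \<and>
      int p dvd e2 * r' \<and> int p dvd e2 * (1 - e^2) * s' - (1 - e2^2) * e * m"
    proof (cases rule: idem_cases)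
      case 1
      hence "int p dvd e1" "int p dvd e2" using e1(2)[OF p] e2(2)[OF p] by auto
      thus ?thesis using 1 by (simp add: dvd_add dvd_diff)
    next
      case e: 2
      show ?thesis
      proof (cases "int p dvd m")
        case True
        have a: "int p dvd e2" using e2(2)[OF p] True by simp
        have b: "int p dvd 1 - e1^2" using idem_cases[OF e1(1) p] e1(2)[OF p] True e by metis
        show ?thesis using True a b e by (simp add: dvd_add dvd_diff)
      next
        case False
        have a: "int p dvd e1" using e1(2)[OF p] False by simp
        have b: "int p dvd 1 - e2^2" using idem_cases[OF e2(1) p] e2(2)[OF p] False e by metis
        show ?thesis using k'[OF False] a b e by (simp add: dvd_add dvd_diff)
      qed
    qed
    thus "int p dvd e1 * m" "int p dvd e1 * (1 - e^2) * (- l) + (1 - e1^2) * e * r'"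
      "int p dvd e2 * r'" "int p dvd e2 * (1 - e^2) * s' - (1 - e2^2) * e * m" by auto
  qed
  define g3 where "g3 = wm n f' * L * sinv n (wm n f)"
  have g3: "g3 \<in> GammaZ n N" unfolding g3_def wm_def L_def
  proof (rule GammaZ_levi[OF ij det wm_det wm_det])
    show "int N dvd f' i * (1 - (f i)^2) * m - (1 - (f' i)^2) * f i * s'"
      by (rule squarefree_dvdI[OF N(2,1)]) (use cases(1) ij in \<open>simp add: f_def f'_def\<close>)
    show "int N dvd f' i * (1 - (f j)^2) * (- l) + (1 - (f' i)^2) * f j * r'"
      by (rule squarefree_dvdI[OF N(2,1)]) (use cases(2) ij in \<open>simp add: f_def f'_def\<close>)
    show "int N dvd f' j * (1 - (f i)^2) * r' + (1 - (f' j)^2) * f i * (- l)"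
      by (rule squarefree_dvdI[OF N(2,1)]) (use cases(3) ij in \<open>simp add: f_def f'_def\<close>)
    show "int N dvd f' j * (1 - (f j)^2) * s' - (1 - (f' j)^2) * f j * m"
      by (rule squarefree_dvdI[OF N(2,1)]) (use cases(4) ij in \<open>simp add: f_def f'_def\<close>)
  qed (simp add: f_def f'_def)
  \<comment> \<open>Undoes W: in plane j the vector (\<mu> (1 - e^2), \<mu> e) comes from (\<mu>,
    0).\<close>
  define v0 where "v0 = vec (2*n) (\<lambda>t. if t = j then \<mu> else if t = n + j then 0 else v2 $ t)"
  have v0: "v0 \<in> carrier_vec (2*n)" by (simp add: v0_def)
  have Wv0: "rat_mat (wm n f) *\<^sub>v v0 = v2"
  proof (rule vec_eq_halves[OF mult_mat_vec_carrier[OF Sp_carrier[OF rat_mat_Sp[OF wm_Sp]] v0] v2])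
    fix t assume t: "t < n"
    show "(rat_mat (wm n f) *\<^sub>v v0) $ t = v2 $ t" "(rat_mat (wm n f) *\<^sub>v v0) $ (n + t) = v2 $ (n + t)"
      unfolding wm_mult_vec[OF v0 t] using t ij g2(3,4) by (auto simp: f_def v0_def v2_def[symmetric])
  qed
  have LS: "L \<in> Sp n" unfolding L_def by (rule levi_Sp[OF ij det])
  define v3 where "v3 = rat_mat L *\<^sub>v v0"
  have v3: "v3 \<in> carrier_vec (2*n)" unfolding v3_def by (rule mult_mat_vec_carrier[OF Sp_carrier[OF rat_mat_Sp[OF LS]] v0])
  have "rat_mat g3 *\<^sub>v v2 = rat_mat (wm n f') *\<^sub>v (rat_mat L *\<^sub>v (rat_mat (sinv n (wm n f)) *\<^sub>v v2))"
    unfolding g3_def rat_mat_mult_vec[OF Sp_mult[OF wm_Sp LS] sinv_Sp[OF wm_Sp] v2]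
    by (rule rat_mat_mult_vec[OF wm_Sp LS mult_mat_vec_carrier[OF Sp_carrier[OF rat_mat_Sp[OF sinv_Sp[OF wm_Sp]]] v2]])
  also have "rat_mat (sinv n (wm n f)) *\<^sub>v v2 = rat_mat (sinv n (wm n f) * wm n f) *\<^sub>v v0"
    unfolding Wv0[symmetric] by (rule rat_mat_mult_vec[OF sinv_Sp[OF wm_Sp] wm_Sp v0, symmetric])
  also have "\<dots> = v0" unfolding sinv_left[OF wm_Sp] of_int_hom.mat_hom_one using v0 by simp
  finally have gv: "rat_mat g3 *\<^sub>v v2 = rat_mat (wm n f') *\<^sub>v v3" unfolding v3_def .
  have v3i: "v3 $ i = 0" "v3 $ (n + i) = 0"
    unfolding v3_def L_def rat_mat_levi levi_mult_vec[OF v0 ij ij(1)]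
    using ij lm v1i g2(5)[OF ij(1,3)] by (simp_all add: v0_def v2_def[symmetric] algebra_simps)
  have v3k: "v3 $ k = v2 $ k" "v3 $ (n + k) = v2 $ (n + k)" if "k < n" "k \<noteq> i" "k \<noteq> j" for k
    unfolding v3_def L_def rat_mat_levi levi_mult_vec[OF v0 ij that(1)] using that ij by (auto simp: v0_def)
  define g where "g = g3 * (g2 * g1)"
  have g: "g \<in> GammaZ n N" unfolding g_def by (intro GammaZ_mult g1 g2 g3)
  have "rat_mat g *\<^sub>v v = rat_mat (wm n f') *\<^sub>v v3"
    unfolding g_def rat_mat_mult_vec[OF GammaZ_Sp[OF g3] GammaZ_Sp[OF GammaZ_mult[OF g2(1) g1]] v]
      rat_mat_mult_vec[OF GammaZ_Sp[OF g2(1)] GammaZ_Sp[OF g1] v] v1_def[symmetric] v2_def[symmetric] gv ..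
  moreover have "(rat_mat (wm n f') *\<^sub>v v3) $ i = 0" "(rat_mat (wm n f') *\<^sub>v v3) $ (n + i) = 0"
    unfolding wm_mult_vec[OF v3 ij(1)] v3i by simp_all
  moreover have "(rat_mat (wm n f') *\<^sub>v v3) $ k = v $ k \<and> (rat_mat (wm n f') *\<^sub>v v3) $ (n + k) = v $ (n + k)"
    if k: "k < n" "k \<noteq> i" "k \<noteq> j" for k
    unfolding wm_mult_vec[OF v3 k(1)] v3k[OF k] using g2(5)[OF k(1,3)] v1k[OF k] k
    by (simp add: f'_def v2_def)
  ultimately show ?thesis using g by (intro bexI[of _ g]) auto
qed

text \<open>\<open>kill_plane\<close> empties the planes 0, ..., n - 1 one after another into plane
  n, which \<open>reduce_plane\<close> normalises at the end; a cleared plane is not touched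
  again.\<close>

lemma reduce_vector:
  assumes N: "N > 0" "squarefree N" and v: "v \<in> carrier_vec (2 * Suc n)"
  shows "\<exists>g\<in>GammaZ (Suc n) N. \<exists>e \<mu>. idem N e \<and>
    (\<forall>k<n. (rat_mat g *\<^sub>v v) $ k = 0 \<and> (rat_mat g *\<^sub>v v) $ (Suc n + k) = 0) \<and>
    (rat_mat g *\<^sub>v v) $ n = \<mu> * (1 - (of_int e)^2) \<and> (rat_mat g *\<^sub>v v) $ (Suc n + n) = \<mu> * of_int e"
proof -
  have "\<exists>g\<in>GammaZ (Suc n) N. \<forall>k<m. (rat_mat g *\<^sub>v v) $ k = 0 \<and> (rat_mat g *\<^sub>v v) $ (Suc n + k) = 0" if "m \<le> n" for m
    using that
  proof (induction m)
    case 0 thus ?case using GammaZ_one by blast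
  next
    case (Suc m)
    then obtain g where g: "g \<in> GammaZ (Suc n) N"
      "\<And>k. k < m \<Longrightarrow> (rat_mat g *\<^sub>v v) $ k = 0 \<and> (rat_mat g *\<^sub>v v) $ (Suc n + k) = 0" by auto
    define u where "u = rat_mat g *\<^sub>v v"
    have u: "u \<in> carrier_vec (2 * Suc n)" unfolding u_def by (rule mult_mat_vec_carrier[OF GammaZ_carrier[OF g(1)] v])
    obtain h where h: "h \<in> GammaZ (Suc n) N" "(rat_mat h *\<^sub>v u) $ m = 0" "(rat_mat h *\<^sub>v u) $ (Suc n + m) = 0"
      "\<And>k. k < Suc n \<Longrightarrow> k \<noteq> m \<Longrightarrow> k \<noteq> n \<Longrightarrow> (rat_mat h *\<^sub>v u) $ k = u $ k \<and> (rat_mat h *\<^sub>v u) $ (Suc n + k) = u $ (Suc n + k)"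
      using kill_plane[OF N u, of m n] Suc.prems by (metis lessI less_SucI Suc_le_lessD less_irrefl)
    have "rat_mat (h * g) *\<^sub>v v = rat_mat h *\<^sub>v u" unfolding u_def
      by (rule rat_mat_mult_vec[OF GammaZ_Sp[OF h(1)] GammaZ_Sp[OF g(1)] v])
    moreover have "(rat_mat h *\<^sub>v u) $ k = 0 \<and> (rat_mat h *\<^sub>v u) $ (Suc n + k) = 0" if "k < Suc m" for k
    proof (cases "k = m")
      case True thus ?thesis using h(2,3) by simp
    next
      case False
      hence "k < m" using that by simp
      thus ?thesis using h(4)[of k] g(2)[of k] Suc.prems unfolding u_def by auto
    qed
    ultimately show ?case using GammaZ_mult[OF h(1) g(1)] by (intro bexI[of _ "h * g"]) auto
  qed
  from this[OF order_refl] obtain g where g: "g \<in> GammaZ (Suc n) N"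
    "\<And>k. k < n \<Longrightarrow> (rat_mat g *\<^sub>v v) $ k = 0 \<and> (rat_mat g *\<^sub>v v) $ (Suc n + k) = 0" by auto
  define u where "u = rat_mat g *\<^sub>v v"
  have u: "u \<in> carrier_vec (2 * Suc n)" unfolding u_def by (rule mult_mat_vec_carrier[OF GammaZ_carrier[OF g(1)] v])
  obtain h e \<mu> where h: "h \<in> GammaZ (Suc n) N" "idem N e" "(rat_mat h *\<^sub>v u) $ n = \<mu> * (1 - (of_int e)^2)"
    "(rat_mat h *\<^sub>v u) $ (Suc n + n) = \<mu> * of_int e"
    "\<And>k. k < Suc n \<Longrightarrow> k \<noteq> n \<Longrightarrow> (rat_mat h *\<^sub>v u) $ k = u $ k \<and> (rat_mat h *\<^sub>v u) $ (Suc n + k) = u $ (Suc n + k)"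
    using reduce_plane[OF N u, of n] by blast
  have e: "rat_mat (h * g) *\<^sub>v v = rat_mat h *\<^sub>v u" unfolding u_def
    by (rule rat_mat_mult_vec[OF GammaZ_Sp[OF h(1)] GammaZ_Sp[OF g(1)] v])
  have "(rat_mat h *\<^sub>v u) $ k = 0 \<and> (rat_mat h *\<^sub>v u) $ (Suc n + k) = 0" if "k < n" for k
    using h(5)[of k] g(2)[OF that] that unfolding u_def by simp
  thus ?thesis using h GammaZ_mult[OF h(1) g(1)] e by (intro bexI[of _ "h * g"] exI[of _ e] exI[of _ \<mu>]) auto
qed

lemma GammaZ_xi:
  assumes "M \<in> GammaZ r N" "r \<le> n" shows "xi r n M \<in> GammaZ n N"
proof -
  have M: "M \<in> Sp r" using assms(1) by (rule GammaZ_Sp)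
  have "int N dvd xi r n M $$ (n + i, j)" if "i < n" "j < n" for i j
    using assms that by (auto simp: xi_index[OF Sp_carrier[OF M]] inF_def unemb_def GammaZ_def)
  thus ?thesis using xi_Sp[OF M assms(2)] by (simp add: GammaZ_def)
qed

section \<open>Double cosets\<close>

lemma wm_cong: "(\<And>j. j < n \<Longrightarrow> e j = e' j) \<Longrightarrow> wm n e = wm n e'"
  unfolding wm_def by (rule dg_cong) simp

lemma rat_wm_Sp: "rat_mat (wm n e) \<in> Sp n"
  by (rule rat_mat_Sp[OF wm_Sp])

lemma wm_res:
  assumes "\<forall>j<r. e j = 0" "r \<le> n" "v \<in> carrier_vec (2*n)"
  shows "res r n (rat_mat (wm n e) *\<^sub>v v) = res r n v"
proof (rule eq_vecI)
  fix i assume "i < dim_vec (res r n v)"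
  hence "i < r \<or> (\<exists>k<r. i = r + k)" by (simp add: res_def) presburger
  thus "res r n (rat_mat (wm n e) *\<^sub>v v) $ i = res r n v $ i"
    using wm_mult_vec[OF assms(3), of _ e] assms(1,2) by (auto simp del: index_mult_mat_vec)
qed (simp add: res_def)

text \<open>The two matrices act on complementary sets of planes.\<close>

lemma wm_xi_commute:
  assumes e: "\<forall>j<r. e j = 0" and rn: "r \<le> n" and M: "M \<in> carrier_mat (2*r) (2*r)"
  shows "rat_mat (wm n e) * xi r n M = xi r n M * rat_mat (wm n e)"
proof (rule mat_eq_via_action)
  note c = Sp_carrier[OF rat_wm_Sp[of n e]] xi_carrier[OF M rn]
  show "rat_mat (wm n e) * xi r n M \<in> carrier_mat (2*n) (2*n)" "xi r n M * rat_mat (wm n e) \<in> carrier_mat (2*n) (2*n)"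
    using mult_carrier_mat[OF c] mult_carrier_mat[OF c(2,1)] by auto
  fix v :: "rat vec" assume v: "v \<in> carrier_vec (2*n)"
  note cv = mult_mat_vec_carrier[OF c(1) v] mult_mat_vec_carrier[OF c(2) v]
  have "rat_mat (wm n e) *\<^sub>v (xi r n M *\<^sub>v v) = xi r n M *\<^sub>v (rat_mat (wm n e) *\<^sub>v v)"
  proof (rule vec_eq_res[OF mult_mat_vec_carrier[OF c(1) cv(2)] mult_mat_vec_carrier[OF c(2) cv(1)] rn])
    show "res r n (rat_mat (wm n e) *\<^sub>v (xi r n M *\<^sub>v v)) = res r n (xi r n M *\<^sub>v (rat_mat (wm n e) *\<^sub>v v))"
      unfolding wm_res[OF e rn cv(2)] xi_res(1)[OF M rn cv(1)] xi_res(1)[OF M rn v] wm_res[OF e rn v] ..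
    fix i assume i: "r \<le> i" "i < n"
    show "(rat_mat (wm n e) *\<^sub>v (xi r n M *\<^sub>v v)) $ i = (xi r n M *\<^sub>v (rat_mat (wm n e) *\<^sub>v v)) $ i \<and>
      (rat_mat (wm n e) *\<^sub>v (xi r n M *\<^sub>v v)) $ (n + i) = (xi r n M *\<^sub>v (rat_mat (wm n e) *\<^sub>v v)) $ (n + i)"
      unfolding wm_mult_vec[OF cv(2) i(2)] xi_res(2,3)[OF M rn cv(1) i] wm_mult_vec[OF v i(2)] xi_res(2,3)[OF M rn v i] by simp
  qed
  thus "rat_mat (wm n e) * xi r n M *\<^sub>v v = xi r n M * rat_mat (wm n e) *\<^sub>v v"
    unfolding assoc_mult_mat_vec[OF c v] assoc_mult_mat_vec[OF c(2,1) v] .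
qed

text \<open>Separates off the planes below r, whose factor is parabolic, on the right.\<close>

lemma wm_split:
  assumes rn: "r \<le> n"
  shows "rat_mat (wm n e) = rat_mat (wm n (\<lambda>j. if j < r then 0 else e j)) * xi r n (rat_mat (wm r e))"
proof (rule mat_eq_via_action)
  let ?h = "\<lambda>j. if j < r then 0 else e j"
  note M = Sp_carrier[OF rat_wm_Sp[of r e]]
  note c = Sp_carrier[OF rat_wm_Sp[of n "?h"]] xi_carrier[OF M rn]
  show "rat_mat (wm n e) \<in> carrier_mat (2*n) (2*n)" by (rule Sp_carrier[OF rat_wm_Sp])
  show "rat_mat (wm n ?h) * xi r n (rat_mat (wm r e)) \<in> carrier_mat (2*n) (2*n)" by (rule mult_carrier_mat[OF c])
  fix v :: "rat vec" assume v: "v \<in> carrier_vec (2*n)"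
  have rv: "res r n v \<in> carrier_vec (2*r)" by simp
  note cv = mult_mat_vec_carrier[OF c(2) v]
  have "rat_mat (wm n e) *\<^sub>v v = rat_mat (wm n ?h) *\<^sub>v (xi r n (rat_mat (wm r e)) *\<^sub>v v)"
  proof (rule vec_eq_res[OF _ mult_mat_vec_carrier[OF c(1) cv] rn])
    show "rat_mat (wm n e) *\<^sub>v v \<in> carrier_vec (2*n)" by (rule mult_mat_vec_carrier[OF Sp_carrier[OF rat_wm_Sp] v])
    have h0: "\<forall>j<r. ?h j = 0" by simp
    show "res r n (rat_mat (wm n e) *\<^sub>v v) = res r n (rat_mat (wm n ?h) *\<^sub>v (xi r n (rat_mat (wm r e)) *\<^sub>v v))"
      unfolding wm_res[OF h0 rn cv] xi_res(1)[OF M rn v]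
    proof (rule vec_eq_halves[OF res_carrier mult_mat_vec_carrier[OF M rv]])
      fix i assume i: "i < r"
      hence i': "i < n" using rn by simp
      show "res r n (rat_mat (wm n e) *\<^sub>v v) $ i = (rat_mat (wm r e) *\<^sub>v res r n v) $ i"
        unfolding res_index(1)[OF i] wm_mult_vec[OF v i'] wm_mult_vec[OF rv i] using i by simp
      show "res r n (rat_mat (wm n e) *\<^sub>v v) $ (r + i) = (rat_mat (wm r e) *\<^sub>v res r n v) $ (r + i)"
        unfolding res_index(2)[OF i] wm_mult_vec[OF v i'] wm_mult_vec[OF rv i] using i by simp
    qed
    fix i assume i: "r \<le> i" "i < n"
    show "(rat_mat (wm n e) *\<^sub>v v) $ i = (rat_mat (wm n ?h) *\<^sub>v (xi r n (rat_mat (wm r e)) *\<^sub>v v)) $ i \<and>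
      (rat_mat (wm n e) *\<^sub>v v) $ (n + i) = (rat_mat (wm n ?h) *\<^sub>v (xi r n (rat_mat (wm r e)) *\<^sub>v v)) $ (n + i)"
      unfolding wm_mult_vec[OF v i(2)] wm_mult_vec[OF cv i(2)] xi_res(2,3)[OF M rn v i] using i by simp
  qed
  thus "rat_mat (wm n e) *\<^sub>v v = rat_mat (wm n ?h) * xi r n (rat_mat (wm r e)) *\<^sub>v v"
    unfolding assoc_mult_mat_vec[OF c v] .
qed

text \<open>Every nonzero W_r contains the line W_n and lies in its annihilator. As u preserves W_n
  and acts trivially on the quotient of the annihilator by W_n, it preserves each W_r.\<close>

lemma parab_all:
  assumes u: "parab (Suc n) n u" and o: "omega (Suc n) n u = 1\<^sub>m (2*n)" and r: "r \<le> Suc n"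
  shows "parab (Suc n) r u"
proof -
  let ?N = "Suc n"
  have o': "u $$ (emb n ?N i, emb n ?N j) = (if i = j then 1 else 0)" if "i < 2*n" "j < 2*n" for i j
    using arg_cong[OF o, of "\<lambda>M. M $$ (i, j)"] that by (simp add: omega_index)
  have 1: "u $$ (i, j) = 0" if "i < n" "j < n" "i \<noteq> j" for i j using o'[of i j] that by simp
  have 2: "u $$ (?N + i, j) = 0" if "i < n" "j < n" for i j
    using o'[of "n + i" j] that by (simp del: add_Suc)
  have 3: "u $$ (?N + i, ?N + j) = 0" if "i < n" "j < n" "i \<noteq> j" for i j
    using o'[of "n + i" "n + j"] that by (simp del: add_Suc)
  have 4: "u $$ (i, n) = 0" "u $$ (?N + i, n) = 0" if "i < n" for i
    using u that by (auto simp: parab_def)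
  have 5: "u $$ (?N + n, j) = 0" if "j < ?N + n" for j
    using u that by (auto simp: parab_def)
  show ?thesis unfolding parab_def
  proof (intro conjI allI impI ballI)
    fix i j assume "i < r" "j \<in> {r..<?N}"
    hence ij: "i < n" "j < n \<or> j = n" "i \<noteq> j" by auto
    show "u $$ (i, j) = 0" using ij 1 4 by blast
    show "u $$ (?N + i, j) = 0" using ij 2 4 by blast
  next
    fix i j assume i: "i \<in> {r..<?N}" and j: "j < ?N + r"
    show "u $$ (?N + i, j) = 0"
    proof (cases "i = n")
      case True thus ?thesis using 5 i j by simp
    next
      case False
      hence i': "i < n" using i by simp
      consider "j < n" | "j = n" | k where "j = ?N + k" "k < r" using j by (metis less_Suc_eq le_add_diff_inverse add_less_cancel_left not_less)
      thus ?thesis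
      proof cases
        case 3
        have "k < n" "i \<noteq> k" using 3(2) i i' by auto
        thus ?thesis unfolding 3(1) using \<open>\<And>i j. i < n \<Longrightarrow> j < n \<Longrightarrow> i \<noteq> j \<Longrightarrow> u $$ (?N + i, ?N + j) = 0\<close> i' by blast
      qed (use i' 2 4 in auto)
    qed
  qed
qed

text \<open>The condition on b says that it stabilises the full flag of all W_r. Induction on n:
  \<open>reduce_vector\<close> normalises the image of the last upper basis vector, after which
  \<gamma>' stabilises the line spanned by it; the induction hypothesis applies to the action \<rho>
  of \<gamma>' on the quotient of the annihilator by this line.\<close>

lemma decomposition:
  assumes N: "N > 0" "squarefree N" and \<gamma>: "\<gamma> \<in> Sp n"
  shows "\<exists>g\<in>GammaZ n N. \<exists>e. \<exists>b\<in>Sp n. (\<forall>j. idem N (e j)) \<and> (\<forall>r\<le>n. parab n r b) \<and>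
    \<gamma> = rat_mat g * rat_mat (wm n e) * b"
  using \<gamma>
proof (induction n arbitrary: \<gamma>)
  case 0
  have "A = B" if "A \<in> carrier_mat 0 0" "B \<in> carrier_mat 0 0" for A B :: "rat mat"
    using that by (intro eq_matI) auto
  hence "\<gamma> = rat_mat (1\<^sub>m (2*0)) * rat_mat (wm 0 (\<lambda>_. 0)) * 1\<^sub>m (2*0)"
    using Sp_carrier[OF 0] Sp_carrier[OF rat_wm_Sp[of 0 "\<lambda>_. 0"]] by auto
  thus ?case using GammaZ_one[of 0 N] Sp_one[of 0] parab_one[of _ 0] by (metis idem_0)
next
  case (Suc n)
  let ?N = "Suc n"
  have nN: "n \<le> ?N" by simp
  note \<gamma>c = Sp_carrier[OF Suc.prems]
  define v where "v = \<gamma> *\<^sub>v unit_vec (2 * ?N) n"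
  have v: "v \<in> carrier_vec (2 * ?N)" unfolding v_def by (rule mult_mat_vec_carrier[OF \<gamma>c unit_vec_carrier])
  obtain g1 e0 \<mu> where g1: "g1 \<in> GammaZ ?N N" "idem N e0"
    "\<And>k. k < n \<Longrightarrow> (rat_mat g1 *\<^sub>v v) $ k = 0 \<and> (rat_mat g1 *\<^sub>v v) $ (?N + k) = 0"
    "(rat_mat g1 *\<^sub>v v) $ n = \<mu> * (1 - (of_int e0)^2)" "(rat_mat g1 *\<^sub>v v) $ (?N + n) = \<mu> * of_int e0"
    using reduce_vector[OF N v] by blast
  define W1 where "W1 = rat_mat (wm ?N (\<lambda>j. if j < n then 0 else e0))"
  have W1: "W1 \<in> Sp ?N" unfolding W1_def by (rule rat_wm_Sp)
  define G1 where "G1 = rat_mat g1"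
  have G1: "G1 \<in> Sp ?N" unfolding G1_def by (rule rat_mat_Sp[OF GammaZ_Sp[OF g1(1)]])
  note c1 = Sp_carrier[OF W1] Sp_carrier[OF G1]
  define x where "x = \<mu> \<cdot>\<^sub>v (unit_vec (2 * ?N) n :: rat vec)"
  have x: "x \<in> carrier_vec (2 * ?N)" by (simp add: x_def)
  have W1x: "W1 *\<^sub>v x = G1 *\<^sub>v v"
  proof (rule vec_eq_halves[OF mult_mat_vec_carrier[OF c1(1) x] mult_mat_vec_carrier[OF c1(2) v]])
    fix i assume i: "i < ?N"
    show "(W1 *\<^sub>v x) $ i = (G1 *\<^sub>v v) $ i" "(W1 *\<^sub>v x) $ (?N + i) = (G1 *\<^sub>v v) $ (?N + i)"
      unfolding W1_def wm_mult_vec[OF x i] G1_def using g1(3)[of i] g1(4,5) i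
      by (cases "i = n"; simp add: x_def del: index_mult_mat_vec)+
  qed
  define \<gamma>' where "\<gamma>' = sinv ?N W1 * (G1 * \<gamma>)"
  have \<gamma>': "\<gamma>' \<in> Sp ?N" unfolding \<gamma>'_def by (intro Sp_mult sinv_Sp W1 G1 Suc.prems)
  have "\<gamma>' *\<^sub>v unit_vec (2 * ?N) n = sinv ?N W1 *\<^sub>v (G1 *\<^sub>v v)"
    unfolding \<gamma>'_def v_def assoc_mult_mat_vec[OF sinv_carrier mult_carrier_mat[OF c1(2) \<gamma>c] unit_vec_carrier]
      assoc_mult_mat_vec[OF c1(2) \<gamma>c unit_vec_carrier] ..
  also have "\<dots> = x" unfolding W1x[symmetric] assoc_mult_mat_vec[OF sinv_carrier c1(1) x, symmetric] sinv_left[OF W1]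
    using x by simp
  finally have col: "\<gamma>' *\<^sub>v unit_vec (2 * ?N) n = x" .
  have coli: "\<gamma>' $$ (i, n) = x $ i" if "i < 2 * ?N" for i
    using arg_cong[OF col, of "\<lambda>u. u $ i"] that Sp_carrier[OF \<gamma>'] by (simp add: scalar_prod_right_unit)
  have p\<gamma>': "parab ?N n \<gamma>'"
  proof (rule Sp_stabilizer_parab[OF \<gamma>' nN])
    fix i j
    { assume "i < n" "j \<in> {n..<?N}"
      thus "\<gamma>' $$ (i, j) = 0" using coli[of i] by (simp add: x_def le_antisym less_Suc_eq_le) }
    { assume i: "i < ?N" and "j \<in> {n..<?N}"
      hence "j = n" by auto
      moreover have "?N + i < 2 * ?N" "?N + i \<noteq> n" using i by auto
      ultimately show "\<gamma>' $$ (?N + i, j) = 0" using coli[of "?N + i"] by (simp add: x_def del: add_Suc mult_Suc_right) }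
  qed
  define \<rho> where "\<rho> = omega ?N n \<gamma>'"
  have \<rho>: "\<rho> \<in> Sp n" unfolding \<rho>_def by (rule omega_Sp[OF \<gamma>' p\<gamma>' nN])
  obtain g2 e' b2 where IH: "g2 \<in> GammaZ n N" "b2 \<in> Sp n" "\<And>j. idem N (e' j)" "\<And>r. r \<le> n \<Longrightarrow> parab n r b2"
    "\<rho> = rat_mat g2 * rat_mat (wm n e') * b2" using Suc.IH[OF \<rho>] by blast
  note xS = xi_Sp[OF \<rho> nN]
  \<comment> \<open>\<gamma>' differs from the lift of \<rho> by u, which \<open>omega\<close> sends
    to the identity; hence u can be absorbed into b.\<close>
  define u where "u = sinv ?N (xi n ?N \<rho>) * \<gamma>'"
  have u: "u \<in> Sp ?N" unfolding u_def by (intro Sp_mult sinv_Sp xS \<gamma>')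
  have px: "parab ?N n (xi n ?N \<rho>)" by (rule parab_xi_ge[OF Sp_carrier[OF \<rho>]]) simp_all
  note psx = parab_sinv[OF nN px]
  have pu: "parab ?N n u" unfolding u_def
    by (rule parab_mult[OF sinv_carrier psx Sp_carrier[OF \<gamma>'] p\<gamma>' nN])
  have ou: "omega ?N n u = 1\<^sub>m (2*n)"
    unfolding u_def omega_mult[OF sinv_carrier psx Sp_carrier[OF \<gamma>'] p\<gamma>' nN] omega_sinv[OF xS px nN]
      omega_xi[OF Sp_carrier[OF \<rho>] nN] \<rho>_def[symmetric] by (rule sinv_left[OF \<rho>])
  note pall = parab_all[OF pu ou]
  define e where "e = (\<lambda>j. if j < n then e' j else e0)"
  have G2: "rat_mat g2 \<in> Sp n" by (rule rat_mat_Sp[OF GammaZ_Sp[OF IH(1)]])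
  define X2 W2 B2 where "X2 = xi n ?N (rat_mat g2)" and "W2 = xi n ?N (rat_mat (wm n e'))" and "B2 = xi n ?N b2"
  have S: "X2 \<in> Sp ?N" "W2 \<in> Sp ?N" "B2 \<in> Sp ?N"
    unfolding X2_def W2_def B2_def by (intro xi_Sp nN G2 rat_wm_Sp IH)+
  note m = mult_carrier_mat[of _ "2 * ?N" "2 * ?N" _ "2 * ?N"] and as = assoc_mult_square[of _ "2 * ?N"]
  note sc = S(1,2,3)[THEN Sp_carrier] and uc = Sp_carrier[OF u]
  have x\<rho>: "xi n ?N \<rho> = X2 * W2 * B2"
    unfolding IH(5) X2_def W2_def B2_def
      xi_mult[OF mult_carrier_mat[OF Sp_carrier[OF G2] Sp_carrier[OF rat_wm_Sp]] Sp_carrier[OF IH(2)] nN]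
      xi_mult[OF Sp_carrier[OF G2] Sp_carrier[OF rat_wm_Sp] nN] ..
  \<comment> \<open>W1 moves only the last plane and X2 only the others, so the element of
    Gamma_0(N) passes to the left of the Weyl element.\<close>
  have comm: "W1 * X2 = X2 * W1" unfolding W1_def X2_def
    by (rule wm_xi_commute[OF _ nN Sp_carrier[OF G2]]) simp
  have W: "W1 * W2 = rat_mat (wm ?N e)"
  proof -
    have a: "wm ?N (\<lambda>j. if j < n then 0 else e j) = wm ?N (\<lambda>j. if j < n then 0 else e0)"
      by (rule wm_cong) (simp add: e_def)
    have b: "wm n e = wm n e'" by (rule wm_cong) (simp add: e_def)
    show ?thesis unfolding wm_split[OF nN, of e] a b W1_def W2_def ..
  qed
  have "\<gamma>' = X2 * W2 * B2 * u"
    unfolding u_def x\<rho>[symmetric] using Sp_cancel_left(2)[OF xS Sp_carrier[OF \<gamma>']] by simp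
  hence "W1 * \<gamma>' = (W1 * X2) * W2 * B2 * u"
    by (simp only: as m sc c1 uc)
  also have "\<dots> = X2 * (W1 * W2) * (B2 * u)" unfolding comm by (simp only: as m sc c1 uc)
  finally have W\<gamma>: "W1 * \<gamma>' = X2 * rat_mat (wm ?N e) * (B2 * u)" unfolding W .
  have "W1 * \<gamma>' = G1 * \<gamma>" unfolding \<gamma>'_def by (rule Sp_cancel_left(2)[OF W1 m[OF c1(2) \<gamma>c]])
  hence "\<gamma> = sinv ?N G1 * (X2 * rat_mat (wm ?N e) * (B2 * u))"
    using Sp_cancel_left(1)[OF G1 \<gamma>c] W\<gamma> by simp
  also have "\<dots> = sinv ?N G1 * X2 * rat_mat (wm ?N e) * (B2 * u)"
    by (simp only: as m sc Sp_carrier[OF rat_wm_Sp] uc sinv_carrier)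
  also have "sinv ?N G1 * X2 = rat_mat (sinv ?N g1 * xi n ?N g2)"
    unfolding rat_mat_mult[OF sinv_carrier xi_carrier[OF Sp_carrier[OF GammaZ_Sp[OF IH(1)]] nN]]
      rat_mat_sinv[OF Sp_carrier[OF GammaZ_Sp[OF g1(1)]]] G1_def X2_def
    using xi_map_mat[OF Sp_carrier[OF GammaZ_Sp[OF IH(1)]] nN, of "of_int :: int \<Rightarrow> rat"] by simp
  finally have "\<gamma> = rat_mat (sinv ?N g1 * xi n ?N g2) * rat_mat (wm ?N e) * (B2 * u)" .
  moreover have "sinv ?N g1 * xi n ?N g2 \<in> GammaZ ?N N"
    by (rule GammaZ_mult[OF GammaZ_sinv[OF g1(1)] GammaZ_xi[OF IH(1) nN]])
  moreover have "parab ?N r (B2 * u)" if r: "r \<le> ?N" for r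
  proof -
    have "parab ?N r B2"
    proof (cases "r \<le> n")
      case True thus ?thesis unfolding B2_def by (intro parab_xi_le[OF Sp_carrier[OF IH(2)] True nN] IH(4))
    next
      case False thus ?thesis unfolding B2_def using r by (intro parab_xi_ge[OF Sp_carrier[OF IH(2)]]) auto
    qed
    thus ?thesis by (rule parab_mult[OF sc(3) _ uc pall[OF r] r])
  qed
  moreover have "idem N (e j)" for j using IH(3) g1(2) by (simp add: e_def)
  ultimately show ?case using Sp_mult[OF S(3) u] by blast
qed

text \<open>For \<open>b = n\<close> this is the rank modulo \<open>p\<close> of the columns \<open>a, \<dots>, n - 1\<close> of the \<open>C\<close>-block of \<open>wm n e\<close>.\<close>

definition cnt :: "nat \<Rightarrow> (nat \<Rightarrow> int) \<Rightarrow> nat \<Rightarrow> nat \<Rightarrow> nat" where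
  "cnt p e a b = card {j \<in> {a..<b}. \<not> int p dvd e j}"

text \<open>The vectors of \<open>W\<^sub>s\<close> modulo \<open>p\<close> which the \<open>C\<close>-block annihilates are counted; there are
  \<open>p\<close> to the power of the corank of them.\<close>

lemma invariance_le:
  assumes p: "prime p" "p dvd N" and sn: "s \<le> n" and g: "g \<in> GammaZ n N" and q: "q \<in> Sp n" "parab n s q"
    and eq: "wm n e' = g * wm n e * q"
  shows "card {j \<in> {s..<n}. int p dvd e' j} \<le> card {j \<in> {s..<n}. int p dvd e j}"
proof -
  \<comment> \<open>Representatives among 0, ..., p - 1 of the solutions of e_j f_j = 0 modulo p
    with support in s, ..., n - 1.\<close>
  define F where "F = (\<lambda>e :: nat \<Rightarrow> int. PiE {s..<n} (\<lambda>j. if int p dvd e j then {0..<int p} else {0}))"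
  have p1: "p > 1" using p(1) by (rule prime_gt_1_nat)
  have cF: "card (F e) = p ^ card {j \<in> {s..<n}. int p dvd e j}" for e
  proof -
    have "card (F e) = (\<Prod>j\<in>{s..<n}. if int p dvd e j then p else 1)"
      unfolding F_def by (subst card_PiE) (auto intro!: prod.cong)
    also have "\<dots> = (\<Prod>j\<in>{j \<in> {s..<n}. int p dvd e j}. p)" by (rule prod.inter_filter[symmetric]) simp
    finally show ?thesis by simp
  qed
  have fF: "finite (F e)" for e unfolding F_def by (intro finite_PiE) auto
  define y where "y = (\<lambda>f. vec (2*n) (\<lambda>j. if s \<le> j \<and> j < n then f j else (0::int)))"
  have y: "y f \<in> carrier_vec (2*n)" for f by (simp add: y_def)
  \<comment> \<open>q preserves W_s, and the lower left block of g^-1 vanishes modulo p, so applying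
    q carries solutions for e' to solutions for e. As q is invertible over the integers, distinct
    solutions stay distinct modulo p.\<close>
  define \<phi> where "\<phi> = (\<lambda>f. restrict (\<lambda>j. (q *\<^sub>v y f) $ j mod int p) {s..<n})"
  note qc = Sp_carrier[OF q(1)] and gS = GammaZ_Sp[OF g] and wS = wm_Sp[of n e] and w'S = wm_Sp[of n e']
  have ry: "res s n (y f) = 0\<^sub>v (2*s)" for f
    by (rule eq_vecI) (use sn in \<open>auto simp: res_def y_def emb_def\<close>)
  have yb: "\<And>i. s \<le> i \<Longrightarrow> i < n \<Longrightarrow> y f $ (n + i) = 0" for f by (simp add: y_def)
  have qy: "q *\<^sub>v y f \<in> carrier_vec (2*n)" for f by (rule mult_mat_vec_carrier[OF qc y])
  have qy0: "(q *\<^sub>v y f) $ i = 0" "(q *\<^sub>v y f) $ (n + i) = 0" if "i < s" for f i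
  proof -
    have "res s n (q *\<^sub>v y f) = omega n s q *\<^sub>v res s n (y f)" by (rule parab_res(1)[OF qc q(2) sn y yb])
    hence z: "res s n (q *\<^sub>v y f) = 0\<^sub>v (2*s)" unfolding ry by auto
    show "(q *\<^sub>v y f) $ i = 0" "(q *\<^sub>v y f) $ (n + i) = 0"
      using arg_cong[OF z, of "\<lambda>u. u $ i"] arg_cong[OF z, of "\<lambda>u. u $ (s + i)"] that by (simp_all del: index_mult_mat_vec)
  qed
  have qyb: "(q *\<^sub>v y f) $ (n + i) = 0" if "i < n" for f i
    using parab_res(2)[OF qc q(2) sn y yb, of i] qy0[of i f] that by (cases "i < s") auto
  have wz: "(wm n e *\<^sub>v z) $ (n + i) = e i * z $ i + (1 - (e i)^2) * z $ (n + i)"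
    if "z \<in> carrier_vec (2*n)" "i < n" for e z i
    unfolding wm_def dg_mult_vec[OF that] ..
  have maps: "\<phi> f \<in> F e" if f: "f \<in> F e'" for f
  proof -
    have fb: "int p dvd (wm n e' *\<^sub>v y f) $ (n + i)" if i: "i < n" for i
    proof -
      have "int p dvd e' i * y f $ i"
        using f i by (cases "int p dvd e' i"; cases "s \<le> i") (auto simp: F_def y_def dest!: PiE_mem[of f _ _ i])
      thus ?thesis unfolding wz[OF y i] using i by (simp add: y_def)
    qed
    have wy: "wm n e' *\<^sub>v y f \<in> carrier_vec (2*n)" by (rule mult_mat_vec_carrier[OF Sp_carrier[OF w'S] y])
    have "sinv n g *\<^sub>v (wm n e' *\<^sub>v y f) = (sinv n g * wm n e') *\<^sub>v y f"
      by (rule assoc_mult_mat_vec[OF sinv_carrier Sp_carrier[OF w'S] y, symmetric])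
    also have "sinv n g * wm n e' = wm n e * q"
      unfolding eq assoc_mult_square[OF Sp_carrier[OF gS] Sp_carrier[OF wS] qc]
      by (rule Sp_cancel_left(1)[OF gS mult_carrier_mat[OF Sp_carrier[OF wS] qc]])
    also have "(wm n e * q) *\<^sub>v y f = wm n e *\<^sub>v (q *\<^sub>v y f)" by (rule assoc_mult_mat_vec[OF Sp_carrier[OF wS] qc y])
    finally have z: "sinv n g *\<^sub>v (wm n e' *\<^sub>v y f) = wm n e *\<^sub>v (q *\<^sub>v y f)" .
    have pd: "int p dvd e i * (q *\<^sub>v y f) $ i" if i: "i < n" for i
    proof -
      have sg: "int p dvd sinv n g $$ (n + i, k)" if "k < n" for k
      proof (rule dvd_trans)
        show "int p dvd int N" using p(2) by simp
        show "int N dvd sinv n g $$ (n + i, k)" using GammaZ_sinv[OF g] i that by (auto simp: GammaZ_def)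
      qed
      have "e i * (q *\<^sub>v y f) $ i = (wm n e *\<^sub>v (q *\<^sub>v y f)) $ (n + i)"
        unfolding wz[OF qy i] qyb[OF i] by simp
      also have "\<dots> = (\<Sum>k<n. sinv n g $$ (n + i, k) * (wm n e' *\<^sub>v y f) $ k)
          + (\<Sum>k<n. sinv n g $$ (n + i, n + k) * (wm n e' *\<^sub>v y f) $ (n + k))"
        unfolding z[symmetric] by (rule mult_vec_index_double[OF sinv_carrier wy]) (use i in simp)
      also have "int p dvd \<dots>" using sg fb by (intro dvd_add dvd_sum dvd_mult2 dvd_mult) auto
      finally show ?thesis .
    qed
    have "(q *\<^sub>v y f) $ i mod int p \<in> (if int p dvd e i then {0..<int p} else {0})" if i: "i < n" for i
    proof (cases "int p dvd e i")
      case False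
      have "int p dvd (q *\<^sub>v y f) $ i" using pd[OF i] False p(1) prime_dvd_mult_iff[of "int p"] by auto
      thus ?thesis using False by (simp del: index_mult_mat_vec)
    qed (use p1 in \<open>simp del: index_mult_mat_vec\<close>)
    thus ?thesis unfolding F_def \<phi>_def by (intro restrict_PiE_iff[THEN iffD2]) auto
  qed
  have inj: "inj_on \<phi> (F e')"
  proof (rule inj_onI)
    fix f f' assume f: "f \<in> F e'" "f' \<in> F e'" and ff: "\<phi> f = \<phi> f'"
    define d where "d = y f - y f'"
    have d: "d \<in> carrier_vec (2*n)" unfolding d_def using y by (metis minus_carrier_vec)
    have qd: "q *\<^sub>v d = q *\<^sub>v y f - q *\<^sub>v y f'" unfolding d_def by (rule mult_minus_distrib_mat_vec[OF qc y y])
    have qdc: "q *\<^sub>v d \<in> carrier_vec (2*n)" by (rule mult_mat_vec_carrier[OF qc d])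
    have pq: "int p dvd (q *\<^sub>v d) $ i" "int p dvd (q *\<^sub>v d) $ (n + i)" if i: "i < n" for i
    proof -
      have ii: "i < dim_vec (q *\<^sub>v y f')" "n + i < dim_vec (q *\<^sub>v y f')" using qc i by auto
      have "(q *\<^sub>v y f) $ i mod int p = (q *\<^sub>v y f') $ i mod int p"
      proof (cases "s \<le> i")
        case True thus ?thesis using fun_cong[OF ff, of i] i by (simp add: \<phi>_def del: index_mult_mat_vec)
      qed (use qy0(1)[of i] in simp)
      thus "int p dvd (q *\<^sub>v d) $ i" unfolding qd index_minus_vec(1)[OF ii(1)] by (simp only: mod_eq_dvd_iff)
      show "int p dvd (q *\<^sub>v d) $ (n + i)" unfolding qd index_minus_vec(1)[OF ii(2)] using qyb[OF i] by simp
    qed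
    have "d = sinv n q *\<^sub>v (q *\<^sub>v d)"
      unfolding assoc_mult_mat_vec[OF sinv_carrier qc d, symmetric] sinv_left[OF q(1)] using d by simp
    hence pd: "int p dvd d $ i" if i: "i < n" for i
    proof -
      have "d $ i = (sinv n q *\<^sub>v (q *\<^sub>v d)) $ i" using \<open>d = sinv n q *\<^sub>v (q *\<^sub>v d)\<close> by simp
      also have "\<dots> = (\<Sum>k<n. sinv n q $$ (i, k) * (q *\<^sub>v d) $ k) + (\<Sum>k<n. sinv n q $$ (i, n + k) * (q *\<^sub>v d) $ (n + k))"
        by (rule mult_vec_index_double[OF sinv_carrier qdc]) (use i in simp)
      also have "int p dvd \<dots>" using pq by (intro dvd_add dvd_sum dvd_mult) auto
      finally show ?thesis .
    qed
    show "f = f'"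
    proof (rule PiE_ext[OF f[unfolded F_def]])
      fix i assume i: "i \<in> {s..<n}"
      have r: "f i \<in> {0..<int p}" "f' i \<in> {0..<int p}"
        using PiE_mem[OF f(1)[unfolded F_def] i] PiE_mem[OF f(2)[unfolded F_def] i] p1 by (auto split: if_splits)
      have "int p dvd f i - f' i" using pd[of i] i by (simp add: d_def y_def)
      hence "f i mod int p = f' i mod int p" by (simp only: mod_eq_dvd_iff)
      thus "f i = f' i" using r by simp
    qed
  qed
  have "card (F e') \<le> card (F e)" using maps by (intro card_inj_on_le[OF inj _ fF]) auto
  hence "p ^ card {j \<in> {s..<n}. int p dvd e' j} \<le> p ^ card {j \<in> {s..<n}. int p dvd e j}" unfolding cF .
  thus ?thesis by (rule power_le_imp_le_exp[OF p1])
qed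

section \<open>The ranks as invariants of cusps\<close>

lemma cnt_add: "cnt p e a b + card {j \<in> {a..<b}. int p dvd e j} = b - a"
proof -
  have "card {a..<b} = card ({j \<in> {a..<b}. \<not> int p dvd e j} \<union> {j \<in> {a..<b}. int p dvd e j})"
    by (rule arg_cong[of _ _ card]) auto
  also have "\<dots> = cnt p e a b + card {j \<in> {a..<b}. int p dvd e j}"
    unfolding cnt_def by (rule card_Un_disjoint) auto
  finally show ?thesis by simp
qed

text \<open>The parabolic factor is a priori rational, but it equals (g w)^-1 w' and is therefore
  integral, which makes counting modulo p possible.\<close>

lemma fequiv_wm_le:
  assumes e: "fequiv n (Gamma0 n N) {s} (rat_mat (wm n e)) (rat_mat (wm n e'))"
    and p: "prime p" "p dvd N" and sn: "s \<le> n"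
  shows "card {j \<in> {s..<n}. int p dvd e' j} \<le> card {j \<in> {s..<n}. int p dvd e j}"
proof -
  obtain g q where g: "g \<in> GammaZ n N" "q \<in> Sp n" "parab n s q" "rat_mat (wm n e') = rat_mat g * rat_mat (wm n e) * q"
    using e by (auto simp: fequiv_def Gamma0_eq)
  note gS = GammaZ_Sp[OF g(1)]
  note c = Sp_carrier[OF gS] Sp_carrier[OF wm_Sp[of n e]] Sp_carrier[OF wm_Sp[of n e']] Sp_carrier[OF g(2)]
  have gw: "g * wm n e \<in> Sp n" by (intro Sp_mult gS wm_Sp)
  have gwr: "rat_mat g * rat_mat (wm n e) = rat_mat (g * wm n e)" by (rule rat_mat_mult[OF c(1,2), symmetric])
  define q0 where "q0 = sinv n (g * wm n e) * wm n e'"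
  have q0: "q0 \<in> Sp n" unfolding q0_def by (intro Sp_mult sinv_Sp gw wm_Sp)
  have "rat_mat q0 = sinv n (rat_mat (g * wm n e)) * (rat_mat (g * wm n e) * q)"
    unfolding q0_def rat_mat_mult[OF sinv_carrier c(3)] rat_mat_sinv[OF Sp_carrier[OF gw]] g(4) gwr ..
  hence qq: "rat_mat q0 = q" using Sp_cancel_left(1)[OF rat_mat_Sp[OF gw] c(4)] by simp
  have "parab n s q0" using parab_rat_mat[OF Sp_carrier[OF q0] sn] g(3) qq by simp
  moreover have "wm n e' = g * wm n e * q0" unfolding q0_def using Sp_cancel_left(2)[OF gw c(3)] by simp
  ultimately show ?thesis by (rule invariance_le[OF p sn g(1) q0])
qed

lemma fequiv_wm_cnt:
  assumes e: "fequiv n (Gamma0 n N) {s} (rat_mat (wm n e)) (rat_mat (wm n e'))"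
    and p: "prime p" "p dvd N" and sn: "s \<le> n"
  shows "cnt p e s n = cnt p e' s n"
proof -
  have "fequiv n (Gamma0 n N) {s} (rat_mat (wm n e')) (rat_mat (wm n e))"
    by (rule fequiv_sym[OF Gamma0_subgroup _ rat_wm_Sp e]) (use sn in simp)
  from fequiv_wm_le[OF e p sn] fequiv_wm_le[OF this p sn] cnt_add[of p e s n] cnt_add[of p e' s n]
  show ?thesis by simp
qed

section \<open>Congruent matrices and flags with equal ranks\<close>

definition mcong :: "nat \<Rightarrow> int \<Rightarrow> int mat \<Rightarrow> int mat \<Rightarrow> bool" where
  "mcong n d A B \<longleftrightarrow> (\<forall>i<2*n. \<forall>j<2*n. d dvd A $$ (i, j) - B $$ (i, j))"

lemma mcong_mult:
  assumes c: "A \<in> carrier_mat (2*n) (2*n)" "A' \<in> carrier_mat (2*n) (2*n)" "B \<in> carrier_mat (2*n) (2*n)" "B' \<in> carrier_mat (2*n) (2*n)"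
    and "mcong n d A A'" "mcong n d B B'"
  shows "mcong n d (A * B) (A' * B')"
  unfolding mcong_def
proof (intro allI impI)
  fix i j assume ij: "i < 2*n" "j < 2*n"
  have "(A * B) $$ (i, j) - (A' * B') $$ (i, j) = (\<Sum>k<2*n. A $$ (i, k) * B $$ (k, j) - A' $$ (i, k) * B' $$ (k, j))"
    using ij c by (simp add: scalar_prod_def lessThan_atLeast0 sum_subtractf)
  also have "d dvd \<dots>"
  proof (rule dvd_sum)
    fix k assume "k \<in> {..<2*n}"
    hence "d dvd A $$ (i, k) - A' $$ (i, k)" "d dvd B $$ (k, j) - B' $$ (k, j)"
      using assms(5,6) ij by (auto simp: mcong_def)
    hence "d dvd (A $$ (i, k) - A' $$ (i, k)) * B $$ (k, j) + A' $$ (i, k) * (B $$ (k, j) - B' $$ (k, j))"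
      by (intro dvd_add dvd_mult dvd_mult2)
    thus "d dvd A $$ (i, k) * B $$ (k, j) - A' $$ (i, k) * B' $$ (k, j)" by (simp add: algebra_simps)
  qed
  finally show "d dvd (A * B) $$ (i, j) - (A' * B') $$ (i, j)" .
qed

lemma mcong_refl: "mcong n d A A"
  by (simp add: mcong_def)

lemma mcong_trans: assumes "mcong n d A B" "mcong n d B C" shows "mcong n d A C"
  unfolding mcong_def
proof (intro allI impI)
  fix i j assume "i < 2*n" "j < 2*n"
  hence "d dvd (A $$ (i, j) - B $$ (i, j)) + (B $$ (i, j) - C $$ (i, j))"
    using assms unfolding mcong_def by (intro dvd_add) auto
  thus "d dvd A $$ (i, j) - C $$ (i, j)" by simp
qed

lemma mcongI_halves:
  assumes "\<And>k l. k < n \<Longrightarrow> l < n \<Longrightarrow> d dvd A $$ (k, l) - B $$ (k, l) \<and> d dvd A $$ (k, n + l) - B $$ (k, n + l) \<and>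
    d dvd A $$ (n + k, l) - B $$ (n + k, l) \<and> d dvd A $$ (n + k, n + l) - B $$ (n + k, n + l)"
  shows "mcong n d A B"
  unfolding mcong_def
proof (intro allI impI)
  fix i j assume "i < 2*n" "j < 2*n"
  hence "i < n \<or> (\<exists>k<n. i = n + k)" "j < n \<or> (\<exists>k<n. j = n + k)" by presburger+
  thus "d dvd A $$ (i, j) - B $$ (i, j)" using assms by auto
qed

text \<open>X Y^-1 is congruent to Y Y^-1 = 1 modulo N.\<close>

lemma mcong_GammaZ:
  assumes X: "X \<in> Sp n" and Y: "Y \<in> Sp n" and XY: "mcong n (int N) X Y"
  shows "X * sinv n Y \<in> GammaZ n N"
proof -
  have "mcong n (int N) (X * sinv n Y) (Y * sinv n Y)"
    by (rule mcong_mult[OF Sp_carrier[OF X] Sp_carrier[OF Y] sinv_carrier sinv_carrier XY mcong_refl])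
  hence mc: "int N dvd (X * sinv n Y) $$ (i, j) - 1\<^sub>m (2*n) $$ (i, j)" if "i < 2*n" "j < 2*n" for i j
    using that unfolding sinv_right[OF Y] mcong_def by blast
  have "int N dvd (X * sinv n Y) $$ (n + i, j)" if "i < n" "j < n" for i j
  proof -
    have "n + i < 2*n" "j < 2*n" "n + i \<noteq> j" using that by auto
    thus ?thesis using mc[of "n + i" j] by (simp del: index_mult_mat)
  qed
  thus ?thesis using Sp_mult[OF X sinv_Sp[OF Y]] by (simp add: GammaZ_def)
qed

lemma mcong_fequiv:
  assumes X: "X \<in> Sp n" and Y: "Y \<in> Sp n" and XY: "mcong n (int N) X Y" and R: "R \<subseteq> {..n}"
  shows "fequiv n (Gamma0 n N) R (rat_mat Y) (rat_mat X)"
proof -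
  note g = mcong_GammaZ[OF X Y XY]
  have "rat_mat X = rat_mat (X * sinv n Y) * rat_mat Y"
    unfolding rat_mat_mult[OF Sp_carrier[OF GammaZ_Sp[OF g]] Sp_carrier[OF Y], symmetric] Sp_cancel_right(1)[OF Y Sp_carrier[OF X]] ..
  thus ?thesis using fequiv_left[OF R rat_mat_Sp[OF Y], of "rat_mat (X * sinv n Y)"] g rat_mat_Sp[OF GammaZ_Sp[OF g]]
    by (simp add: Gamma0_eq)
qed

lemma wm_mcong:
  assumes "\<And>k. k < n \<Longrightarrow> d dvd e k - e' k"
  shows "mcong n d (wm n e) (wm n e')"
proof (rule mcongI_halves)
  fix k l assume kl: "k < n" "l < n"
  obtain z where z: "e k = e' k + d * z" using assms[OF kl(1)] by (metis dvdE diff_eq_eq add.commute)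
  have 1: "(1 - (e k)^2) - (1 - (e' k)^2) = d * (- z * (e k + e' k))" unfolding z by (simp add: algebra_simps power2_eq_square)
  have 2: "((e k)^3 - 2 * e k) - ((e' k)^3 - 2 * e' k) = d * (z * ((e k)^2 + e k * e' k + (e' k)^2 - 2))"
    unfolding z by (simp add: algebra_simps power2_eq_square power3_eq_cube)
  show "d dvd wm n e $$ (k, l) - wm n e' $$ (k, l) \<and> d dvd wm n e $$ (k, n + l) - wm n e' $$ (k, n + l) \<and>
    d dvd wm n e $$ (n + k, l) - wm n e' $$ (n + k, l) \<and> d dvd wm n e $$ (n + k, n + l) - wm n e' $$ (n + k, n + l)"
  proof -
    have "d dvd (1 - (e k)^2) - (1 - (e' k)^2)" "d dvd ((e k)^3 - 2 * e k) - ((e' k)^3 - 2 * e' k)"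
      unfolding 1 2 by simp_all
    thus ?thesis using assms[OF kl(1)] unfolding wm_def dg_index[OF kl] by (cases "k = l") auto
  qed
qed

lemma idem_diff:
  assumes N: "N > 0" "squarefree N" and "idem N a" "idem N b" "\<And>p. prime p \<Longrightarrow> p dvd N \<Longrightarrow> int p dvd a \<longleftrightarrow> int p dvd b"
  shows "int N dvd a - b"
proof (rule squarefree_dvdI[OF N(2,1)])
  fix p assume p: "prime p" "p dvd N"
  have "a - b = (a - 1) - (b - 1)" by simp
  thus "int p dvd a - b" using assms(3,4) assms(5)[OF p] p unfolding idem_def by (metis dvd_diff)
qed

text \<open>Interchanges the classes of e_i and e_j at the single prime p. The Levi element L turns
  the coordinates i and j into each other, up to sign, modulo p and is the identity modulo the other
  prime divisors of N. As i and j lie on the same side of every r in R, it stabilises the members of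
  the flag.\<close>

lemma swap_fequiv:
  assumes N: "N > 0" "squarefree N" and ij: "i < n" "j < n" "i \<noteq> j" and p: "prime p" "p dvd N"
    and e: "\<And>k. idem N (e k)" "\<And>k. idem N (e' k)"
    and sw: "\<And>\<pi> k. prime \<pi> \<Longrightarrow> \<pi> dvd N \<Longrightarrow> k < n \<Longrightarrow> int \<pi> dvd e' k \<longleftrightarrow>
        (if \<pi> = p \<and> k = i then int \<pi> dvd e j else if \<pi> = p \<and> k = j then int \<pi> dvd e i else int \<pi> dvd e k)"
    and R: "R \<subseteq> {..n}" "\<And>r. r \<in> R \<Longrightarrow> i < r \<longleftrightarrow> j < r"
  shows "fequiv n (Gamma0 n N) R (rat_mat (wm n e)) (rat_mat (wm n e'))"
proof -
  obtain \<epsilon> where \<epsilon>: "idem N \<epsilon>" "\<And>\<pi>. prime \<pi> \<Longrightarrow> \<pi> dvd N \<Longrightarrow> int \<pi> dvd \<epsilon> \<longleftrightarrow> \<pi> \<noteq> p"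
    using idem_exists[OF N(1), of "\<lambda>\<pi>. \<pi> = p"] by blast
  have det: "(1 - \<epsilon>^2) * (1 - \<epsilon>^2) - (\<epsilon>^3 - 2 * \<epsilon>) * \<epsilon> = 1" by (rule wm_det)
  \<comment> \<open>The 2 x 2 matrix of \<open>wm\<close> again, now acting across two planes: J
    modulo p and the identity modulo the other prime divisors of N.\<close>
  define L where "L = levi n i j (1 - \<epsilon>^2) (\<epsilon>^3 - 2 * \<epsilon>) \<epsilon> (1 - \<epsilon>^2)"
  have L: "L \<in> Sp n" unfolding L_def by (rule levi_Sp[OF ij det])
  have d12: "int \<pi> dvd 1 - (f k)^2" if "\<not> int \<pi> dvd f k" "prime \<pi>" "\<pi> dvd N" "idem N (f k)" for f :: "nat \<Rightarrow> int" and \<pi> k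
    using that by (metis idem_cases)
  have same: "int \<pi> dvd e' k * (1 - (e l)^2) \<and> int \<pi> dvd (1 - (e' k)^2) * e l"
    if "prime \<pi>" "\<pi> dvd N" "int \<pi> dvd e' k \<longleftrightarrow> int \<pi> dvd e l" for \<pi> k l
    using that d12[of \<pi> e l] d12[of \<pi> e' k] e by (cases "int \<pi> dvd e l") auto
  have \<epsilon>p: "int p dvd 1 - \<epsilon>^2" using d12[of p "\<lambda>_. \<epsilon>"] \<epsilon> p by auto
  define g where "g = wm n e' * L * sinv n (wm n e)"
  have ji: "j \<noteq> i" using ij by simp
  have g: "g \<in> GammaZ n N" unfolding g_def wm_def L_def
  proof (rule GammaZ_levi[OF ij det wm_det wm_det])
    fix k assume k: "k < n" "k \<noteq> i" "k \<noteq> j"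
    show "int N dvd e' k * (1 - (e k)^2) - (1 - (e' k)^2) * e k"
      by (rule squarefree_dvdI[OF N(2,1)], rule dvd_diff) (use same sw k in auto)
  next
    show "int N dvd e' i * (1 - (e i)^2) * (1 - \<epsilon>^2) - (1 - (e' i)^2) * e i * (1 - \<epsilon>^2)"
    proof (rule squarefree_dvdI[OF N(2,1)])
      fix \<pi> assume \<pi>: "prime \<pi>" "\<pi> dvd N"
      show "int \<pi> dvd e' i * (1 - (e i)^2) * (1 - \<epsilon>^2) - (1 - (e' i)^2) * e i * (1 - \<epsilon>^2)"
        using \<epsilon>p same[OF \<pi>, of i i] sw[OF \<pi> ij(1)] by (cases "\<pi> = p") (auto intro!: dvd_diff dvd_mult2)
    qed
    show "int N dvd e' j * (1 - (e j)^2) * (1 - \<epsilon>^2) - (1 - (e' j)^2) * e j * (1 - \<epsilon>^2)"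
    proof (rule squarefree_dvdI[OF N(2,1)])
      fix \<pi> assume \<pi>: "prime \<pi>" "\<pi> dvd N"
      show "int \<pi> dvd e' j * (1 - (e j)^2) * (1 - \<epsilon>^2) - (1 - (e' j)^2) * e j * (1 - \<epsilon>^2)"
        using \<epsilon>p same[OF \<pi>, of j j] sw[OF \<pi> ij(2)] ji by (cases "\<pi> = p") (auto intro!: dvd_diff dvd_mult2)
    qed
    have \<epsilon>3: "\<epsilon>^3 - 2 * \<epsilon> = \<epsilon> * (\<epsilon>^2 - 2)" by (simp add: algebra_simps power2_eq_square power3_eq_cube)
    show "int N dvd e' i * (1 - (e j)^2) * (\<epsilon>^3 - 2 * \<epsilon>) + (1 - (e' i)^2) * e j * \<epsilon>"
    proof (rule squarefree_dvdI[OF N(2,1)])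
      fix \<pi> assume \<pi>: "prime \<pi>" "\<pi> dvd N"
      show "int \<pi> dvd e' i * (1 - (e j)^2) * (\<epsilon>^3 - 2 * \<epsilon>) + (1 - (e' i)^2) * e j * \<epsilon>"
        using \<epsilon>(2)[OF \<pi>] same[OF \<pi>, of i j] sw[OF \<pi> ij(1)] unfolding \<epsilon>3
        by (cases "\<pi> = p") (auto intro!: dvd_add dvd_mult2)
    qed
    show "int N dvd e' j * (1 - (e i)^2) * \<epsilon> + (1 - (e' j)^2) * e i * (\<epsilon>^3 - 2 * \<epsilon>)"
    proof (rule squarefree_dvdI[OF N(2,1)])
      fix \<pi> assume \<pi>: "prime \<pi>" "\<pi> dvd N"
      show "int \<pi> dvd e' j * (1 - (e i)^2) * \<epsilon> + (1 - (e' j)^2) * e i * (\<epsilon>^3 - 2 * \<epsilon>)"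
        using \<epsilon>(2)[OF \<pi>] same[OF \<pi>, of j i] sw[OF \<pi> ij(2)] ji unfolding \<epsilon>3
        by (cases "\<pi> = p") (auto intro!: dvd_add dvd_mult2)
    qed
  qed
  note c = Sp_carrier[OF wm_Sp[of n e]] Sp_carrier[OF wm_Sp[of n e']] Sp_carrier[OF L]
  note cr = Sp_carrier[OF rat_mat_Sp[OF L]]
  have "g * wm n e = wm n e' * L" unfolding g_def by (rule Sp_cancel_right(1)[OF wm_Sp mult_carrier_mat[OF c(2,3)]])
  hence "rat_mat g * rat_mat (wm n e) = rat_mat (wm n e') * rat_mat L"
    using rat_mat_mult[OF Sp_carrier[OF GammaZ_Sp[OF g]] c(1)] rat_mat_mult[OF c(2,3)] by simp
  hence "rat_mat g * rat_mat (wm n e) * sinv n (rat_mat L) = rat_mat (wm n e')"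
    using Sp_cancel_right(2)[OF rat_mat_Sp[OF L] Sp_carrier[OF rat_wm_Sp]] by simp
  moreover have "parab n r (sinv n (rat_mat L))" if "r \<in> R" for r
    using that R ij unfolding L_def rat_mat_levi sinv_levi[OF ij(3)] by (intro levi_parab) auto
  ultimately show ?thesis unfolding fequiv_def Gamma0_eq using g sinv_Sp[OF rat_mat_Sp[OF L]]
    by (intro bexI[of _ "rat_mat g"] bexI[of _ "sinv n (rat_mat L)"]) auto
qed

text \<open>The factor in the planes below s stabilises W_r for every r >= s and is split off on the
  right.\<close>

lemma wm_low_fequiv:
  assumes "s \<le> n" "R \<subseteq> {s..n}"
  shows "fequiv n (Gamma0 n N) R (rat_mat (wm n (\<lambda>j. if j < s then 0 else e j))) (rat_mat (wm n e))"
  unfolding wm_split[OF assms(1), of e]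
  by (rule fequiv_right[OF Gamma0_subgroup rat_wm_Sp xi_Sp[OF rat_wm_Sp assms(1)]])
    (use assms(2) in \<open>auto intro!: parab_xi_ge Sp_carrier[OF rat_wm_Sp]\<close>)

text \<open>Once the planes below s are set to 0, equal classes at every prime make the parameters,
  and so the matrices, congruent modulo N.\<close>

lemma equal_classes_fequiv:
  assumes N: "N > 0" "squarefree N" and sn: "s \<le> n" and R: "R \<subseteq> {s..n}"
    and e: "\<And>k. idem N (e k)" "\<And>k. idem N (e' k)"
    and eq: "\<And>p k. prime p \<Longrightarrow> p dvd N \<Longrightarrow> s \<le> k \<Longrightarrow> k < n \<Longrightarrow> int p dvd e k \<longleftrightarrow> int p dvd e' k"
  shows "fequiv n (Gamma0 n N) R (rat_mat (wm n e)) (rat_mat (wm n e'))"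
proof -
  let ?h = "\<lambda>e :: nat \<Rightarrow> int. \<lambda>j. if j < s then 0 else e j"
  have R': "R \<subseteq> {..n}" using R by auto
  note G = Gamma0_subgroup[of n N]
  have "mcong n (int N) (wm n (?h e')) (wm n (?h e))"
    by (rule wm_mcong) (auto intro!: idem_diff[OF N e(2) e(1)] simp: eq)
  hence m: "fequiv n (Gamma0 n N) R (rat_mat (wm n (?h e))) (rat_mat (wm n (?h e')))"
    by (rule mcong_fequiv[OF wm_Sp wm_Sp _ R'])
  have a: "fequiv n (Gamma0 n N) R (rat_mat (wm n e)) (rat_mat (wm n (?h e)))"
    by (rule fequiv_sym[OF G R' rat_wm_Sp wm_low_fequiv[OF sn R]])
  show ?thesis
    by (rule fequiv_trans[OF G R' rat_wm_Sp a fequiv_trans[OF G R' rat_wm_Sp m wm_low_fequiv[OF sn R]]])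
qed

text \<open>Induction on the number of pairs (p, k) at which e and e' disagree. A disagreement in
  one of the blocks {s..<r} and {r..<n} comes, by equality of the counts, with indices i and j in
  that block whose discrepancies at p are opposite; swapping them at p removes both and changes
  nothing at other primes.\<close>

lemma equal_cnt_fequiv:
  assumes N: "N > 0" "squarefree N" and sr: "s \<le> r" and rn: "r \<le> n"
    and "\<And>k. idem N (e k)" and e': "\<And>k. idem N (e' k)"
    and "\<And>p. prime p \<Longrightarrow> p dvd N \<Longrightarrow> cnt p e s r = cnt p e' s r \<and> cnt p e r n = cnt p e' r n"
  shows "fequiv n (Gamma0 n N) {s, r} (rat_mat (wm n e)) (rat_mat (wm n e'))"
  using assms(5,7)
proof (induction "card {(p, k). p \<in> prime_factors N \<and> k \<in> {s..<n} \<and> (int p dvd e k) \<noteq> (int p dvd e' k)}"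
    arbitrary: e rule: less_induct)
  case less
  define Mis where "Mis = (\<lambda>e. {(p, k). p \<in> prime_factors N \<and> k \<in> {s..<n} \<and> (int p dvd e k) \<noteq> (int p dvd e' k)})"
  have fin: "finite (Mis e)" for e
    by (rule finite_subset[of _ "prime_factors N \<times> {s..<n}"]) (auto simp: Mis_def)
  note G = Gamma0_subgroup[of n N]
  have R: "{s, r} \<subseteq> {s..n}" "{s, r} \<subseteq> {..n}" using sr rn by auto
  show ?case
  proof (cases "Mis e = {}")
    case True
    have "int p dvd e k \<longleftrightarrow> int p dvd e' k" if "prime p" "p dvd N" "s \<le> k" "k < n" for p k
    proof -
      have "p \<in> prime_factors N" using that N(1) by (simp add: prime_factors_dvd)
      thus ?thesis using True that unfolding Mis_def by auto
    qed
    thus ?thesis using sr rn by (intro equal_classes_fequiv[OF N _ R(1)] less.prems(1) e') auto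
  next
    case False
    then obtain p k where pk: "p \<in> prime_factors N" "k \<in> {s..<n}" "(int p dvd e k) \<noteq> (int p dvd e' k)"
      unfolding Mis_def by auto
    have p: "prime p" "p dvd N" using pk(1) by auto
    obtain a b where ab: "k \<in> {a..<b}" "a = s \<and> b = r \<or> a = r \<and> b = n"
      using pk(2) by (metis atLeastLessThan_iff not_less)
    define A where "A = (\<lambda>e :: nat \<Rightarrow> int. {j \<in> {a..<b}. \<not> int p dvd e j})"
    have fA: "finite (A e)" for e by (simp add: A_def)
    have cA: "card (A e) = card (A e')" using less.prems(2)[OF p] ab(2) unfolding A_def cnt_def by blast
    have "A e \<noteq> A e'" using pk(3) ab(1) by (auto simp: A_def)
    \<comment> \<open>Distinct finite sets of the same size: neither contains the other.\<close>
    hence "\<not> A e \<subseteq> A e'" "\<not> A e' \<subseteq> A e" using cA fA by (metis card_subset_eq)+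
    then obtain i j where ij: "i \<in> A e" "i \<notin> A e'" "j \<in> A e'" "j \<notin> A e" by blast
    have abn: "a \<ge> s" "b \<le> n" using ab(2) sr rn by auto
    have ijn: "i < n" "j < n" "i \<noteq> j" "s \<le> i" "s \<le> j" using ij abn by (auto simp: A_def)
    have cls: "\<not> int p dvd e i" "int p dvd e' i" "int p dvd e j" "\<not> int p dvd e' j" using ij by (auto simp: A_def)
    obtain x where x: "idem N x" "\<And>\<pi>. prime \<pi> \<Longrightarrow> \<pi> dvd N \<Longrightarrow> int \<pi> dvd x \<longleftrightarrow> \<not> (\<pi> \<noteq> p \<and> \<not> int \<pi> dvd e i)"
      using idem_exists[OF N(1), of "\<lambda>\<pi>. \<pi> \<noteq> p \<and> \<not> int \<pi> dvd e i"] by blast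
    obtain y where y: "idem N y" "\<And>\<pi>. prime \<pi> \<Longrightarrow> \<pi> dvd N \<Longrightarrow> int \<pi> dvd y \<longleftrightarrow> \<not> (\<pi> = p \<or> \<not> int \<pi> dvd e j)"
      using idem_exists[OF N(1), of "\<lambda>\<pi>. \<pi> = p \<or> \<not> int \<pi> dvd e j"] by blast
    \<comment> \<open>x and y carry the classes of e_i and e_j, interchanged at p and kept at the
      other primes.\<close>
    define f where "f = e(i := x, j := y)"
    have f: "idem N (f k)" for k using x y less.prems(1) by (simp add: f_def)
    have fcl: "int \<pi> dvd f k \<longleftrightarrow> (if \<pi> = p \<and> k = i then int \<pi> dvd e j else if \<pi> = p \<and> k = j then int \<pi> dvd e i else int \<pi> dvd e k)"
      if "prime \<pi>" "\<pi> dvd N" for \<pi> k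
      using x(2)[OF that] y(2)[OF that] cls ijn by (auto simp: f_def)
    have ef: "fequiv n (Gamma0 n N) {s, r} (rat_mat (wm n e)) (rat_mat (wm n f))"
    proof (rule swap_fequiv[OF N ijn(1-3) p less.prems(1) f fcl R(2)])
      fix t assume "t \<in> {s, r}"
      thus "i < t \<longleftrightarrow> j < t" using ij ab(2) ijn(4,5) by (auto simp: A_def)
    qed
    have sub: "Mis f \<subseteq> Mis e"
    proof
      fix z assume "z \<in> Mis f"
      then obtain \<pi> k where z: "z = (\<pi>, k)" "\<pi> \<in> prime_factors N" "k \<in> {s..<n}" "(int \<pi> dvd f k) \<noteq> (int \<pi> dvd e' k)"
        unfolding Mis_def by auto
      have "prime \<pi>" "\<pi> dvd N" using z(2) by auto
      hence "(int \<pi> dvd e k) \<noteq> (int \<pi> dvd e' k)" using z(4) fcl[of \<pi> k] cls by (auto split: if_splits)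
      thus "z \<in> Mis e" using z unfolding Mis_def by auto
    qed
    have "(p, i) \<in> Mis e" "(p, i) \<notin> Mis f" using pk(1) ijn cls fcl[OF p, of i] by (auto simp: Mis_def)
    hence "Mis f \<subset> Mis e" using sub by blast
    hence lt: "card (Mis f) < card (Mis e)" by (rule psubset_card_mono[OF fin])
    have cf: "cnt \<pi> f s r = cnt \<pi> e' s r \<and> cnt \<pi> f r n = cnt \<pi> e' r n" if \<pi>: "prime \<pi>" "\<pi> dvd N" for \<pi>
    proof -
      have "cnt \<pi> f c d = cnt \<pi> e c d" if cd: "c = s \<and> d = r \<or> c = r \<and> d = n" for c d
      proof (cases "\<pi> = p")
        case False
        thus ?thesis unfolding cnt_def fcl[OF \<pi>] by simp
      next
        case True
        have "i \<in> {c..<d} \<longleftrightarrow> j \<in> {c..<d}" using ij ab(2) cd sr rn by (auto simp: A_def)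
        show ?thesis
        proof (cases "i \<in> {c..<d}")
          case in': True
          have "{k \<in> {c..<d}. \<not> int \<pi> dvd f k} = insert j ({k \<in> {c..<d}. \<not> int \<pi> dvd e k} - {i})"
            unfolding True fcl[OF p] using in' \<open>i \<in> {c..<d} \<longleftrightarrow> j \<in> {c..<d}\<close> cls ijn by auto
          moreover have "card (insert j ({k \<in> {c..<d}. \<not> int \<pi> dvd e k} - {i})) = card {k \<in> {c..<d}. \<not> int \<pi> dvd e k}"
          proof -
            have "i \<in> {k \<in> {c..<d}. \<not> int \<pi> dvd e k}" "j \<notin> {k \<in> {c..<d}. \<not> int \<pi> dvd e k} - {i}"
              using in' cls True by auto
            moreover have "finite {k \<in> {c..<d}. \<not> int \<pi> dvd e k}" by simp
            ultimately show ?thesis by (simp only: card_insert_disjoint finite_Diff card_Suc_Diff1 not_False_eq_True)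
          qed
          ultimately show ?thesis unfolding cnt_def by simp
        next
          case False
          hence "{k \<in> {c..<d}. \<not> int \<pi> dvd f k} = {k \<in> {c..<d}. \<not> int \<pi> dvd e k}"
            unfolding True fcl[OF p] using \<open>i \<in> {c..<d} \<longleftrightarrow> j \<in> {c..<d}\<close> by auto
          thus ?thesis unfolding cnt_def by simp
        qed
      qed
      thus ?thesis using less.prems(2)[OF \<pi>] by simp
    qed
    have "fequiv n (Gamma0 n N) {s, r} (rat_mat (wm n f)) (rat_mat (wm n e'))"
      by (rule less.hyps[OF lt[unfolded Mis_def] f cf])
    thus ?thesis by (rule fequiv_trans[OF G R(2) rat_wm_Sp ef])
  qed
qed

section \<open>Cusps and tuples\<close>

lemma wm_0: "wm n (\<lambda>_. 0) = 1\<^sub>m (2*n)"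
  unfolding wm_def by (simp add: dg_one)

lemma wm_mcong_Jmat:
  assumes "d dvd \<epsilon> - 1" shows "mcong m d (wm m (\<lambda>_. \<epsilon>)) (Jmat m)"
proof (rule mcongI_halves)
  fix k l assume kl: "k < m" "l < m"
  have "1 - \<epsilon>^2 = (\<epsilon> - 1) * (- (\<epsilon> + 1))" "\<epsilon>^3 - 2 * \<epsilon> + 1 = (\<epsilon> - 1) * (\<epsilon>^2 + \<epsilon> - 1)"
    by (simp_all add: algebra_simps power2_eq_square power3_eq_cube)
  hence "d dvd 1 - \<epsilon>^2" "d dvd \<epsilon>^3 - 2 * \<epsilon> + 1" using assms by simp_all
  thus "d dvd wm m (\<lambda>_. \<epsilon>) $$ (k, l) - Jmat m $$ (k, l) \<and> d dvd wm m (\<lambda>_. \<epsilon>) $$ (k, m + l) - Jmat m $$ (k, m + l) \<and>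
    d dvd wm m (\<lambda>_. \<epsilon>) $$ (m + k, l) - Jmat m $$ (m + k, l) \<and> d dvd wm m (\<lambda>_. \<epsilon>) $$ (m + k, m + l) - Jmat m $$ (m + k, m + l)"
    using kl assms unfolding wm_def dg_index[OF kl] by (auto simp: Jmat_index)
qed

lemma wm_mcong_one:
  assumes "d dvd \<epsilon>" shows "mcong m d (wm m (\<lambda>_. \<epsilon>)) (1\<^sub>m (2*m))"
  using wm_mcong[of m d "\<lambda>_. \<epsilon>" "\<lambda>_. 0"] assms by (simp add: wm_0)

lemma mcong_sym: "mcong n d A B \<Longrightarrow> mcong n d B A"
  unfolding mcong_def by (metis dvd_minus_iff minus_diff_eq)

lemma mcong_dvd: "mcong n d A B \<Longrightarrow> c dvd d \<Longrightarrow> mcong n c A B"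
  unfolding mcong_def by (meson dvd_trans)

lemma mat_cong_mcong: "mat_cong n A B k \<longleftrightarrow> mcong n (int k) A B"
  by (simp add: mat_cong_def mcong_def cong_iff_dvd_diff)

lemma mcong_squarefree:
  assumes "squarefree N" "N > 0" "\<And>p. prime p \<Longrightarrow> p dvd N \<Longrightarrow> mcong n (int p) A B"
  shows "mcong n (int N) A B"
  unfolding mcong_def using squarefree_dvdI[OF assms(1,2)] assms(3) by (simp add: mcong_def)

lemma xi_mcong:
  assumes "A \<in> carrier_mat (2*m) (2*m)" "B \<in> carrier_mat (2*m) (2*m)" "m \<le> n" "mcong m d A B"
  shows "mcong n d (xi m n A) (xi m n B)"
  unfolding mcong_def
proof (intro allI impI)
  fix i j assume ij: "i < 2*n" "j < 2*n"
  have "unemb m n k < 2*m" if "inF m n k" for k using that assms(3) by (auto simp: inF_def unemb_def)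
  thus "d dvd xi m n A $$ (i, j) - xi m n B $$ (i, j)"
    using assms(4) unfolding xi_index[OF assms(1,3) ij] xi_index[OF assms(2,3) ij] mcong_def by auto
qed

lemma xi_wm:
  assumes mn: "m \<le> n" shows "xi m n (wm m e) = wm n (\<lambda>j. if j < m then e j else 0)"
proof (rule rat_mat_inj)
  let ?e = "\<lambda>j. if j < m then e j else 0"
  have 1: "wm n (\<lambda>j. if j < m then 0 else ?e j) = 1\<^sub>m (2*n)" unfolding wm_0[symmetric] by (rule wm_cong) simp
  have 2: "wm m ?e = wm m e" by (rule wm_cong) simp
  have "xi m n (rat_mat (wm m e)) = rat_mat (wm n ?e)"
    unfolding wm_split[OF mn, of ?e] 1 2 of_int_hom.mat_hom_one
    by (rule left_mult_one_mat[symmetric, OF xi_carrier[OF Sp_carrier[OF rat_wm_Sp] mn]])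
  thus "rat_mat (xi m n (wm m e)) = rat_mat (wm n ?e)"
    using xi_map_mat[OF Sp_carrier[OF wm_Sp] mn, of "of_int :: int \<Rightarrow> rat"] by simp
qed

text \<open>Modulo d every mixed term contains the factor \<open>e k * e' k\<close>, so that
  multiplication amounts to adding the parameters.\<close>

lemma wm_add:
  assumes "\<And>k. k < n \<Longrightarrow> d dvd e k * e' k"
  shows "mcong n d (wm n e * wm n e') (wm n (\<lambda>k. e k + e' k))"
  unfolding wm_def dg_mult
proof (rule mcongI_halves, goal_cases)
  case (1 k l)
  define a b where "a = e k" and "b = e' k"
  have ab: "d dvd a * b" using assms[OF 1(1)] by (simp add: a_def b_def)
  have "((1 - a^2) * (1 - b^2) + (a^3 - 2 * a) * b) - (1 - (a + b)^2) = a * b * (a * b + a^2)"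
    "((1 - a^2) * (b^3 - 2 * b) + (a^3 - 2 * a) * (1 - b^2)) - ((a + b)^3 - 2 * (a + b)) = a * b * (- a * b^2 - a^2 * b - a - b)"
    "(a * (1 - b^2) + (1 - a^2) * b) - (a + b) = a * b * (- a - b)"
    "(a * (b^3 - 2 * b) + (1 - a^2) * (1 - b^2)) - (1 - (a + b)^2) = a * b * (b^2 + a * b)"
    by (simp_all add: algebra_simps power2_eq_square power3_eq_cube)
  hence "d dvd ((1 - a^2) * (1 - b^2) + (a^3 - 2 * a) * b) - (1 - (a + b)^2)"
    "d dvd ((1 - a^2) * (b^3 - 2 * b) + (a^3 - 2 * a) * (1 - b^2)) - ((a + b)^3 - 2 * (a + b))"
    "d dvd (a * (1 - b^2) + (1 - a^2) * b) - (a + b)"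
    "d dvd (a * (b^3 - 2 * b) + (1 - a^2) * (1 - b^2)) - (1 - (a + b)^2)"
    using ab by (metis dvd_mult2)+
  thus ?case unfolding dg_index[OF 1] a_def b_def by (cases "k = l") simp_all
qed

lemma squarefree_coprime_div:
  fixes N l :: nat
  assumes "squarefree N" "l dvd N" shows "coprime l (N div l)"
proof (rule coprimeI)
  fix c assume "c dvd l" "c dvd N div l"
  hence "c * c dvd l * (N div l)" by (rule mult_dvd_mono)
  hence "c^2 dvd N" using assms(2) by (simp add: power2_eq_square)
  thus "is_unit c" using assms(1) by (simp add: squarefree_def)
qed

lemma is_tuple_Cons: "is_tuple N (l # ls) \<longleftrightarrow> l > 0 \<and> l dvd N \<and> (\<forall>k\<in>set ls. coprime l k) \<and> is_tuple N ls"
  by (auto simp: is_tuple_def)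

text \<open>Modulo \<open>N\<close> every representative is a plane-wise element; at \<open>p\<close> it acts as \<open>J\<close>
  precisely in the planes below the size of the factor whose entry \<open>p\<close> divides.\<close>

lemma std_rep_wm:
  assumes N: "N > 0" "squarefree N"
  shows "std_rep n N m ls \<gamma> \<Longrightarrow> is_tuple N ls \<Longrightarrow> m \<le> n \<Longrightarrow> length ls \<le> m \<Longrightarrow>
    \<gamma> \<in> Sp n \<and> (\<exists>e. (\<forall>j. idem N (e j)) \<and> mcong n (int N) \<gamma> (wm n e) \<and>
      (\<forall>p j. prime p \<longrightarrow> p dvd N \<longrightarrow> (\<not> int p dvd e j \<longleftrightarrow> (\<exists>k<length ls. p dvd ls ! k \<and> j < m - k))))"
proof (induction ls arbitrary: m \<gamma>)
  case Nil
  thus ?case by (auto intro!: exI[of _ "\<lambda>_. 0"] simp: wm_0 mcong_refl)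
next
  case (Cons l ls)
  obtain g h where g: "gamma_elt N m l g" "std_rep n N (m - 1) ls h" "\<gamma> = xi m n g * h"
    using Cons.prems(1) by auto
  have l: "l > 0" "l dvd N" "\<And>k. k \<in> set ls \<Longrightarrow> coprime l k" "is_tuple N ls" using Cons.prems(2) by (auto simp: is_tuple_Cons)
  have mn: "m \<le> n" "m \<ge> 1" using Cons.prems by auto
  have mle: "m - 1 \<le> n" "length ls \<le> m - 1" using mn Cons.prems(4) by auto
  obtain e' where h: "h \<in> Sp n" and e': "\<And>j. idem N (e' j)" "mcong n (int N) h (wm n e')"
    "\<And>p j. prime p \<Longrightarrow> p dvd N \<Longrightarrow> \<not> int p dvd e' j \<longleftrightarrow> (\<exists>k<length ls. p dvd ls ! k \<and> j < m - 1 - k)"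
    using Cons.IH[OF g(2) l(4)] mle by blast
  obtain \<epsilon> where \<epsilon>: "idem N \<epsilon>" "\<And>p. prime p \<Longrightarrow> p dvd N \<Longrightarrow> int p dvd \<epsilon> \<longleftrightarrow> \<not> p dvd l"
    using idem_exists[OF N(1), of "\<lambda>p. p dvd l"] by blast
  have gS: "g \<in> Sp m" and gJ: "mcong m (int (l^2)) g (Jmat m)" and g1: "mcong m (int ((N div l)^2)) g (1\<^sub>m (2*m))"
    using g(1) by (auto simp: gamma_elt_def mat_cong_mcong)
  \<comment> \<open>Modulo p | N the factor g is J if p | l and the identity otherwise, and so is
    \<open>wm\<close> with the constant parameter \<epsilon>.\<close>
  have gw: "mcong m (int N) g (wm m (\<lambda>_. \<epsilon>))"
  proof (rule mcong_squarefree[OF N(2,1)])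
    fix p assume p: "prime p" "p dvd N"
    show "mcong m (int p) g (wm m (\<lambda>_. \<epsilon>))"
    proof (cases "p dvd l")
      case True
      hence "\<not> int p dvd \<epsilon>" using \<epsilon>(2)[OF p] by simp
      hence "int p dvd \<epsilon> - 1" using \<epsilon>(1) p unfolding idem_def by blast
      moreover have "int p dvd int (l^2)" using True by (simp only: int_dvd_int_iff) (simp add: power2_eq_square)
      ultimately show ?thesis using mcong_trans[OF mcong_dvd[OF gJ] mcong_sym[OF wm_mcong_Jmat]] by blast
    next
      case False
      hence "int p dvd \<epsilon>" using \<epsilon>(2)[OF p] by simp
      moreover have "p dvd l * (N div l)" using p l by simp
      hence "p dvd N div l" using False p(1) prime_dvd_mult_iff by blast
      hence "int p dvd int ((N div l)^2)" by (simp only: int_dvd_int_iff) (simp add: power2_eq_square)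
      ultimately show ?thesis using mcong_trans[OF mcong_dvd[OF g1] mcong_sym[OF wm_mcong_one]] by blast
    qed
  qed
  define e1 where "e1 = (\<lambda>j. if j < m then \<epsilon> else 0)"
  have xg: "mcong n (int N) (xi m n g) (wm n e1)"
    using xi_mcong[OF Sp_carrier[OF gS] Sp_carrier[OF wm_Sp] mn(1) gw] unfolding xi_wm[OF mn(1)] e1_def .
  have xS: "xi m n g \<in> Sp n" by (rule xi_Sp[OF gS mn(1)])
  have lk: "\<not> p dvd ls ! k" if "p dvd l" "prime p" "k < length ls" for p k
    using l(3)[of "ls ! k"] that by (metis coprime_common_divisor_nat nth_mem not_prime_1)
  have e'l: "int p dvd e' j" if "p dvd l" "prime p" "p dvd N" for p j
    using e'(3)[OF that(2,3), of j] lk[OF that(1,2)] by auto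
  \<comment> \<open>Coprimality of the entries: a prime dividing l divides no later entry, so at
    every p | N at most one of the two factors is nontrivial.\<close>
  have ee: "int N dvd e1 j * e' j" for j
  proof (rule squarefree_dvdI[OF N(2,1)])
    fix p assume p: "prime p" "p dvd N"
    show "int p dvd e1 j * e' j" using \<epsilon>(2)[OF p] e'l[OF _ p] by (cases "p dvd l") (auto simp: e1_def)
  qed
  define e where "e = (\<lambda>j. e1 j + e' j)"
  have cl: "\<not> int p dvd e j \<longleftrightarrow> (if p dvd l then j < m else \<not> int p dvd e' j)" if p: "prime p" "p dvd N" for p j
    using \<epsilon>(2)[OF p] e'l[OF _ p, of j] by (auto simp: e_def e1_def dvd_add_left_iff dvd_add_right_iff)
  have ide: "idem N (e j)" for j unfolding idem_def
  proof (intro allI impI)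
    fix p assume p: "prime p" "p dvd N"
    have "int p dvd e1 j \<or> int p dvd e' j" using \<epsilon>(2)[OF p] e'l[OF _ p] by (auto simp: e1_def)
    moreover have "int p dvd e1 j \<or> int p dvd e1 j - 1" using \<epsilon>(1) p by (auto simp: e1_def idem_def)
    moreover have "int p dvd e' j \<or> int p dvd e' j - 1" using e'(1)[of j] p by (auto simp: idem_def)
    moreover have "e j - 1 = e1 j + (e' j - 1)" "e j - 1 = (e1 j - 1) + e' j" by (simp_all add: e_def)
    ultimately show "int p dvd e j \<or> int p dvd e j - 1" unfolding e_def by (metis dvd_add)
  qed
  have "mcong n (int N) \<gamma> (wm n e1 * wm n e')" unfolding g(3)
    by (rule mcong_mult[OF Sp_carrier[OF xS] Sp_carrier[OF wm_Sp] Sp_carrier[OF h] Sp_carrier[OF wm_Sp] xg e'(2)])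
  hence "mcong n (int N) \<gamma> (wm n e)" unfolding e_def by (rule mcong_trans[OF _ wm_add[OF ee]])
  moreover have "\<not> int p dvd e j \<longleftrightarrow> (\<exists>k<length (l # ls). p dvd (l # ls) ! k \<and> j < m - k)" if p: "prime p" "p dvd N" for p j
  proof -
    have "(\<exists>k<length (l # ls). p dvd (l # ls) ! k \<and> j < m - k) \<longleftrightarrow> (p dvd l \<and> j < m) \<or> (\<exists>k<length ls. p dvd ls ! k \<and> j < m - Suc k)"
      by (auto simp: less_Suc_eq_0_disj)
    also have "\<dots> \<longleftrightarrow> \<not> int p dvd e j" unfolding cl[OF p] e'(3)[OF p] using lk[OF _ p(1)] by auto
    finally show ?thesis by blast
  qed
  moreover have "\<gamma> \<in> Sp n" unfolding g(3) by (rule Sp_mult[OF xS h])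
  ultimately show ?case using ide by blast
qed

text \<open>The factor belonging to l can be taken as \<open>wm\<close> with a constant parameter
  that is 1 modulo l^2 and 0 modulo (N / l)^2; the squares are coprime because N is
  squarefree.\<close>

lemma std_rep_exists:
  assumes N: "squarefree N" shows "(\<forall>l\<in>set ls. l dvd N) \<Longrightarrow> \<exists>\<gamma>. std_rep n N m ls \<gamma>"
proof (induction ls arbitrary: m)
  case Nil
  show ?case by (rule exI[of _ "1\<^sub>m (2*n)"]) simp
next
  case (Cons l ls)
  obtain h where h: "std_rep n N (m - 1) ls h" using Cons by auto
  have "coprime (int (l^2)) (int ((N div l)^2))"
    using squarefree_coprime_div[OF N, of l] Cons.prems by simp
  then obtain u v where uv: "u * int (l^2) + v * int ((N div l)^2) = 1"
    using bezout_int by (metis coprime_iff_gcd_eq_1)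
  define \<epsilon> where "\<epsilon> = v * int ((N div l)^2)"
  have "\<epsilon> - 1 = - u * int (l^2)" using uv by (simp add: \<epsilon>_def)
  hence "mcong m (int (l^2)) (wm m (\<lambda>_. \<epsilon>)) (Jmat m)" by (intro wm_mcong_Jmat) simp
  moreover have "mcong m (int ((N div l)^2)) (wm m (\<lambda>_. \<epsilon>)) (1\<^sub>m (2*m))" by (intro wm_mcong_one) (simp add: \<epsilon>_def)
  ultimately have "gamma_elt N m l (wm m (\<lambda>_. \<epsilon>))" by (simp add: gamma_elt_def mat_cong_mcong)
  thus ?case using h by auto
qed

lemma is_tuple_prime_unique:
  assumes "is_tuple N ls" "prime p" "i < length ls" "j < length ls" "p dvd ls ! i" "p dvd ls ! j"
  shows "i = j"
proof (rule ccontr)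
  assume "i \<noteq> j"
  hence "coprime (ls ! i) (ls ! j)"
    using assms(1,3,4) unfolding is_tuple_def sorted_wrt_iff_nth_less by (metis coprime_commute linorder_neqE_nat)
  thus False using assms(2,5,6) by (metis coprime_common_divisor_nat not_prime_1)
qed

text \<open>Position k of the list holds l_(n-r-k). If p divides it, the planes with J at p are
  those below n - k, and n - r - k of them are not below r. Since p divides at most one entry, the
  rank determines the position.\<close>

lemma has_tuple_imp_cnt:
  assumes N: "N > 0" "squarefree N" and rn: "r \<le> n" and t: "is_tuple N ls" "length ls = n - r" and \<gamma>: "std_rep n N n ls \<gamma>"
  shows "\<gamma> \<in> Sp n \<and> (\<exists>e. (\<forall>j. idem N (e j)) \<and> fequiv n (Gamma0 n N) {r} (rat_mat (wm n e)) (rat_mat \<gamma>) \<and>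
    (\<forall>p. prime p \<longrightarrow> p dvd N \<longrightarrow> (\<forall>k<n - r. p dvd ls ! k \<longleftrightarrow> cnt p e r n = n - r - k)))"
proof -
  obtain e where \<gamma>S: "\<gamma> \<in> Sp n" and e: "\<And>j. idem N (e j)" "mcong n (int N) \<gamma> (wm n e)"
    "\<And>p j. prime p \<Longrightarrow> p dvd N \<Longrightarrow> \<not> int p dvd e j \<longleftrightarrow> (\<exists>k<length ls. p dvd ls ! k \<and> j < n - k)"
    using std_rep_wm[OF N \<gamma> t(1) order_refl] t(2) diff_le_self[of n r] by metis
  have c: "cnt p e r n = n - r - k" if p: "prime p" "p dvd N" and k: "k < n - r" "p dvd ls ! k" for p k
  proof -
    have "(\<exists>k'<length ls. p dvd ls ! k' \<and> j < n - k') \<longleftrightarrow> j < n - k" for j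
      using is_tuple_prime_unique[OF t(1) p(1)] k t(2) by metis
    hence "{j \<in> {r..<n}. \<not> int p dvd e j} = {r..<n - k}" unfolding e(3)[OF p] by auto
    thus ?thesis by (simp add: cnt_def)
  qed
  have "p dvd ls ! k \<longleftrightarrow> cnt p e r n = n - r - k" if p: "prime p" "p dvd N" and k: "k < n - r" for p k
  proof
    assume eq: "cnt p e r n = n - r - k"
    hence "card {j \<in> {r..<n}. \<not> int p dvd e j} \<noteq> 0" using k by (simp add: cnt_def)
    then obtain j where "\<not> int p dvd e j" by (metis (mono_tags, lifting) Collect_empty_eq card.empty)
    then obtain k' where k': "k' < length ls" "p dvd ls ! k'" using e(3)[OF p] by blast
    hence "cnt p e r n = n - r - k'" using c[OF p] t(2) by simp
    hence "k = k'" using eq k k'(1) t(2) by simp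
    thus "p dvd ls ! k" using k' by simp
  qed (rule c[OF p k])
  thus ?thesis using \<gamma>S e(1) mcong_fequiv[OF \<gamma>S wm_Sp e(2), of "{r}"] rn by blast
qed

lemma cnt_le: "cnt p e a b \<le> b - a"
  using cnt_add[of p e a b] by simp

text \<open>For the converse a standard representative of the same tuple is compared with e: the
  tuple fixes all ranks, and equal ranks give equal cusps. In particular the cusp does not depend on
  the choice of the factors in \<open>std_rep\<close>.\<close>

lemma has_tuple_iff:
  assumes N: "N > 0" "squarefree N" and rn: "r \<le> n"
  shows "has_tuple n N r ls X \<longleftrightarrow> is_tuple N ls \<and> length ls = n - r \<and>
    (\<exists>e. (\<forall>j. idem N (e j)) \<and> X = cusp n (Gamma0 n N) r (rat_mat (wm n e)) \<and>
      (\<forall>p. prime p \<longrightarrow> p dvd N \<longrightarrow> (\<forall>k<n - r. p dvd ls ! k \<longleftrightarrow> cnt p e r n = n - r - k)))"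
proof (cases "is_tuple N ls \<and> length ls = n - r")
  case t: True
  note G = Gamma0_subgroup[of n N]
  let ?P = "\<lambda>e. \<forall>p. prime p \<longrightarrow> p dvd N \<longrightarrow> (\<forall>k<n - r. p dvd ls ! k \<longleftrightarrow> cnt p e r n = n - r - k)"
  show ?thesis
  proof
    assume "has_tuple n N r ls X"
    then obtain \<gamma> where \<gamma>: "std_rep n N n ls \<gamma>" "X = cusp n (Gamma0 n N) r (rat_mat \<gamma>)" by (auto simp: has_tuple_def)
    obtain e where e: "\<gamma> \<in> Sp n" "\<forall>j. idem N (e j)" "fequiv n (Gamma0 n N) {r} (rat_mat (wm n e)) (rat_mat \<gamma>)" "?P e"
      using has_tuple_imp_cnt[OF N rn _ _ \<gamma>(1)] t by blast
    have "X = cusp n (Gamma0 n N) r (rat_mat (wm n e))"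
      unfolding \<gamma>(2) using cusp_eq_iff[OF G rn rat_wm_Sp[of n e] rat_mat_Sp[OF e(1)]] e(3) by simp
    thus "is_tuple N ls \<and> length ls = n - r \<and> (\<exists>e. (\<forall>j. idem N (e j)) \<and> X = cusp n (Gamma0 n N) r (rat_mat (wm n e)) \<and> ?P e)"
      using t e by blast
  next
    assume "is_tuple N ls \<and> length ls = n - r \<and> (\<exists>e. (\<forall>j. idem N (e j)) \<and> X = cusp n (Gamma0 n N) r (rat_mat (wm n e)) \<and> ?P e)"
    then obtain e where e: "\<And>j. idem N (e j)" "X = cusp n (Gamma0 n N) r (rat_mat (wm n e))" "?P e" by blast
    have "\<forall>l\<in>set ls. l dvd N" using t by (simp add: is_tuple_def)
    from std_rep_exists[OF N(2) this] obtain \<gamma> where \<gamma>: "std_rep n N n ls \<gamma>" by blast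
    obtain f where f: "\<gamma> \<in> Sp n" "\<And>j. idem N (f j)" "fequiv n (Gamma0 n N) {r} (rat_mat (wm n f)) (rat_mat \<gamma>)" "?P f"
      using has_tuple_imp_cnt[OF N rn _ _ \<gamma>] t by blast
    have cc: "cnt p e r n = cnt p f r n" if p: "prime p" "p dvd N" for p
    proof -
      \<comment> \<open>A nonzero rank is read off from the entry divisible by p. Rank 0 belongs to
        no entry and is settled by using the claim in both directions.\<close>
      have "cnt p e' r n = cnt p f' r n \<or> cnt p e' r n = 0" if "?P e'" "?P f'" for e' f'
      proof (cases "cnt p e' r n = 0")
        case False
        define k where "k = n - r - cnt p e' r n"
        have "k < n - r" "cnt p e' r n = n - r - k" using False cnt_le[of p e' r n] by (auto simp: k_def)
        thus ?thesis using that p by metis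
      qed simp
      from this[OF e(3) f(4)] this[OF f(4) e(3)] show ?thesis by auto
    qed
    \<comment> \<open>W_n is zero, so this flag amounts to W_r alone and the upper block of planes
      is empty.\<close>
    have "fequiv n (Gamma0 n N) {r, n} (rat_mat (wm n e)) (rat_mat (wm n f))"
      by (rule equal_cnt_fequiv[OF N rn order_refl e(1) f(2)]) (use cc in \<open>auto simp: cnt_def\<close>)
    hence "fequiv n (Gamma0 n N) {r} (rat_mat (wm n e)) (rat_mat (wm n f))" by (rule fequiv_mono) simp
    hence "fequiv n (Gamma0 n N) {r} (rat_mat (wm n e)) (rat_mat \<gamma>)"
      by (rule fequiv_trans[OF G _ rat_wm_Sp _ f(3), rotated]) (use rn in simp)
    hence "X = cusp n (Gamma0 n N) r (rat_mat \<gamma>)"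
      unfolding e(2) using cusp_eq_iff[OF G rn rat_wm_Sp[of n e] rat_mat_Sp[OF f(1)]] by simp
    thus "has_tuple n N r ls X" using t \<gamma> by (auto simp: has_tuple_def)
  qed
qed (auto simp: has_tuple_def)

lemma cnt_split: "a \<le> b \<Longrightarrow> b \<le> c \<Longrightarrow> cnt p e a c = cnt p e a b + cnt p e b c"
  using cnt_add[of p e a b] cnt_add[of p e b c] cnt_add[of p e a c]
proof -
  assume "a \<le> b" "b \<le> c"
  hence "{j \<in> {a..<c}. \<not> int p dvd e j} = {j \<in> {a..<b}. \<not> int p dvd e j} \<union> {j \<in> {b..<c}. \<not> int p dvd e j}" by auto
  thus ?thesis unfolding cnt_def by (simp add: card_Un_disjoint disjoint_iff)
qed

lemma decomposition_fequiv:
  assumes N: "N > 0" "squarefree N" and \<gamma>: "\<gamma> \<in> Sp n"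
  obtains e where "\<And>j. idem N (e j)" "fequiv n (Gamma0 n N) {..n} (rat_mat (wm n e)) \<gamma>"
proof -
  obtain g e b where "g \<in> GammaZ n N" "b \<in> Sp n" "\<And>j. idem N (e j)" "\<And>r. r \<le> n \<Longrightarrow> parab n r b"
    "\<gamma> = rat_mat g * rat_mat (wm n e) * b" using decomposition[OF assms] by blast
  thus ?thesis by (intro that[of e]) (auto simp: fequiv_def Gamma0_eq)
qed

section \<open>Absence of self-intersections\<close>

text \<open>Equality of the images relates only the larger subspaces a W_s and a' W_s. Since a and
  a' differ from \<gamma> by elements stabilising W_r, the smaller ones a W_r and a' W_r coincide.
  The resulting flag equivalence a' = g a b still has to be realised inside the boundary
  group.\<close>

lemma no_self_intersection:
  assumes N: "N > 0" "squarefree N" and sr: "s \<le> r" and rn: "r \<le> n" and \<gamma>: "\<gamma> \<in> Sp n"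
    and X: "X \<in> cusps r (boundary_group n (Gamma0 n N) r \<gamma>) s" and Y: "Y \<in> cusps r (boundary_group n (Gamma0 n N) r \<gamma>) s"
    and eq: "boundary_image n (Gamma0 n N) r \<gamma> X = boundary_image n (Gamma0 n N) r \<gamma> Y"
  shows "X = Y"
proof -
  define G H where "G = Gamma0 n N" and "H = boundary_group n G r \<gamma>"
  have G: "is_subgroup n G" unfolding G_def by (rule Gamma0_subgroup)
  have GS: "G \<subseteq> Sp n" using G by (simp add: is_subgroup_def)
  have H: "is_subgroup r H" unfolding H_def by (rule boundary_group_subgroup[OF G \<gamma> rn])
  obtain \<rho> \<rho>' where \<rho>: "\<rho> \<in> Sp r" "X = cusp r H s \<rho>" and \<rho>': "\<rho>' \<in> Sp r" "Y = cusp r H s \<rho>'"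
    using X Y unfolding cusps_def H_def G_def by blast
  have sn: "s \<le> n" using sr rn by simp
  have R: "{s, r} \<subseteq> {..n}" "{s} \<subseteq> {..n}" "{r} \<subseteq> {..n}" using sn rn by auto
  note x = xi_Sp[OF \<rho>(1) rn] and x' = xi_Sp[OF \<rho>'(1) rn]
  have px: "parab n r (xi r n \<rho>)" and px': "parab n r (xi r n \<rho>')"
    using parab_xi_ge[OF Sp_carrier[OF \<rho>(1)] order_refl rn] parab_xi_ge[OF Sp_carrier[OF \<rho>'(1)] order_refl rn] .
  define a a' where "a = \<gamma> * xi r n \<rho>" and "a' = \<gamma> * xi r n \<rho>'"
  have a: "a \<in> Sp n" "a' \<in> Sp n" unfolding a_def a'_def by (intro Sp_mult \<gamma> x x')+
  have "cusp n G s a = cusp n G s a'"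
    using eq unfolding \<rho>(2) \<rho>'(2) H_def G_def[symmetric]
      boundary_image_cusp[OF G rn sr \<gamma> \<rho>(1)] boundary_image_cusp[OF G rn sr \<gamma> \<rho>'(1)] a_def a'_def .
  hence s: "fequiv n G {s} a a'" using cusp_eq_iff[OF G sn a] by simp
  have r1: "fequiv n G {r} \<gamma> a" unfolding a_def using px by (intro fequiv_right[OF G \<gamma> x]) simp
  have r2: "fequiv n G {r} \<gamma> a'" unfolding a'_def using px' by (intro fequiv_right[OF G \<gamma> x']) simp
  have r: "fequiv n G {r} a a'" by (rule fequiv_trans[OF G R(3) a(1) fequiv_sym[OF G R(3) \<gamma> r1] r2])
  obtain e where e: "\<And>j. idem N (e j)" "fequiv n G {..n} (rat_mat (wm n e)) a"
    using decomposition_fequiv[OF N a(1)] unfolding G_def by blast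
  obtain e' where e': "\<And>j. idem N (e' j)" "fequiv n G {..n} (rat_mat (wm n e')) a'"
    using decomposition_fequiv[OF N a(2)] unfolding G_def by blast
  have tr: "fequiv n G T (rat_mat (wm n e)) (rat_mat (wm n e'))" if "fequiv n G T a a'" "T \<subseteq> {..n}" for T
    by (rule fequiv_trans[OF G that(2) rat_wm_Sp fequiv_mono[OF e(2) that(2)]
          fequiv_trans[OF G that(2) a(1) that(1) fequiv_sym[OF G that(2) rat_wm_Sp fequiv_mono[OF e'(2) that(2)]]]])
  have cs: "cnt p e s n = cnt p e' s n" "cnt p e r n = cnt p e' r n" if "prime p" "p dvd N" for p
    using fequiv_wm_cnt[OF tr[OF s R(2), unfolded G_def] that sn] fequiv_wm_cnt[OF tr[OF r R(3), unfolded G_def] that rn] .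
  \<comment> \<open>The count over {s..<r} is the difference of the ranks of the two
    members.\<close>
  have "fequiv n G {s, r} (rat_mat (wm n e)) (rat_mat (wm n e'))" unfolding G_def
    by (rule equal_cnt_fequiv[OF N sr rn e(1) e'(1)]) (use cs cnt_split[OF sr rn] in \<open>metis add_right_cancel\<close>)
  hence "fequiv n G {s, r} a a'"
    using fequiv_trans[OF G R(1) a(1) fequiv_sym[OF G R(1) rat_wm_Sp fequiv_mono[OF e(2) R(1)]]
        fequiv_trans[OF G R(1) rat_wm_Sp _ fequiv_mono[OF e'(2) R(1)]]] by blast
  then obtain g b where g: "g \<in> G" "b \<in> Sp n" "parab n s b" "parab n r b" "a' = g * a * b" by (auto simp: fequiv_def)
  have gS: "g \<in> Sp n" using g(1) GS by blast
  \<comment> \<open>Chosen so that \<gamma> q \<gamma>^-1 = g. Then \<open>omega\<close> maps q into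
    the boundary group, and applying \<open>omega\<close> to q xi(\<rho>) b = xi(\<rho>') yields the
    equivalence of \<rho> and \<rho>' there.\<close>
  define q where "q = xi r n \<rho>' * sinv n b * sinv n (xi r n \<rho>)"
  have q: "q \<in> Sp n" unfolding q_def by (intro Sp_mult sinv_Sp x x' g)
  note m = mult_carrier_mat[of _ "2*n" "2*n" _ "2*n"] and as = assoc_mult_square[of _ "2*n"]
  note c = Sp_carrier[OF \<gamma>] Sp_carrier[OF x] Sp_carrier[OF x'] Sp_carrier[OF g(2)] Sp_carrier[OF gS] sinv_carrier Sp_carrier[OF q] Sp_carrier[OF a(1)]
  have "\<gamma> * q = a' * sinv n b * sinv n (xi r n \<rho>)" unfolding q_def a'_def by (simp only: as m c)
  also have "a' * sinv n b = g * a" unfolding g(5) by (rule Sp_cancel_right(2)[OF g(2) m[OF c(5) c(8)]])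
  also have "g * a * sinv n (xi r n \<rho>) = g * \<gamma>"
    unfolding a_def assoc_mult_square[OF c(5) c(1) c(2), symmetric] by (rule Sp_cancel_right(2)[OF x m[OF c(5) c(1)]])
  finally have "\<gamma> * q * sinv n \<gamma> = g" using Sp_cancel_right(2)[OF \<gamma> c(5)] by simp
  moreover have pq: "parab n r q" unfolding q_def
    by (intro parab_mult[OF m[OF c(3) c(6)] _ c(6) _ rn] parab_mult[OF c(3) px' c(6) _ rn] parab_sinv[OF rn] px g)
  ultimately have \<delta>: "omega n r q \<in> H" unfolding H_def boundary_group_eq[OF GS \<gamma>] using q g(1) by blast
  have ob: "omega n r b \<in> Sp r" by (rule omega_Sp[OF g(2,4) rn])
  have "q * xi r n \<rho> * b = xi r n \<rho>'" unfolding q_def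
    unfolding Sp_cancel_right(1)[OF x m[OF c(3) c(6)]] by (rule Sp_cancel_right(1)[OF g(2) c(3)])
  hence "omega n r (q * xi r n \<rho> * b) = \<rho>'" using omega_xi[OF Sp_carrier[OF \<rho>'(1)] rn] by simp
  moreover have "omega n r (q * xi r n \<rho> * b) = omega n r q * \<rho> * omega n r b"
    unfolding omega_mult[OF m[OF c(7) c(2)] parab_mult[OF c(7) pq c(2) px rn] c(4) g(4) rn]
      omega_mult[OF c(7) pq c(2) px rn] omega_xi[OF Sp_carrier[OF \<rho>(1)] rn] ..
  ultimately have "fequiv r H {s} \<rho> \<rho>'"
    unfolding fequiv_def using \<delta> ob parab_omega[OF sr rn g(3)] by blast
  thus ?thesis unfolding \<rho>(2) \<rho>'(2) using cusp_eq_iff[OF H sr \<rho>(1) \<rho>'(1)] by simp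
qed

section \<open>The boundary group up to conjugation\<close>

lemma boundary_group_translate:
  assumes G: "is_subgroup n G" and \<gamma>: "\<gamma> \<in> Sp n" and rn: "r \<le> n" and g: "g \<in> G" and p: "p \<in> Sp n" "parab n r p"
  shows "boundary_group n G r (g * \<gamma> * p) = {sinv r (omega n r p) * x * omega n r p | x. x \<in> boundary_group n G r \<gamma>}"
proof -
  have GS: "G \<subseteq> Sp n" using G by (simp add: is_subgroup_def)
  have gS: "g \<in> Sp n" using g GS by blast
  have gi: "sinv n g \<in> G" using G g by (simp add: is_subgroup_def)
  have \<gamma>': "g * \<gamma> * p \<in> Sp n" by (intro Sp_mult gS \<gamma> p)
  note m = mult_carrier_mat[of _ "2*n" "2*n" _ "2*n"] and as = assoc_mult_square[of _ "2*n"]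
  note c = Sp_carrier[OF gS] Sp_carrier[OF \<gamma>] Sp_carrier[OF p(1)] sinv_carrier
  have ti: "(g * \<gamma> * p) * (sinv n p * q * p) * sinv n (g * \<gamma> * p) = g * (\<gamma> * q * sinv n \<gamma>) * sinv n g"
    if q: "q \<in> carrier_mat (2*n) (2*n)" for q
  proof -
    have "(g * \<gamma> * p) * (sinv n p * q * p) * sinv n (g * \<gamma> * p) =
        g * \<gamma> * (p * (sinv n p * (q * (p * (sinv n p * (sinv n \<gamma> * sinv n g))))))"
      unfolding sinv_mult[OF Sp_mult[OF gS \<gamma>] p(1)] sinv_mult[OF gS \<gamma>] by (simp only: as m c q)
    also have "p * (sinv n p * (sinv n \<gamma> * sinv n g)) = sinv n \<gamma> * sinv n g"
      by (rule Sp_cancel_left(2)[OF p(1) m[OF c(4) c(4)]])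
    also have "p * (sinv n p * (q * (sinv n \<gamma> * sinv n g))) = q * (sinv n \<gamma> * sinv n g)"
      by (rule Sp_cancel_left(2)[OF p(1) m[OF q m[OF c(4) c(4)]]])
    finally show ?thesis by (simp only: as m c q)
  qed
  have gG: "g * y * sinv n g \<in> G \<longleftrightarrow> y \<in> G" if y: "y \<in> carrier_mat (2*n) (2*n)" for y
  proof
    assume "g * y * sinv n g \<in> G"
    hence "sinv n g * (g * y * sinv n g) * g \<in> G" using G g gi by (simp add: is_subgroup_def)
    moreover have "sinv n g * (g * y * sinv n g) = y * sinv n g"
      unfolding assoc_mult_square[OF c(1) y c(4)] by (rule Sp_cancel_left(1)[OF gS m[OF y c(4)]])
    ultimately show "y \<in> G" using Sp_cancel_right(1)[OF gS y] by simp
  next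
    assume "y \<in> G" thus "g * y * sinv n g \<in> G" using G g gi by (simp add: is_subgroup_def)
  qed
  note psi = parab_sinv[OF rn p(2)]
  have om: "omega n r (sinv n p * q * p) = sinv r (omega n r p) * omega n r q * omega n r p" "parab n r (sinv n p * q * p)"
    if "q \<in> Sp n" "parab n r q" for q
  proof -
    note qc = Sp_carrier[OF that(1)]
    note pp = parab_mult[OF c(4) psi qc that(2) rn]
    show "omega n r (sinv n p * q * p) = sinv r (omega n r p) * omega n r q * omega n r p"
      unfolding omega_mult[OF m[OF c(4) qc] pp c(3) p(2) rn] omega_mult[OF c(4) psi qc that(2) rn] omega_sinv[OF p rn] ..
    show "parab n r (sinv n p * q * p)" by (rule parab_mult[OF m[OF c(4) qc] pp c(3) p(2) rn])
  qed
  have conj_p: "\<exists>q'. q' \<in> Sp n \<and> parab n r q' \<and> q = sinv n p * q' * p" if q: "q \<in> Sp n" "parab n r q" for q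
  proof (intro exI conjI)
    note qc = Sp_carrier[OF q(1)]
    show "p * q * sinv n p \<in> Sp n" by (intro Sp_mult p sinv_Sp q)
    show "parab n r (p * q * sinv n p)"
      by (rule parab_mult[OF m[OF c(3) qc] parab_mult[OF c(3) p(2) qc q(2) rn] c(4) psi rn])
    have "sinv n p * (p * q * sinv n p) * p = sinv n p * (p * (q * (sinv n p * p)))" by (simp only: as m c qc)
    also have "\<dots> = q * (sinv n p * p)" by (rule Sp_cancel_left(1)[OF p(1) m[OF qc m[OF c(4) c(3)]]])
    also have "\<dots> = q" unfolding sinv_left[OF p(1)] using qc by simp
    finally show "q = sinv n p * (p * q * sinv n p) * p" by simp
  qed
  have mem: "(g * \<gamma> * p) * (sinv n p * q * p) * sinv n (g * \<gamma> * p) \<in> G \<longleftrightarrow> \<gamma> * q * sinv n \<gamma> \<in> G" if "q \<in> Sp n" for q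
    unfolding ti[OF Sp_carrier[OF that]] by (rule gG[OF m[OF m[OF c(2) Sp_carrier[OF that]] c(4)]])
  show ?thesis unfolding boundary_group_eq[OF GS \<gamma>'] boundary_group_eq[OF GS \<gamma>]
  proof (intro equalityI subsetI)
    fix \<delta> assume "\<delta> \<in> omega n r ` {q \<in> Sp n. parab n r q \<and> g * \<gamma> * p * q * sinv n (g * \<gamma> * p) \<in> G}"
    then obtain q where q: "q \<in> Sp n" "parab n r q" "g * \<gamma> * p * q * sinv n (g * \<gamma> * p) \<in> G" "\<delta> = omega n r q" by blast
    then obtain q' where q': "q' \<in> Sp n" "parab n r q'" "q = sinv n p * q' * p" using conj_p by blast
    have "\<gamma> * q' * sinv n \<gamma> \<in> G" using q(3) mem[OF q'(1)] unfolding q'(3) by blast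
    thus "\<delta> \<in> {sinv r (omega n r p) * x * omega n r p | x. x \<in> omega n r ` {q \<in> Sp n. parab n r q \<and> \<gamma> * q * sinv n \<gamma> \<in> G}}"
      using q' om(1)[OF q'(1,2)] q(4) by blast
  next
    fix \<delta> assume "\<delta> \<in> {sinv r (omega n r p) * x * omega n r p | x. x \<in> omega n r ` {q \<in> Sp n. parab n r q \<and> \<gamma> * q * sinv n \<gamma> \<in> G}}"
    then obtain q where q: "q \<in> Sp n" "parab n r q" "\<gamma> * q * sinv n \<gamma> \<in> G"
      "\<delta> = sinv r (omega n r p) * omega n r q * omega n r p" by blast
    have "sinv n p * q * p \<in> Sp n" by (intro Sp_mult sinv_Sp p q)
    thus "\<delta> \<in> omega n r ` {q \<in> Sp n. parab n r q \<and> g * \<gamma> * p * q * sinv n (g * \<gamma> * p) \<in> G}"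
      using om[OF q(1,2)] mem[OF q(1)] q(3,4) by (intro image_eqI[of _ _ "sinv n p * q * p"]) auto
  qed
qed

text \<open>A plane-wise w that is trivial on the first r planes commutes with \<open>xi\<close>,
  which gives one inclusion. For the other, w q0 = k w with k in Gamma_0(N); the rows and columns of
  w belonging to these planes are those of the identity, so q0 and k have the same entries
  there.\<close>

lemma boundary_group_wm:
  assumes rn: "r \<le> n" and e: "\<forall>j<r. e j = 0"
  shows "boundary_group n (Gamma0 n N) r (rat_mat (wm n e)) = Gamma0 r N"
proof -
  let ?w = "rat_mat (wm n e)"
  note wc = Sp_carrier[OF rat_wm_Sp[of n e]] Sp_carrier[OF wm_Sp[of n e]]
  have GS: "Gamma0 n N \<subseteq> Sp n" using Gamma0_subgroup[of n N] by (simp add: is_subgroup_def)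
  show ?thesis unfolding boundary_group_eq[OF GS rat_wm_Sp]
  proof (intro equalityI subsetI)
    fix \<delta> assume "\<delta> \<in> omega n r ` {q \<in> Sp n. parab n r q \<and> ?w * q * sinv n ?w \<in> Gamma0 n N}"
    then obtain q k where q: "q \<in> Sp n" "parab n r q" "?w * q * sinv n ?w = rat_mat k" "k \<in> GammaZ n N" "\<delta> = omega n r q"
      by (auto simp: Gamma0_eq)
    note qc = Sp_carrier[OF q(1)] and kS = GammaZ_Sp[OF q(4)]
    note kc = Sp_carrier[OF kS]
    have wq: "?w * q = rat_mat (k * wm n e)"
      unfolding rat_mat_mult[OF kc wc(2)] q(3)[symmetric]
      by (rule Sp_cancel_right(1)[OF rat_wm_Sp mult_carrier_mat[OF wc(1) qc], symmetric])
    \<comment> \<open>The integral form of q, again a quotient of integral symplectic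
      matrices.\<close>
    define q0 where "q0 = sinv n (wm n e) * (k * wm n e)"
    have q0: "q0 \<in> Sp n" unfolding q0_def by (intro Sp_mult sinv_Sp wm_Sp kS)
    note q0c = Sp_carrier[OF q0]
    have "rat_mat q0 = sinv n ?w * (?w * q)"
      unfolding q0_def rat_mat_mult[OF sinv_carrier mult_carrier_mat[OF kc wc(2)]] rat_mat_sinv[OF wc(2)] wq ..
    hence qq: "rat_mat q0 = q" using Sp_cancel_left(1)[OF rat_wm_Sp qc] by simp
    have pq0: "parab n r q0" using parab_rat_mat[OF q0c rn] q(2) qq by simp
    have eq: "wm n e * q0 = k * wm n e" unfolding q0_def by (rule Sp_cancel_left(2)[OF wm_Sp mult_carrier_mat[OF kc wc(2)]])
    have "int N dvd q0 $$ (n + i, j)" if ij: "i < r" "j < r" for i j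
    proof -
      have ij': "i < n" "j < n" "n + i < 2*n" "j < 2*n" using ij rn by auto
      have "(wm n e * q0) $$ (n + i, j) = q0 $$ (n + i, j)"
        unfolding mult_mat_index_double[OF wc(2) q0c ij'(3,4)] using ij' e ij by (simp add: wm_def dg_index sum_delta_mult)
      moreover have "(k * wm n e) $$ (n + i, j) = k $$ (n + i, j)"
        unfolding mult_mat_index_double[OF kc wc(2) ij'(3,4)] using ij' e ij by (simp add: wm_def dg_index sum_delta_mult)
      ultimately have "q0 $$ (n + i, j) = k $$ (n + i, j)" unfolding eq by simp
      thus ?thesis using q(4) ij' by (simp add: GammaZ_def)
    qed
    hence "omega n r q0 \<in> GammaZ r N"
      using omega_Sp[OF q0 pq0 rn] by (simp add: GammaZ_def omega_index)
    moreover have "\<delta> = rat_mat (omega n r q0)" unfolding q(5) qq[symmetric] by (rule omega_map_mat[OF rn q0c])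
    ultimately show "\<delta> \<in> Gamma0 r N" by (simp add: Gamma0_eq)
  next
    fix \<delta> assume "\<delta> \<in> Gamma0 r N"
    then obtain g where g: "g \<in> GammaZ r N" "\<delta> = rat_mat g" by (auto simp: Gamma0_eq)
    have \<delta>S: "\<delta> \<in> Sp r" unfolding g(2) by (rule rat_mat_Sp[OF GammaZ_Sp[OF g(1)]])
    note \<delta>c = Sp_carrier[OF \<delta>S]
    have "?w * xi r n \<delta> * sinv n ?w = xi r n \<delta>"
      unfolding wm_xi_commute[OF e rn \<delta>c] by (rule Sp_cancel_right(2)[OF rat_wm_Sp xi_carrier[OF \<delta>c rn]])
    also have "\<dots> = rat_mat (xi r n g)" unfolding g(2)
      by (rule xi_map_mat[OF Sp_carrier[OF GammaZ_Sp[OF g(1)]] rn]) simp_all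
    finally have "?w * xi r n \<delta> * sinv n ?w \<in> Gamma0 n N" using GammaZ_xi[OF g(1) rn] by (simp add: Gamma0_eq)
    thus "\<delta> \<in> omega n r ` {q \<in> Sp n. parab n r q \<and> ?w * q * sinv n ?w \<in> Gamma0 n N}"
      using xi_Sp[OF \<delta>S rn] parab_xi_ge[OF \<delta>c order_refl rn] omega_xi[OF \<delta>c rn]
      by (intro image_eqI[of _ _ "xi r n \<delta>"]) auto
  qed
qed

text \<open>Setting e to 0 on the planes below r amounts to a parabolic factor on the right, hence
  to a conjugation of the boundary group; for the new element the group is Gamma_0(N) of degree r
  itself.\<close>

lemma boundary_group_conjugate:
  assumes N: "N > 0" "squarefree N" and rn: "r \<le> n" and \<gamma>: "\<gamma> \<in> Sp n"
  shows "\<exists>h\<in>Sp r. boundary_group n (Gamma0 n N) r \<gamma> = {h * g * minv h | g. g \<in> Gamma0 r N}"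
proof -
  note G = Gamma0_subgroup[of n N]
  obtain e where e: "\<And>j. idem N (e j)" "fequiv n (Gamma0 n N) {..n} (rat_mat (wm n e)) \<gamma>"
    using decomposition_fequiv[OF N \<gamma>] by blast
  let ?h = "\<lambda>j. if j < r then 0 else e j"
  have R: "{r} \<subseteq> {..n}" "{r} \<subseteq> {r..n}" using rn by auto
  have "fequiv n (Gamma0 n N) {r} (rat_mat (wm n ?h)) \<gamma>"
    by (rule fequiv_trans[OF G R(1) rat_wm_Sp wm_low_fequiv[OF rn R(2)] fequiv_mono[OF e(2) R(1)]])
  then obtain g p where g: "g \<in> Gamma0 n N" "p \<in> Sp n" "parab n r p" "\<gamma> = g * rat_mat (wm n ?h) * p"
    by (auto simp: fequiv_def)
  define h where "h = sinv r (omega n r p)"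
  note oS = omega_Sp[OF g(2,3) rn]
  have h: "h \<in> Sp r" unfolding h_def by (rule sinv_Sp[OF oS])
  have mh: "minv h = omega n r p" unfolding minv_Sp[OF h] unfolding h_def by (rule sinv_sinv[OF oS])
  have "\<forall>j<r. ?h j = 0" by simp
  note b = boundary_group_wm[OF rn this, of N]
  have "boundary_group n (Gamma0 n N) r \<gamma> = {h * x * omega n r p | x. x \<in> Gamma0 r N}"
    unfolding g(4) boundary_group_translate[OF G rat_wm_Sp rn g(1-3)] b h_def ..
  thus ?thesis using h by (intro bexI[of _ h]) (simp_all add: mh)
qed

section \<open>The cusps on which a given cusp lies\<close>

lemma is_tuple_rev_map:
  "is_tuple N (rev (map l [1..<K + 1])) \<longleftrightarrow>
    (\<forall>i\<in>{1..K}. l i > 0 \<and> l i dvd N) \<and> (\<forall>i\<in>{1..K}. \<forall>j\<in>{1..K}. i < j \<longrightarrow> coprime (l i) (l j))"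
proof -
  have "sorted_wrt coprime (rev (map l [1..<K + 1])) \<longleftrightarrow> (\<forall>i j. i < j \<longrightarrow> j < K \<longrightarrow> coprime (l (Suc j)) (l (Suc i)))"
    unfolding sorted_wrt_rev sorted_wrt_map unfolding sorted_wrt_iff_nth_less by (auto simp del: upt_Suc)
  also have "\<dots> \<longleftrightarrow> (\<forall>i\<in>{1..K}. \<forall>j\<in>{1..K}. i < j \<longrightarrow> coprime (l i) (l j))"
  proof (intro iffI ballI allI impI)
    fix i j assume a: "\<forall>i j. i < j \<longrightarrow> j < K \<longrightarrow> coprime (l (Suc j)) (l (Suc i))" and ij: "i \<in> {1..K}" "j \<in> {1..K}" "i < j"
    have "coprime (l (Suc (j - 1))) (l (Suc (i - 1)))" using a[rule_format, of "i - 1" "j - 1"] ij by auto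
    thus "coprime (l i) (l j)" using ij by (simp add: coprime_commute)
  next
    fix i j assume "\<forall>i\<in>{1..K}. \<forall>j\<in>{1..K}. i < j \<longrightarrow> coprime (l i) (l j)" "i < j" "j < K"
    thus "coprime (l (Suc j)) (l (Suc i))" by (simp add: coprime_commute)
  qed
  finally show ?thesis unfolding is_tuple_def by (auto simp del: upt_Suc)
qed

text \<open>Indexing by the rank i instead of the position K - i in the list makes the dictionary
  uniform: p | l_i exactly if the rank at p is i.\<close>

lemma has_tuple_fun_iff:
  assumes N: "N > 0" "squarefree N" and rn: "r \<le> n" and K: "K = n - r"
  shows "has_tuple n N r (rev (map l [1..<K + 1])) X \<longleftrightarrow>
    (\<forall>i\<in>{1..K}. l i > 0 \<and> l i dvd N) \<and> (\<forall>i\<in>{1..K}. \<forall>j\<in>{1..K}. i < j \<longrightarrow> coprime (l i) (l j)) \<and>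
    (\<exists>e. (\<forall>j. idem N (e j)) \<and> X = cusp n (Gamma0 n N) r (rat_mat (wm n e)) \<and>
      (\<forall>p. prime p \<longrightarrow> p dvd N \<longrightarrow> (\<forall>i\<in>{1..K}. p dvd l i \<longleftrightarrow> cnt p e r n = i)))"
proof -
  have "(\<forall>k<n - r. p dvd rev (map l [1..<K + 1]) ! k \<longleftrightarrow> cnt p e r n = n - r - k) \<longleftrightarrow>
      (\<forall>i\<in>{1..K}. p dvd l i \<longleftrightarrow> cnt p e r n = i)" for p e
  proof (rule iffI; intro ballI allI impI)
    fix i assume a: "\<forall>k<n - r. p dvd rev (map l [1..<K + 1]) ! k \<longleftrightarrow> cnt p e r n = n - r - k" and i: "i \<in> {1..K}"
    have "K - i < n - r" "n - r - (K - i) = i" "rev (map l [1..<K + 1]) ! (K - i) = l i"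
      using i K by (auto simp: rev_nth simp del: upt_Suc)
    thus "p dvd l i \<longleftrightarrow> cnt p e r n = i" using a by metis
  next
    fix k assume a: "\<forall>i\<in>{1..K}. p dvd l i \<longleftrightarrow> cnt p e r n = i" and k: "k < n - r"
    have kK: "k < K" using k K by simp
    hence "K - k \<in> {1..K}" "rev (map l [1..<K + 1]) ! k = l (K - k)"
      by (auto simp: rev_nth Suc_diff_Suc simp del: upt_Suc)
    thus "p dvd rev (map l [1..<K + 1]) ! k \<longleftrightarrow> cnt p e r n = n - r - k" using a K by auto
  qed
  thus ?thesis unfolding has_tuple_iff[OF N rn] is_tuple_rev_map using K by (simp del: upt_Suc)
qed

lemma prime_dvd_div_squarefree:
  fixes l c :: nat
  assumes l: "squarefree l" and c: "c dvd l" and p: "prime p"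
  shows "p dvd l div c \<longleftrightarrow> p dvd l \<and> \<not> p dvd c"
proof -
  have "l = c * (l div c)" using c by simp
  moreover have "coprime c (l div c)" by (rule squarefree_coprime_div[OF l c])
  ultimately show ?thesis using p by (metis coprime_common_divisor_nat dvd_mult not_prime_1 prime_dvd_mult_iff)
qed

text \<open>Entry i of the new tuple is (l_(i+1) / c_(i+1)) c_i, with c_K read as 1 at the top. The
  shifted index lets all K - 1 entries be treated alike.\<close>

lemma boundary_tuple_list:
  fixes l c :: "nat \<Rightarrow> nat"
  assumes "K \<ge> 2"
  shows "(l K * c (K - 1)) # rev (map (\<lambda>i. l i div c i * c (i - 1)) [2..<K]) =
    rev (map (\<lambda>i. if i = K - 1 then l K * c (K - 1) else l (i + 1) div c (i + 1) * c i) [1..<(K - 1) + 1])"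
proof -
  have 1: "[1..<(K - 1) + 1] = [1..<K - 1] @ [K - 1]" using assms upt_Suc_append[of 1 "K - 1"] by simp
  have "map (\<lambda>i. if i = K - 1 then l K * c (K - 1) else l (i + 1) div c (i + 1) * c i) [1..<K - 1]
      = map (\<lambda>i. l i div c i * c (i - 1)) [2..<K]"
    using assms by (intro nth_equalityI) auto
  thus ?thesis unfolding 1 by simp
qed

text \<open>As xi(\<rho>) stabilises W_r, incidence means that the single element \<gamma>
  xi(\<rho>) represents both cusps.\<close>

lemma lies_on_iff:
  assumes rn: "r \<le> n" and sr: "s \<le> r"
  shows "lies_on n (Gamma0 n N) s r Y X \<longleftrightarrow>
    (\<exists>\<gamma>\<in>Sp n. \<exists>\<rho>\<in>Sp r. X = cusp n (Gamma0 n N) r \<gamma> \<and> Y = cusp n (Gamma0 n N) s (\<gamma> * xi r n \<rho>))"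
  unfolding lies_on_def cusps_def using boundary_image_cusp[OF Gamma0_subgroup rn sr] by (auto simp: image_iff)

text \<open>The new rank at p is i if the old rank i + 1 drops by one or if the old rank i is kept,
  which c_i records. The old rank K is the full dimension of the larger subspace and always
  drops.\<close>

lemma boundary_tuple_prime:
  fixes l c :: "nat \<Rightarrow> nat" and K :: nat
  defines "m \<equiv> \<lambda>i. if i = K - 1 then l K * c (K - 1) else l (i + 1) div c (i + 1) * c i"
  assumes sq: "\<And>i. i \<in> {1..K} \<Longrightarrow> squarefree (l i)" and c: "\<And>i. i \<in> {1..K - 1} \<Longrightarrow> c i dvd l i"
    and i: "i \<in> {1..K - 1}" and p: "prime p"
  shows "p dvd m i \<longleftrightarrow> (p dvd l (i + 1) \<and> (i + 1 = K \<or> \<not> p dvd c (i + 1))) \<or> p dvd c i"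
proof (cases "i = K - 1")
  case True
  hence "i + 1 = K" using i by simp
  thus ?thesis using True p by (auto simp: m_def prime_dvd_mult_iff)
next
  case False
  hence "i + 1 \<in> {1..K - 1}" "i + 1 \<in> {1..K}" "i + 1 \<noteq> K" using i by auto
  thus ?thesis using False p prime_dvd_div_squarefree[OF sq c p, of "i + 1"] by (simp add: m_def prime_dvd_mult_iff)
qed

text \<open>The two subspaces differ by plane s, so the old rank is the new one plus 0 or 1
  according to e_s modulo p. A flag determines c through e_s; conversely c prescribes e_s at each p,
  while the planes above s are taken from a representative of the given X.\<close>

lemma boundary_tuples:
  assumes N: "N > 0" "squarefree N" and sn: "s + 1 < n"
    and Y: "has_tuple n N s (rev (map l [1..<n - s + 1])) Y"
  shows "{X \<in> cusps n (Gamma0 n N) (s + 1). lies_on n (Gamma0 n N) s (s + 1) Y X} =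
        {X. \<exists>c. (\<forall>i\<in>{1..n - s - 1}. c i dvd l i) \<and>
              has_tuple n N (s + 1)
                ((l (n - s) * c (n - s - 1)) #
                 rev (map (\<lambda>i. l i div c i * c (i - 1)) [2..<n - s])) X}"
proof -
  define G where "G = Gamma0 n N"
  have G: "is_subgroup n G" unfolding G_def by (rule Gamma0_subgroup)
  define K r where "K = n - s" and "r = s + 1"
  have K: "K \<ge> 2" "K - 1 = n - r" using sn by (auto simp: K_def r_def)
  have le: "s \<le> n" "r \<le> n" "s \<le> r" "s < r" "s < n" using sn by (auto simp: r_def)
  define m where "m = (\<lambda>c :: nat \<Rightarrow> nat. \<lambda>i. if i = K - 1 then l K * c (K - 1) else l (i + 1) div c (i + 1) * c i)"
  have list: "(l K * c (K - 1)) # rev (map (\<lambda>i. l i div c i * c (i - 1)) [2..<K]) = rev (map (m c) [1..<(K - 1) + 1])" for c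
    unfolding m_def by (rule boundary_tuple_list[OF K(1)])
  obtain e0 where l: "\<And>i. i \<in> {1..K} \<Longrightarrow> l i > 0 \<and> l i dvd N"
      "\<And>i j. i \<in> {1..K} \<Longrightarrow> j \<in> {1..K} \<Longrightarrow> i < j \<Longrightarrow> coprime (l i) (l j)"
    and e0: "\<And>j. idem N (e0 j)" "Y = cusp n G s (rat_mat (wm n e0))"
      "\<And>p i. prime p \<Longrightarrow> p dvd N \<Longrightarrow> i \<in> {1..K} \<Longrightarrow> p dvd l i \<longleftrightarrow> cnt p e0 s n = i"
    using Y[folded K_def, unfolded has_tuple_fun_iff[OF N le(1) K_def], folded G_def] by blast
  have sq: "squarefree (l i)" if "i \<in> {1..K}" for i using l(1)[OF that] N(2) by (auto intro: squarefree_mono)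
  have uniq: "i = j" if "i \<in> {1..K}" "j \<in> {1..K}" "prime p" "p dvd l i" "p dvd l j" for i j p
    using l(2)[of i j] l(2)[of j i] that by (metis coprime_common_divisor_nat linorder_neqE_nat not_prime_1)
  have pm: "p dvd m c i \<longleftrightarrow> (p dvd l (i + 1) \<and> (i + 1 = K \<or> \<not> p dvd c (i + 1))) \<or> p dvd c i"
    if "\<forall>i\<in>{1..K - 1}. c i dvd l i" "i \<in> {1..K - 1}" "prime p" for c i p
    unfolding m_def using that by (intro boundary_tuple_prime[OF sq]) auto
  have cs: "cnt p e s n = (if int p dvd e s then 0 else 1) + cnt p e r n" for p e
  proof -
    have "{j \<in> {s..<r}. \<not> int p dvd e j} = (if int p dvd e s then {} else {s})" by (auto simp: r_def)
    hence "cnt p e s r = (if int p dvd e s then 0 else 1)" by (simp add: cnt_def)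
    thus ?thesis using cnt_split[OF le(3,2), of p e] by simp
  qed
  have cK: "cnt p e r n \<le> K - 1" for p e using cnt_le[of p e r n] K(2) by simp
  have key: "X \<in> cusps n G r \<and> lies_on n G s r Y X \<longleftrightarrow>
    (\<exists>c. (\<forall>i\<in>{1..K - 1}. c i dvd l i) \<and> has_tuple n N r (rev (map (m c) [1..<(K - 1) + 1])) X)" for X
  proof
    assume "X \<in> cusps n G r \<and> lies_on n G s r Y X"
    then obtain \<gamma> \<rho> where \<gamma>: "\<gamma> \<in> Sp n" "\<rho> \<in> Sp r" "X = cusp n G r \<gamma>" "Y = cusp n G s (\<gamma> * xi r n \<rho>)"
      unfolding G_def lies_on_iff[OF le(2,3)] by blast
    define a where "a = \<gamma> * xi r n \<rho>"
    have a: "a \<in> Sp n" unfolding a_def by (intro Sp_mult \<gamma> xi_Sp le)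
    obtain e where e: "\<And>j. idem N (e j)" "fequiv n G {..n} (rat_mat (wm n e)) a"
      using decomposition_fequiv[OF N a] unfolding G_def by blast
    have "fequiv n G {r} \<gamma> a" unfolding a_def
      using parab_xi_ge[OF Sp_carrier[OF \<gamma>(2)] order_refl le(2)] by (intro fequiv_right[OF G \<gamma>(1) xi_Sp[OF \<gamma>(2) le(2)]]) simp
    hence X: "X = cusp n G r (rat_mat (wm n e))"
      using cusp_eq_iff[OF G le(2) \<gamma>(1) a] cusp_eq_iff[OF G le(2) rat_wm_Sp[of n e] a] fequiv_mono[OF e(2), of "{r}"] le \<gamma>(3) by simp
    have "cusp n G s (rat_mat (wm n e0)) = cusp n G s (rat_mat (wm n e))"
      using cusp_eq_iff[OF G le(1) rat_wm_Sp[of n e] a] fequiv_mono[OF e(2), of "{s}"] le e0(2) \<gamma>(4) a_def by simp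
    hence "fequiv n G {s} (rat_mat (wm n e0)) (rat_mat (wm n e))"
      using cusp_eq_iff[OF G le(1) rat_wm_Sp[of n e0] rat_wm_Sp[of n e]] by simp
    hence c0: "cnt p e0 s n = cnt p e s n" if "prime p" "p dvd N" for p
      using fequiv_wm_cnt[of n N s e0 e p] that le unfolding G_def by blast
    have le': "p dvd l i \<longleftrightarrow> cnt p e s n = i" if "prime p" "p dvd N" "i \<in> {1..K}" for p i
      using e0(3)[OF that] c0[OF that(1,2)] by simp
    \<comment> \<open>As l_i is squarefree, the gcd is the product of the primes p | l_i with e_s =
      0 modulo p, those where plane s adds nothing to the rank.\<close>
    define c where "c = (\<lambda>i. gcd (l i) (nat \<bar>e s\<bar>))"
    have pc: "p dvd c i \<longleftrightarrow> p dvd l i \<and> int p dvd e s" for p i by (simp only: c_def gcd_greatest_iff dvd_nat_abs_iff)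
    have cdl: "c i dvd l i" for i unfolding c_def by (rule gcd_dvd1)
    hence cl: "\<forall>i\<in>{1..K - 1}. c i dvd l i" by blast
    note pm = pm[OF cl]
    have mpos: "m c i > 0 \<and> m c i dvd N" if i: "i \<in> {1..K - 1}" for i
    proof -
      have ii: "i \<in> {1..K}" "i + 1 \<in> {1..K}" "i < i + 1" using i by auto
      note ci = cdl[of i] cdl[of "i + 1"]
      define d where "d = (if i = K - 1 then l (i + 1) else l (i + 1) div c (i + 1))"
      have d: "d dvd l (i + 1)" unfolding d_def using ci(2) by (auto simp: div_dvd_iff_mult dvd_div_eq_mult)
      have md: "m c i = d * c i" using i by (auto simp: m_def d_def)
      have co: "coprime d (c i)" using l(2)[OF ii] d ci(1) by (metis coprime_commute coprime_divisors)
      have "d dvd N" "c i dvd N" using l(1)[OF ii(1)] l(1)[OF ii(2)] d ci(1) by (meson dvd_trans)+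
      hence "d * c i dvd N" using co by (simp add: divides_mult)
      thus ?thesis unfolding md using N(1) by (metis dvd_0_left_iff gr0I less_irrefl)
    qed
    \<comment> \<open>By \<open>pm\<close> a common prime would divide two of the l_k with different
      indices, or e_s would be both zero and nonzero modulo it.\<close>
    have mcop: "coprime (m c i) (m c j)" if i: "i \<in> {1..K - 1}" and j: "j \<in> {1..K - 1}" and ij: "i < j" for i j
    proof (rule ccontr)
      assume "\<not> coprime (m c i) (m c j)"
      hence "gcd (m c i) (m c j) \<noteq> 1" by (simp add: coprime_iff_gcd_eq_1)
      then obtain p where p: "prime p" "p dvd m c i" "p dvd m c j" using prime_factor_nat by (metis gcd_greatest_iff)
      have i': "i \<in> {1..K}" "i + 1 \<in> {1..K}" "i + 1 \<noteq> K" "j \<in> {1..K}" "j + 1 \<in> {1..K}" using i j ij by auto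
      have "(p dvd l (i + 1) \<and> \<not> int p dvd e s) \<or> (p dvd l i \<and> int p dvd e s)"
        using p(2) unfolding pm[OF i p(1)] pc using i' by blast
      moreover have "p dvd l (j + 1) \<or> (p dvd l j \<and> int p dvd e s)"
        using p(3) unfolding pm[OF j p(1)] pc by blast
      ultimately show False
        using uniq[OF i'(2) i'(5) p(1)] uniq[OF i'(2) i'(4) p(1)] uniq[OF i'(1) i'(5) p(1)] uniq[OF i'(1) i'(4) p(1)] ij by auto
    qed
    have mcnt: "p dvd m c i \<longleftrightarrow> cnt p e r n = i" if p: "prime p" "p dvd N" and i: "i \<in> {1..K - 1}" for p i
    proof -
      have i': "i \<in> {1..K}" "i + 1 \<in> {1..K}" "K \<in> {1..K}" using i by auto
      show ?thesis
      proof (cases "int p dvd e s")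
        case True
        have "cnt p e s n = cnt p e r n" using cs[of p e] True by simp
        moreover from this have "\<not> p dvd l K" using le'[OF p i'(3)] cK[of p e] K(1) by auto
        ultimately show ?thesis unfolding pm[OF i p(1)] pc using True le'[OF p i'(1)] by auto
      next
        case False
        thus ?thesis unfolding pm[OF i p(1)] pc using le'[OF p i'(2)] cs[of p e] by auto
      qed
    qed
    have "has_tuple n N r (rev (map (m c) [1..<(K - 1) + 1])) X"
      unfolding has_tuple_fun_iff[OF N le(2) K(2)] using mpos mcop mcnt e(1) X unfolding G_def by blast
    thus "\<exists>c. (\<forall>i\<in>{1..K - 1}. c i dvd l i) \<and> has_tuple n N r (rev (map (m c) [1..<(K - 1) + 1])) X" using cl by blast
  next
    assume "\<exists>c. (\<forall>i\<in>{1..K - 1}. c i dvd l i) \<and> has_tuple n N r (rev (map (m c) [1..<(K - 1) + 1])) X"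
    then obtain c where c: "\<forall>i\<in>{1..K - 1}. c i dvd l i" "has_tuple n N r (rev (map (m c) [1..<(K - 1) + 1])) X" by blast
    note pm = pm[OF c(1)]
    obtain e1 where e1: "\<And>j. idem N (e1 j)" "X = cusp n G r (rat_mat (wm n e1))"
      "\<And>p i. prime p \<Longrightarrow> p dvd N \<Longrightarrow> i \<in> {1..K - 1} \<Longrightarrow> p dvd m c i \<longleftrightarrow> cnt p e1 r n = i"
      using c(2) unfolding has_tuple_fun_iff[OF N le(2) K(2)] G_def by blast
    \<comment> \<open>The primes at which the rank is to drop on passing to the smaller subspace;
      there plane s has to supply the missing 1.\<close>
    define Q where "Q = (\<lambda>p. p dvd l K \<or> (\<exists>i\<in>{1..K - 1}. p dvd l i \<and> \<not> p dvd c i))"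
    obtain x where x: "idem N x" "\<And>p. prime p \<Longrightarrow> p dvd N \<Longrightarrow> int p dvd x \<longleftrightarrow> \<not> Q p"
      using idem_exists[OF N(1), of Q] by blast
    \<comment> \<open>Only plane s is changed, so e still represents X.\<close>
    define e where "e = e1(s := x)"
    have ide: "idem N (e j)" for j using e1(1) x(1) by (simp add: e_def)
    have cr: "cnt p e r n = cnt p e1 r n" for p unfolding cnt_def e_def r_def
      by (rule arg_cong[of _ _ card]) auto
    have cnt_e: "cnt p e s n = (if Q p then 1 else 0) + cnt p e1 r n" if "prime p" "p dvd N" for p
      using x(2)[OF that] cs[of p e] unfolding cr by (simp add: e_def)
    have l1: "cnt p e s n = a" if p: "prime p" "p dvd N" and a: "a \<in> {1..K}" "p dvd l a" for p a
    proof -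
      have cl: "p dvd l i" if "i \<in> {1..K - 1}" "p dvd c i" for i using c(1) that by (meson dvd_trans)
      \<comment> \<open>In this order: full rank; rank kept; rank dropping to a - 1 >= 1; rank
        dropping from 1 to 0, where p divides none of the m_i.\<close>
      consider "a = K" | "a < K" "p dvd c a" | "a < K" "\<not> p dvd c a" "a \<ge> 2" | "\<not> p dvd c a" "a = 1" "a < K"
        using a(1) by fastforce
      thus ?thesis
      proof cases
        case 1
        have i: "K - 1 \<in> {1..K - 1}" "K - 1 + 1 = K" using K(1) by auto
        have "p dvd m c (K - 1)" unfolding pm[OF i(1) p(1)] i(2) using a(2) 1 by simp
        hence "cnt p e1 r n = K - 1" using e1(3)[OF p i(1)] by simp
        moreover have "Q p" using a(2) 1 by (simp add: Q_def)
        ultimately show ?thesis using cnt_e[OF p] 1 K(1) by simp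
      next
        case 2
        have i: "a \<in> {1..K - 1}" using a(1) 2 by auto
        have "p dvd m c a" unfolding pm[OF i p(1)] using 2 by simp
        hence "cnt p e1 r n = a" using e1(3)[OF p i] by simp
        moreover have "\<not> Q p"
        proof
          have sub: "K \<in> {1..K}" "{1..K - 1} \<subseteq> {1..K}" using K(1) by auto
          assume "Q p"
          thus False unfolding Q_def
          proof (elim disjE bexE conjE)
            assume "p dvd l K"
            thus False using uniq[OF a(1) sub(1) p(1) a(2)] 2 by simp
          next
            fix b assume "b \<in> {1..K - 1}" "p dvd l b" "\<not> p dvd c b"
            thus False using uniq[OF a(1) _ p(1) a(2), of b] sub(2) 2 by blast
          qed
        qed
        ultimately show ?thesis using cnt_e[OF p] by simp
      next
        case 3
        have i: "a - 1 \<in> {1..K - 1}" "a - 1 + 1 = a" using a(1) 3 by auto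
        have "p dvd m c (a - 1)" unfolding pm[OF i(1) p(1)] i(2) using a(2) 3 by simp
        hence "cnt p e1 r n = a - 1" using e1(3)[OF p i(1)] by simp
        moreover have "a \<in> {1..K - 1}" using a(1) 3 by auto
        hence "Q p" using a(2) 3 unfolding Q_def by blast
        ultimately show ?thesis using cnt_e[OF p] i(2) by simp
      next
        case 4
        have a1: "a \<in> {1..K - 1}" using 4 by auto
        have "cnt p e1 r n = 0"
        proof (rule ccontr)
          assume nz: "cnt p e1 r n \<noteq> 0"
          define k where "k = cnt p e1 r n"
          have k: "k \<in> {1..K - 1}" using nz cK[of p e1] by (auto simp: k_def)
          hence k': "k \<in> {1..K}" "k + 1 \<in> {1..K}" by auto
          have "p dvd m c k" using e1(3)[OF p k] by (simp add: k_def)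
          hence "p dvd l (k + 1) \<or> p dvd c k" unfolding pm[OF k p(1)] by blast
          thus False
          proof
            assume "p dvd l (k + 1)"
            hence "k + 1 = a" using uniq[OF k'(2) a(1) p(1)] a(2) by simp
            thus False using k 4 by simp
          next
            assume ck: "p dvd c k"
            hence "k = a" using uniq[OF k'(1) a(1) p(1) cl[OF k]] a(2) by simp
            thus False using 4 ck by simp
          qed
        qed
        moreover have "Q p" using a(2) 4 a1 unfolding Q_def by blast
        ultimately show ?thesis using cnt_e[OF p] 4 by simp
      qed
    qed
    \<comment> \<open>If p divides some l_b, then \<open>l1\<close> gives b = a. If it divides none,
      rank a would force p | m_a, although the factors of m_a divide l_a and l_(a+1).\<close>
    have l2: "p dvd l a" if p: "prime p" "p dvd N" and a: "a \<in> {1..K}" "cnt p e s n = a" for p a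
    proof (cases "\<exists>b\<in>{1..K}. p dvd l b")
      case True
      then obtain b where b: "b \<in> {1..K}" "p dvd l b" by blast
      thus ?thesis using l1[OF p b] a(2) by simp
    next
      case False
      have nl: "\<not> p dvd l b" if "b \<in> {1..K}" for b using False that by blast
      have "\<not> Q p" unfolding Q_def using nl[of K] nl K(1) by auto
      hence eq: "cnt p e1 r n = a" using cnt_e[OF p] a(2) by simp
      hence aK: "a \<in> {1..K - 1}" using a(1) cK[of p e1] by auto
      hence "p dvd m c a" using e1(3)[OF p aK] eq by simp
      hence "p dvd l (a + 1) \<or> p dvd c a" unfolding pm[OF aK p(1)] by blast
      moreover have "a + 1 \<in> {1..K}" using aK by auto
      ultimately have "p dvd c a" using nl by blast
      hence "p dvd l a" using c(1) aK by (meson dvd_trans)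
      thus ?thesis .
    qed
    have c0: "cnt p e0 s n = cnt p e s n" if p: "prime p" "p dvd N" for p
    proof (cases "cnt p e0 s n = 0 \<and> cnt p e s n = 0")
      case False
      have K0: "cnt p e0 s n \<le> K" "cnt p e s n \<le> K" using cnt_le[of p _ s n] by (auto simp: K_def)
      show ?thesis
      proof (cases "cnt p e0 s n = 0")
        case True
        hence "cnt p e s n \<in> {1..K}" using False K0 by auto
        thus ?thesis using e0(3)[OF p] l2[OF p] by blast
      next
        case F: False
        hence "cnt p e0 s n \<in> {1..K}" using K0 by auto
        thus ?thesis using e0(3)[OF p] l1[OF p] by metis
      qed
    qed simp
    have "fequiv n G {s, n} (rat_mat (wm n e0)) (rat_mat (wm n e))" unfolding G_def
      by (rule equal_cnt_fequiv[OF N le(1) order_refl e0(1) ide]) (use c0 in \<open>auto simp: cnt_def\<close>)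
    hence "fequiv n G {s} (rat_mat (wm n e0)) (rat_mat (wm n e))" by (rule fequiv_mono) simp
    hence Ye: "Y = cusp n G s (rat_mat (wm n e))"
      unfolding e0(2) using cusp_eq_iff[OF G le(1) rat_wm_Sp[of n e0] rat_wm_Sp[of n e]] by simp
    have "fequiv n G {r} (rat_mat (wm n e1)) (rat_mat (wm n e))" unfolding G_def
      by (rule equal_classes_fequiv[OF N le(2) _ e1(1) ide]) (use le in \<open>auto simp: e_def\<close>)
    hence Xe: "X = cusp n G r (rat_mat (wm n e))"
      unfolding e1(2) using cusp_eq_iff[OF G le(2) rat_wm_Sp[of n e1] rat_wm_Sp[of n e]] by simp
    \<comment> \<open>The same matrix represents both cusps, so incidence holds with \<rho> =
      1.\<close>
    have "rat_mat (wm n e) * xi r n (1\<^sub>m (2*r)) = rat_mat (wm n e)"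
      unfolding xi_one[OF le(2)] using Sp_carrier[OF rat_wm_Sp[of n e]] by simp
    hence "lies_on n G s r Y X"
      unfolding lies_on_iff[OF le(2,3), of N, folded G_def] using Ye Xe rat_wm_Sp[of n e] Sp_one[of r] by metis
    moreover have "X \<in> cusps n G r" unfolding cusps_def Xe using rat_wm_Sp by blast
    ultimately show "X \<in> cusps n G r \<and> lies_on n G s r Y X" by blast
  qed
  have "X \<in> cusps n G r \<and> lies_on n G s r Y X \<longleftrightarrow> (\<exists>c. (\<forall>i\<in>{1..K - 1}. c i dvd l i) \<and>
      has_tuple n N r ((l K * c (K - 1)) # rev (map (\<lambda>i. l i div c i * c (i - 1)) [2..<K])) X)" for X
    unfolding list by (rule key)
  thus ?thesis unfolding K_def r_def G_def by (intro Collect_cong)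
qed

text \<open>The second conjunct of (1) is the parenthetical claim about the group, with the
  conjugation taken in the rational symplectic group. In (2) the lists run from the highest index
  down, and \<open>has_tuple\<close> on the right-hand side contains that the displayed list is a
  tuple for the c in question.\<close>

theorem theorem6p3:
  fixes n N :: nat
  assumes "n > 0" and "N > 0" and "squarefree N"
  shows
    "(\<forall>r s ls \<gamma>. s \<le> r \<and> r \<le> n \<and> \<gamma> \<in> Sp n \<and>
        has_tuple n N r ls (cusp n (Gamma0 n N) r \<gamma>) \<longrightarrow>
          (\<forall>X \<in> cusps r (boundary_group n (Gamma0 n N) r \<gamma>) s.
           \<forall>Y \<in> cusps r (boundary_group n (Gamma0 n N) r \<gamma>) s.
             boundary_image n (Gamma0 n N) r \<gamma> X = boundary_image n (Gamma0 n N) r \<gamma> Y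
               \<longrightarrow> X = Y) \<and>
          (\<exists>h \<in> Sp r. boundary_group n (Gamma0 n N) r \<gamma>
                        = {h * g * minv h | g. g \<in> Gamma0 r N}))
     \<and>
     (\<forall>s l Y. s + 1 < n \<and> has_tuple n N s (rev (map l [1..<n - s + 1])) Y \<longrightarrow>
        {X \<in> cusps n (Gamma0 n N) (s + 1). lies_on n (Gamma0 n N) s (s + 1) Y X} =
        {X. \<exists>c. (\<forall>i\<in>{1..n - s - 1}. c i dvd l i) \<and>
              has_tuple n N (s + 1)
                ((l (n - s) * c (n - s - 1)) #
                 rev (map (\<lambda>i. l i div c i * c (i - 1)) [2..<n - s])) X})"
proof (rule conjI; intro allI impI)
  fix r s :: nat and ls \<gamma>
  assume a: "s \<le> r \<and> r \<le> n \<and> \<gamma> \<in> Sp n \<and> has_tuple n N r ls (cusp n (Gamma0 n N) r \<gamma>)"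
  show "(\<forall>X \<in> cusps r (boundary_group n (Gamma0 n N) r \<gamma>) s.
           \<forall>Y \<in> cusps r (boundary_group n (Gamma0 n N) r \<gamma>) s.
             boundary_image n (Gamma0 n N) r \<gamma> X = boundary_image n (Gamma0 n N) r \<gamma> Y \<longrightarrow> X = Y) \<and>
          (\<exists>h \<in> Sp r. boundary_group n (Gamma0 n N) r \<gamma> = {h * g * minv h | g. g \<in> Gamma0 r N})"
  proof (intro conjI ballI impI)
    fix X Y assume "X \<in> cusps r (boundary_group n (Gamma0 n N) r \<gamma>) s" "Y \<in> cusps r (boundary_group n (Gamma0 n N) r \<gamma>) s"
      "boundary_image n (Gamma0 n N) r \<gamma> X = boundary_image n (Gamma0 n N) r \<gamma> Y"
    thus "X = Y" using a no_self_intersection[OF assms(2,3), of s r n \<gamma> X Y] by blast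
  next
    show "\<exists>h \<in> Sp r. boundary_group n (Gamma0 n N) r \<gamma> = {h * g * minv h | g. g \<in> Gamma0 r N}"
      using a boundary_group_conjugate[OF assms(2,3), of r n \<gamma>] by blast
  qed
next
  fix s l Y
  assume a: "s + 1 < n \<and> has_tuple n N s (rev (map l [1..<n - s + 1])) Y"
  show "{X \<in> cusps n (Gamma0 n N) (s + 1). lies_on n (Gamma0 n N) s (s + 1) Y X} =
        {X. \<exists>c. (\<forall>i\<in>{1..n - s - 1}. c i dvd l i) \<and>
              has_tuple n N (s + 1)
                ((l (n - s) * c (n - s - 1)) #
                 rev (map (\<lambda>i. l i div c i * c (i - 1)) [2..<n - s])) X}"
    by (rule boundary_tuples[OF assms(2,3) conjunct1[OF a] conjunct2[OF a]])
qed

end
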